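(* Let $V$ be a finite-dimensional Hilbert space over a field $F\in\{\mathbb{R},\mathbb{C}\}$, let $G\leq\operatorname{Aut}(V)$ be a finite subgroup, and let $k$ be a positive integer. Consider the inequality $$k \;\geq\; \max_\pi \frac{n_\pi(V)-(r-1)\cdot[\pi=\mathbf{1}]}{n_\pi(R)}, \qquad ( * )$$ where the maximum is over all (finitely many) irreducible representations $\pi$ of $G$ over $F$, and $r$, $R$, $n_\pi$, $\mathbf{1}$, $[\,\cdot\,]$ are as defined in the context. (a) If $k$ does not satisfy $( * )$, then every combination of $k$ orbits of $G$ can be realized as orbits of another subgroup of $\operatorname{Aut}(V)$: for all $v_1,\dots,v_k\in V$ there exists a subgroup $H\leq\operatorname{Aut}(V)$ with $H\neq G$ such that $Gv_1,\dots,Gv_k$ are all orbits of $H$. That is, $k$ orbits fail to determine the concrete group $G$. (b) If $k$ satisfies both $k\geq[\mathbb{C}:F]$ and $( * )$, then $k$ generic orbits determine the concrete group $G$. Explicitly: for fixed $V$ and $k$ with $k\geq[\mathbb{C}:F]$, one can assign to each finite subgroup $H\leq\operatorname{Aut}(V)$ a generic subset $K_H\subseteq V^k$ such that whenever $G,H\leq \operatorname{Aut}(V)$ are finite, $k$ satisfies $( * )$ for $G$, $(v_1,\dots,v_k)\in K_G$, $(w_1,\dots,w_k)\in K_H$, and $\{Gv_1,\dots,Gv_k\}=\{Hw_1,\dots,Hw_k\}$, it holds that $G=H$ as subsets of $\operatorname{Aut}(V)$.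
   Context: $\operatorname{Aut}(V)$ is the group of linear isometries of $V$, i.e. the unitary group $\operatorname{U}(V)$ if $F=\mathbb{C}$ and the orthogonal group $\operatorname{O}(V)$ if $F=\mathbb{R}$. $Gv=\{gv: g\in G\}$ denotes the orbit of $v$. $[\mathbb{C}:F]$ is the degree of the field extension $\mathbb{C}/F$, so it equals $1$ if $F=\mathbb{C}$ and $2$ if $F=\mathbb{R}$. Genericity: a subset of a topological space $X$ is generic if it is open and dense in $X$; a condition holds for generic $x\in X$ if there is a generic subset of $X$ on which it holds. $V^k$ carries its usual topology. Representations are over $F$. $V$ is regarded as a representation of $G$ via $G\leq\operatorname{Aut}(V)$. $R$ is the regular representation of $G$ over $F$: the vector space of formal $F$-linear combinations of elements of $G$, on which $G$ acts by $g\cdot\sum_h a_h h=\sum_h a_h gh$. For an irreducible representation $\pi$, $n_\pi(W)$ denotes the multiplicity of $\pi$ in a representation $W$. $\mathbf{1}$ is the trivial irreducible representation. $r$ is the minimum dimension of a nontrivial representation (one on which $G$ does not act trivially) of the abstract group $G$ over $F$; if $G$ is the trivial group, $r=\infty$ by convention, in which case $( * )$ holds for every $k$. The Iverson bracket $[P]$ is $1$ if the statement $P$ holds and $0$ otherwise. *)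

theory Defs
  imports "HOL-Analysis.Analysis" "HOL-Algebra.Group" "HOL-Library.Function_Algebras"
begin

section \<open>The field F\<close>

text \<open>
  A type of this class is (isometrically isomorphic to) \<^typ>\<open>real\<close> or \<^typ>\<open>complex\<close>. The axioms force \<open>cj\<close> to be the identity, respectively complex conjugation.
\<close>

class real_or_complex = real_normed_field +
  fixes cj :: "'a \<Rightarrow> 'a"
  assumes cj_add: "cj (x + y) = cj x + cj y"
    and mult_cj: "x * cj x = ((norm x)\<^sup>2) *\<^sub>R 1"
    and real_or_complex:
      "(\<forall>z. \<exists>a. z = a *\<^sub>R 1) \<or> (\<exists>i. i * i = - 1 \<and> (\<forall>z. \<exists>a b. z = a *\<^sub>R 1 + b *\<^sub>R i))"

instantiation real :: real_or_complex
begin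
definition cj_real :: "real \<Rightarrow> real" where "cj_real x = x"
instance
  by standard (auto simp: cj_real_def power2_eq_square)
end

instantiation complex :: real_or_complex
begin
definition cj_complex :: "complex \<Rightarrow> complex" where "cj_complex = cnj"
instance
proof
  fix x y :: complex
  show "cj (x + y) = cj x + cj y"
    by (simp add: cj_complex_def)
  show "x * cj x = ((norm x)\<^sup>2) *\<^sub>R 1"
    by (simp add: cj_complex_def complex_norm_square[symmetric] scaleR_conv_of_real del: of_real_power)
  have "\<exists>a b. z = a *\<^sub>R 1 + b *\<^sub>R \<i>" for z :: complex
    by (rule exI[of _ "Re z"], rule exI[of _ "Im z"]) (simp add: complex_eq_iff)
  then show "(\<forall>z::complex. \<exists>a. z = a *\<^sub>R 1) \<or>
      (\<exists>i::complex. i * i = - 1 \<and> (\<forall>z. \<exists>a b. z = a *\<^sub>R 1 + b *\<^sub>R i))"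
    using i_squared by blast
qed
end

text \<open>The degree of the complex numbers over F.\<close>

definition degree_C_over :: "'f::real_or_complex itself \<Rightarrow> nat"
  where "degree_C_over _ = (if \<forall>z::'f. z \<in> \<real> then 2 else 1)"

section \<open>Finite-dimensional Hilbert spaces and their isometries\<close>

text \<open>
  The space is the whole type \<open>'v\<close>, which may be a one-element type. Finite-dimensional inner
  product spaces are automatically complete.
\<close>

locale fd_hilbert_space = vector_space smul
  for smul :: "'f::real_or_complex \<Rightarrow> 'v::ab_group_add \<Rightarrow> 'v" +
  fixes ip :: "'v \<Rightarrow> 'v \<Rightarrow> 'f"
  assumes ip_add_left: "ip (x + y) z = ip x z + ip y z"
    and ip_scale_left: "ip (smul c x) y = c * ip x y"
    and ip_commute: "ip y x = cj (ip x y)"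
    and ip_pos: "x \<noteq> 0 \<Longrightarrow> \<exists>t>0. ip x x = of_real t"
    and finite_dim: "\<exists>B. finite B \<and> span B = UNIV"

definition hnorm :: "('v \<Rightarrow> 'v \<Rightarrow> 'f::real_or_complex) \<Rightarrow> 'v \<Rightarrow> real"
  where "hnorm ip x = sqrt (norm (ip x x))"

definition htopology :: "('v::ab_group_add \<Rightarrow> 'v \<Rightarrow> 'f::real_or_complex) \<Rightarrow> 'v topology"
  where "htopology ip = Metric_space.mtopology UNIV (\<lambda>x y. hnorm ip (x - y))"

text \<open>A \<open>k\<close>-tuple is an extensional function on \<open>{..<k}\<close>.\<close>

definition htopology_pow :: "('v::ab_group_add \<Rightarrow> 'v \<Rightarrow> 'f::real_or_complex) \<Rightarrow> nat \<Rightarrow> (nat \<Rightarrow> 'v) topology"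
  where "htopology_pow ip k = product_topology (\<lambda>_. htopology ip) {..<k}"

definition generic :: "'a topology \<Rightarrow> 'a set \<Rightarrow> bool"
  where "generic X K \<longleftrightarrow> openin X K \<and> X closure_of K = topspace X"

definition Aut :: "('f::real_or_complex \<Rightarrow> 'v::ab_group_add \<Rightarrow> 'v) \<Rightarrow> ('v \<Rightarrow> 'v \<Rightarrow> 'f) \<Rightarrow> ('v \<Rightarrow> 'v) monoid"
  where "Aut smul ip =
    \<lparr>carrier = {f. Vector_Spaces.linear smul smul f \<and> bij f \<and> (\<forall>x. hnorm ip (f x) = hnorm ip x)},
     mult = (\<circ>), one = id\<rparr>"

definition orbit :: "('v \<Rightarrow> 'v) set \<Rightarrow> 'v \<Rightarrow> 'v set"
  where "orbit G v = (\<lambda>g. g v) ` G"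

section \<open>Representations\<close>

text \<open>
  The underlying space of a representation is a linear subspace \<open>spc\<close> of a vector space given by a
  type \<open>'w\<close> with scalar multiplication \<open>scl\<close>; only the values of \<open>act\<close> on \<open>spc\<close> matter.
\<close>

record ('f, 'w, 'g) rep =
  scl :: "'f \<Rightarrow> 'w \<Rightarrow> 'w"
  spc :: "'w set"
  act :: "'g \<Rightarrow> 'w \<Rightarrow> 'w"

definition is_rep :: "('g, 'm) monoid_scheme \<Rightarrow> ('f::field, 'w::ab_group_add, 'g) rep \<Rightarrow> bool"
  where "is_rep G \<pi> \<longleftrightarrow>
    vector_space (scl \<pi>) \<and> module.subspace (scl \<pi>) (spc \<pi>) \<and>
    (\<forall>g\<in>carrier G. \<forall>x\<in>spc \<pi>. act \<pi> g x \<in> spc \<pi>) \<and>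
    (\<forall>g\<in>carrier G. \<forall>x\<in>spc \<pi>. \<forall>y\<in>spc \<pi>. act \<pi> g (x + y) = act \<pi> g x + act \<pi> g y) \<and>
    (\<forall>g\<in>carrier G. \<forall>c. \<forall>x\<in>spc \<pi>. act \<pi> g (scl \<pi> c x) = scl \<pi> c (act \<pi> g x)) \<and>
    (\<forall>x\<in>spc \<pi>. act \<pi> \<one>\<^bsub>G\<^esub> x = x) \<and>
    (\<forall>g\<in>carrier G. \<forall>h\<in>carrier G. \<forall>x\<in>spc \<pi>. act \<pi> (g \<otimes>\<^bsub>G\<^esub> h) x = act \<pi> g (act \<pi> h x))"

definition subrep :: "('g, 'm) monoid_scheme \<Rightarrow> 'w set \<Rightarrow> ('f::field, 'w::ab_group_add, 'g) rep \<Rightarrow> bool"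
  where "subrep G U \<pi> \<longleftrightarrow> U \<subseteq> spc \<pi> \<and> is_rep G (\<pi>\<lparr>spc := U\<rparr>)"

definition irreducible_rep :: "('g, 'm) monoid_scheme \<Rightarrow> ('f::field, 'w::ab_group_add, 'g) rep \<Rightarrow> bool"
  where "irreducible_rep G \<pi> \<longleftrightarrow>
    is_rep G \<pi> \<and> spc \<pi> \<noteq> {0} \<and> (\<forall>U. subrep G U \<pi> \<longrightarrow> U = {0} \<or> U = spc \<pi>)"

definition rep_iso :: "('g, 'm) monoid_scheme \<Rightarrow> ('f::field, 'u::ab_group_add, 'g) rep \<Rightarrow>
    ('f, 'w::ab_group_add, 'g) rep \<Rightarrow> bool"
  where "rep_iso G \<sigma> \<pi> \<longleftrightarrow> (\<exists>T. bij_betw T (spc \<sigma>) (spc \<pi>) \<and>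
    (\<forall>x\<in>spc \<sigma>. \<forall>y\<in>spc \<sigma>. T (x + y) = T x + T y) \<and>
    (\<forall>c. \<forall>x\<in>spc \<sigma>. T (scl \<sigma> c x) = scl \<pi> c (T x)) \<and>
    (\<forall>g\<in>carrier G. \<forall>x\<in>spc \<sigma>. T (act \<sigma> g x) = act \<pi> g (T x)))"

text \<open>
  \<open>\<pi>\<close> is the internal direct sum of the irreducible subrepresentations in \<open>D\<close>. The members of a
  direct decomposition into nonzero subspaces are distinct, so a set of subspaces suffices.
\<close>

definition irreducible_decomp ::
    "('g, 'm) monoid_scheme \<Rightarrow> ('f::field, 'w::ab_group_add, 'g) rep \<Rightarrow> 'w set set \<Rightarrow> bool"
  where "irreducible_decomp G \<pi> D \<longleftrightarrow>
    finite D \<and> (\<forall>U\<in>D. subrep G U \<pi> \<and> irreducible_rep G (\<pi>\<lparr>spc := U\<rparr>)) \<and>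
    module.span (scl \<pi>) (\<Union>D) = spc \<pi> \<and>
    (\<forall>f. (\<forall>U\<in>D. f U \<in> U) \<and> (\<Sum>U\<in>D. f U) = 0 \<longrightarrow> (\<forall>U\<in>D. f U = 0))"

text \<open>
  For a finite group in characteristic 0 acting on a finite-dimensional space, a decomposition
  exists (Maschke) and the number below does not depend on it (Krull-Schmidt).
\<close>

definition multiplicity_rep :: "('g, 'm) monoid_scheme \<Rightarrow> ('f::field, 'u::ab_group_add, 'g) rep \<Rightarrow>
    ('f, 'w::ab_group_add, 'g) rep \<Rightarrow> nat"
  where "multiplicity_rep G \<sigma> \<pi> =
    (THE m. \<exists>D. irreducible_decomp G \<pi> D \<and> m = card {U\<in>D. rep_iso G \<sigma> (\<pi>\<lparr>spc := U\<rparr>)})"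

definition trivial_rep :: "('f::field, 'f, 'g) rep"
  where "trivial_rep = \<lparr>scl = (*), spc = UNIV, act = (\<lambda>_ x. x)\<rparr>"

definition fun_scale :: "'f::field \<Rightarrow> ('a \<Rightarrow> 'f) \<Rightarrow> 'a \<Rightarrow> 'f"
  where "fun_scale c a = (\<lambda>x. c * a x)"

text \<open>
  A formal linear combination \<open>\<Sum>h. a h h\<close> is the function \<open>a\<close>, which vanishes off \<open>carrier G\<close>;
  the coefficient of \<open>x\<close> in \<open>\<Sum>h. a h (g h)\<close> is \<open>a (inv g x)\<close>.
\<close>

definition regular_rep :: "('g, 'm) monoid_scheme \<Rightarrow> ('f::field, 'g \<Rightarrow> 'f, 'g) rep"
  where "regular_rep G =
    \<lparr>scl = fun_scale,
     spc = {a. \<forall>x. x \<notin> carrier G \<longrightarrow> a x = 0},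
     act = (\<lambda>g a x. if x \<in> carrier G then a (inv\<^bsub>G\<^esub> g \<otimes>\<^bsub>G\<^esub> x) else 0)\<rparr>"

text \<open>
  Quantification over all finite-dimensional representations of \<open>G\<close> over F is quantification over
  representations on subspaces of \<open>nat \<Rightarrow> 'f\<close>: up to isomorphism this is every one of them.
  An irreducible representation of a finite group is finite-dimensional.
\<close>

definition irreps :: "('g, 'm) monoid_scheme \<Rightarrow> ('f::field, nat \<Rightarrow> 'f, 'g) rep set"
  where "irreps G = {\<pi>. scl \<pi> = fun_scale \<and> irreducible_rep G \<pi>}"

text \<open>
  The number \<open>r\<close>; it is \<open>\<infinity>\<close> if there is no nontrivial representation. The library's \<open>dim\<close> is
  0 on infinite-dimensional spaces, so these are excluded explicitly.
\<close>

definition min_nontrivial_dim :: "'f::field itself \<Rightarrow> ('g, 'm) monoid_scheme \<Rightarrow> enat"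
  where "min_nontrivial_dim _ G =
    Inf {enat (vector_space.dim (scl \<pi>) (spc \<pi>)) | \<pi> :: ('f, nat \<Rightarrow> 'f, 'g) rep.
      scl \<pi> = fun_scale \<and> is_rep G \<pi> \<and>
      (\<exists>B. finite B \<and> spc \<pi> \<subseteq> module.span (scl \<pi>) B) \<and>
      \<not> (\<forall>g\<in>carrier G. \<forall>x\<in>spc \<pi>. act \<pi> g x = x)}"

section \<open>The inequality\<close>

definition natural_rep :: "('f::field \<Rightarrow> 'v::ab_group_add \<Rightarrow> 'v) \<Rightarrow> ('f, 'v, 'v \<Rightarrow> 'v) rep"
  where "natural_rep smul = \<lparr>scl = smul, spc = UNIV, act = (\<lambda>g. g)\<rparr>"

text \<open>
  The supremum runs over all representatives of the finitely many isomorphism classes of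
  irreducible representations, so it is a maximum. In \<^typ>\<open>ereal\<close>, \<open>\<infinity> * 0 = 0\<close>.
\<close>

definition orbit_bound :: "('f::real_or_complex \<Rightarrow> 'v::ab_group_add \<Rightarrow> 'v) \<Rightarrow> ('v \<Rightarrow> 'v) monoid \<Rightarrow> ereal"
  where "orbit_bound smul G =
    (SUP \<pi> \<in> (irreps G :: ('f, nat \<Rightarrow> 'f, 'v \<Rightarrow> 'v) rep set).
      (ereal (real (multiplicity_rep G \<pi> (natural_rep smul)))
        - (ereal_of_enat (min_nontrivial_dim TYPE('f) G) - 1)
          * of_bool (rep_iso G \<pi> (trivial_rep :: ('f, 'f, 'v \<Rightarrow> 'v) rep)))
      / ereal (real (multiplicity_rep G \<pi> (regular_rep G :: ('f, ('v \<Rightarrow> 'v) \<Rightarrow> 'f, 'v \<Rightarrow> 'v) rep))))"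

definition star_condition :: "('f::real_or_complex \<Rightarrow> 'v::ab_group_add \<Rightarrow> 'v) \<Rightarrow> ('v \<Rightarrow> 'v \<Rightarrow> 'f) \<Rightarrow>
    ('v \<Rightarrow> 'v) set \<Rightarrow> nat \<Rightarrow> bool"
  where "star_condition smul ip G k \<longleftrightarrow>
    ereal (real k) \<ge> orbit_bound smul ((Aut smul ip)\<lparr>carrier := G\<rparr>)"

definition finite_subgroup :: "('v \<Rightarrow> 'v) set \<Rightarrow> ('v \<Rightarrow> 'v) monoid \<Rightarrow> bool"
  where "finite_subgroup G A \<longleftrightarrow> finite G \<and> subgroup G A"

end

theory Submission
  imports Defs
begin

text \<open>
  Let \<open>W\<close> be the span of the orbits of \<open>v\<^sub>0, \<dots>, v\<^sub>k\<^sub>-\<^sub>1\<close> under \<open>G\<close> and \<open>N\<close> its orthogonal complement. The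
  orbits do not see what a group does on \<open>N\<close>, and generically they pin down what it does on \<open>W\<close>. So the
  question is how much of \<open>V\<close> has to remain in \<open>N\<close>, and which actions \<open>N\<close> admits.

  The size of \<open>N\<close> is a matter of counting. The maps \<open>x \<mapsto> (h \<mapsto> \<langle>x, h v\<^sub>i\<rangle>)\<close> are homomorphisms from \<open>V\<close> to the
  regular representation \<open>R\<close>, and \<open>N\<close> is their common kernel (\<open>coeffs\<close>). They respect isotypic components,
  so \<open>dim (V\<^sub>\<pi> \<inter> N) \<ge> dim V\<^sub>\<pi> - k dim R\<^sub>\<pi>\<close>, where \<open>dim V\<^sub>\<pi> = n\<^sub>\<pi>(V) dim \<pi>\<close> and \<open>dim R\<^sub>\<pi> = n\<^sub>\<pi>(R) dim \<pi>\<close> by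
  \<open>multiplicity_times_dim\<close>. If the inequality fails at a nontrivial \<open>\<pi>\<close>, then \<open>G\<close> acts nontrivially on \<open>N\<close>, and
  making it act trivially there gives another group with the same orbits. If it fails at \<open>\<pi> = 1\<close>, then \<open>N\<close>
  contains an \<open>r\<close>-dimensional space of fixed vectors, on which a nontrivial unitary representation of \<open>G\<close>
  can be installed instead (\<open>orbits_fail_to_determine\<close>).

  Conversely, suppose that small changes of \<open>v\<close> cannot enlarge \<open>W\<close>. If \<open>T \<subseteq> N\<close> is irreducible, then the
  above estimate must be an equality for the type of \<open>T\<close>, for otherwise moving one \<open>v\<^sub>j\<close> by a small vector
  of \<open>T\<close> would enlarge \<open>W\<close> (\<open>perturbation\<close>). Under the inequality this leaves for \<open>N\<close> only fixed vectors of
  \<open>G\<close>, and fewer than \<open>r\<close> dimensions of them (\<open>complement_fixed\<close>, \<open>complement_small\<close>).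

  On \<open>W\<close>, suppose that the numbers \<open>\<langle>g v\<^sub>i, v\<^sub>j\<rangle>\<close> distinguish the elements \<open>g\<close> of \<open>G\<close>, whenever \<open>i \<noteq> j\<close> or the field
  is complex; the assumption \<open>k \<ge> [C:F]\<close> ensures that every \<open>i\<close> has a suitable partner \<open>j\<close>. An isometry that
  preserves the orbits preserves these inner products, and so it acts on \<open>W\<close> like one element of \<open>G\<close>
  (\<open>isometry_preserving_orbits\<close>). If \<open>H\<close> has the same orbits, all of which are free, then \<open>|G| = |H|\<close>, so the two
  groups induce the same isometries of \<open>W\<close>, and \<open>H \<cong> G\<close> acts on \<open>N\<close> by a representation of \<open>G\<close> of dimension less
  than \<open>r\<close>. It is trivial, as is the action of \<open>G\<close> on \<open>N\<close>, and \<open>G = H\<close> follows.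

  Both conditions on \<open>v\<close> hold wherever a certain bounded, lower semicontinuous, integer-valued function is
  locally maximal: the dimension of \<open>W\<close>, and the number of inner products that are told apart. Local maxima of
  such a function always form an open dense set (\<open>generic_local_maxima\<close>).
\<close>

section \<open>Dimensions of subspaces\<close>

text \<open>The ambient spaces of functions are infinite-dimensional, so finiteness is a property of the subspace.\<close>

definition fin_dim :: "('a::field \<Rightarrow> 'b::ab_group_add \<Rightarrow> 'b) \<Rightarrow> 'b set \<Rightarrow> bool"
  where "fin_dim s S \<longleftrightarrow> (\<exists>B. finite B \<and> S \<subseteq> module.span s B)"

text \<open>The independence clause of \<open>irreducible_decomp\<close>, isolated because it is pure linear algebra.\<close>

definition direct_family :: "'b::ab_group_add set set \<Rightarrow> bool"
  where "direct_family D \<longleftrightarrow> (\<forall>f. (\<forall>U\<in>D. f U \<in> U) \<and> (\<Sum>U\<in>D. f U) = 0 \<longrightarrow> (\<forall>U\<in>D. f U = 0))"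

context vector_space begin

lemma fin_dim_subset: "fin_dim scale T \<Longrightarrow> S \<subseteq> T \<Longrightarrow> fin_dim scale S"
  unfolding fin_dim_def by blast

lemma fin_dim_finite_independent:
  assumes "fin_dim scale S" "independent B" "B \<subseteq> S"
  shows "finite B"
  using assms independent_span_bound unfolding fin_dim_def by blast

lemma fin_dim_basis:
  assumes "fin_dim scale S" "subspace S"
  obtains B where "finite B" "independent B" "B \<subseteq> S" "span B = S" "card B = dim S"
proof -
  obtain B where B: "B \<subseteq> S" "independent B" "S \<subseteq> span B" "card B = dim S"
    using basis_exists by blast
  moreover have "finite B" using fin_dim_finite_independent assms(1) B by blast
  moreover have "span B = S" using B assms(2) span_minimal by blast
  ultimately show thesis using that by blast
qed

lemma fin_dim_span: "finite B \<Longrightarrow> fin_dim scale (span B)"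
  unfolding fin_dim_def by blast

lemma independent_card_le:
  assumes "fin_dim scale S" "independent B" "B \<subseteq> S" "subspace S"
  shows "finite B \<and> card B \<le> dim S"
  using assms by (metis fin_dim_basis independent_span_bound)

lemma dim_mono_fin:
  assumes "fin_dim scale T" "S \<subseteq> T" "subspace S" "subspace T"
  shows "dim S \<le> dim T"
  using assms independent_card_le[of T] fin_dim_basis[of S] fin_dim_subset[of T S]
  by (metis order_trans)

lemma subspace_eq_of_dim_ge:
  assumes "fin_dim scale T" "S \<subseteq> T" "subspace S" "subspace T" "dim T \<le> dim S"
  shows "S = T"
proof -
  obtain B where B: "finite B" "independent B" "B \<subseteq> S" "span B = S" "card B = dim S"
    using fin_dim_basis[of S] fin_dim_subset assms by metis
  have "x \<in> S" if x: "x \<in> T" for x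
  proof (rule ccontr)
    assume "x \<notin> S"
    then have i: "independent (insert x B)" and "x \<notin> B"
      using B independent_insertI span_base by auto
    have "insert x B \<subseteq> T" using x B assms by auto
    with i have "card (insert x B) \<le> dim T" using independent_card_le assms by blast
    with \<open>x \<notin> B\<close> B assms show False by simp
  qed
  with assms(2) show ?thesis by blast
qed

lemma dim_0 [simp]: "dim {0} = 0"
  by (metis card.empty dim_unique empty_subsetI independent_empty insert_subset span_zero)

lemma dim_eq_0_imp:
  assumes "fin_dim scale S" "subspace S" "dim S = 0"
  shows "S = {0}"
  using subspace_eq_of_dim_ge[of S "{0}"] assms subspace_0 subspace_single_0 by auto

lemma dim_pos:
  assumes "fin_dim scale S" "subspace S" "x \<in> S" "x \<noteq> 0"
  shows "dim S > 0"
  using dim_eq_0_imp assms by blast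

lemma subspace_of_dim:
  assumes "fin_dim scale S" "subspace S" "n \<le> dim S"
  obtains U where "subspace U" "U \<subseteq> S" "dim U = n"
proof -
  obtain B where B: "finite B" "independent B" "B \<subseteq> S" "span B = S" "card B = dim S"
    using fin_dim_basis assms by metis
  obtain C where C: "C \<subseteq> B" "card C = n"
    using B assms by (metis obtain_subset_with_card_n)
  then have "dim (span C) = n"
    using B independent_mono dim_span_eq_card_independent by metis
  moreover have "span C \<subseteq> S" using C B span_mono by blast
  ultimately show thesis using that subspace_span by blast
qed

lemma direct_family_subset:
  assumes "finite D" "direct_family D" "E \<subseteq> D" "\<And>U. U \<in> D \<Longrightarrow> subspace U"
  shows "direct_family E"
  unfolding direct_family_def
proof (intro allI impI ballI)
  fix f U assume f: "(\<forall>U\<in>E. f U \<in> U) \<and> sum f E = 0" and U: "U \<in> E"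
  let ?g = "\<lambda>U. if U \<in> E then f U else 0"
  have "sum ?g D = sum f E"
    using assms(1,3) by (simp add: sum.If_cases Int_absorb1)
  moreover have "\<forall>U\<in>D. ?g U \<in> U" using f assms(4) subspace_0 by auto
  moreover have "(\<forall>U\<in>D. ?g U \<in> U) \<and> sum ?g D = 0 \<longrightarrow> (\<forall>U\<in>D. ?g U = 0)"
    using assms(2) unfolding direct_family_def by (rule spec)
  ultimately have "\<forall>U\<in>D. ?g U = 0" using f by presburger
  moreover have "U \<in> D" using U assms(3) by blast
  ultimately have "?g U = 0" by (rule bspec)
  then show "f U = 0" using U by simp
qed

lemma span_Union_sum:
  assumes "finite D" "\<And>U. U \<in> D \<Longrightarrow> subspace U" "x \<in> span (\<Union>D)"
  obtains f where "\<And>U. U \<in> D \<Longrightarrow> f U \<in> U" "x = (\<Sum>U\<in>D. f U)"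
proof -
  let ?S = "{\<Sum>U\<in>D. f U | f. \<forall>U\<in>D. f U \<in> U}"
  have "subspace ?S"
  proof (rule subspaceI)
    show "0 \<in> ?S" using assms(2) subspace_0 by (intro CollectI exI[of _ "\<lambda>_. 0"]) auto
    fix x y assume "x \<in> ?S" "y \<in> ?S"
    then obtain f g where "\<forall>U\<in>D. f U \<in> U" "x = sum f D" "\<forall>U\<in>D. g U \<in> U" "y = sum g D" by blast
    then show "x + y \<in> ?S" using assms(2) subspace_add
      by (intro CollectI exI[of _ "\<lambda>U. f U + g U"]) (auto simp: sum.distrib)
  next
    fix c x assume "x \<in> ?S"
    then obtain f where "\<forall>U\<in>D. f U \<in> U" "x = sum f D" by blast
    then show "scale c x \<in> ?S" using assms(2) subspace_scale
      by (intro CollectI exI[of _ "\<lambda>U. scale c (f U)"]) (auto simp: scale_sum_right)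
  qed
  moreover have "\<Union>D \<subseteq> ?S"
  proof
    fix y assume "y \<in> \<Union>D"
    then obtain U where U: "U \<in> D" "y \<in> U" by blast
    have "(\<Sum>U'\<in>D. if U' = U then y else 0) = y" using assms(1) U by simp
    then show "y \<in> ?S" using U assms(2) subspace_0
      by (intro CollectI exI[of _ "\<lambda>U'. if U' = U then y else 0"]) auto
  qed
  ultimately have "span (\<Union>D) \<subseteq> ?S" by (simp add: span_minimal)
  with assms(3) that show thesis by blast
qed

text \<open>Bases of the members are disjoint, since a common vector would give a relation between two members; they unite to a basis of the span.\<close>

lemma dim_direct_family:
  assumes D: "finite D" "direct_family D" and sub: "\<And>U. U \<in> D \<Longrightarrow> subspace U"
    and fin: "\<And>U. U \<in> D \<Longrightarrow> fin_dim scale U"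
  shows "dim (span (\<Union>D)) = (\<Sum>U\<in>D. dim U)"
proof -
  have "\<forall>U\<in>D. \<exists>B. finite B \<and> independent B \<and> B \<subseteq> U \<and> span B = U \<and> card B = dim U"
    using fin_dim_basis sub fin by metis
  then obtain B where B: "\<And>U. U \<in> D \<Longrightarrow> finite (B U) \<and> independent (B U) \<and> B U \<subseteq> U \<and>
      span (B U) = U \<and> card (B U) = dim U"
    by metis
  have zero: "f U = 0" if "\<And>U. U \<in> D \<Longrightarrow> f U \<in> U" "(\<Sum>U\<in>D. f U) = 0" "U \<in> D" for f U
    using D(2) that unfolding direct_family_def by blast
  have disj: "B U \<inter> B U' = {}" if U: "U \<in> D" "U' \<in> D" "U \<noteq> U'" for U U'
  proof (rule ccontr)
    assume "B U \<inter> B U' \<noteq> {}"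
    then obtain b where b: "b \<in> B U" "b \<in> B U'" by blast
    let ?f = "\<lambda>X. (if X = U then b else 0) - (if X = U' then b else 0)"
    have mem: "b \<in> U" "b \<in> U'" using b B U by blast+
    have "?f U = 0"
    proof (rule zero[of ?f])
      show "?f X \<in> X" if "X \<in> D" for X
        using that mem sub[OF that] U by (auto intro: subspace_0 subspace_neg)
      show "(\<Sum>X\<in>D. ?f X) = 0" using D(1) U by (simp add: sum_subtractf)
    qed fact
    then have "b = 0" using U by simp
    with b B U dependent_zero show False by blast
  qed
  let ?B = "\<Union>(B ` D)"
  have finB: "finite ?B" using D B by blast
  have sumB: "(\<Sum>b\<in>?B. h b) = (\<Sum>U\<in>D. \<Sum>b\<in>B U. h b)" for h :: "'b \<Rightarrow> 'b"
    by (rule sum.UNION_disjoint) (use D B disj in auto)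
  have "independent ?B"
  proof (rule independent_if_scalars_zero[OF finB])
    fix c x assume s: "(\<Sum>b\<in>?B. scale (c b) b) = 0" and x: "x \<in> ?B"
    then obtain U where U: "U \<in> D" "x \<in> B U" by blast
    have "(\<Sum>b\<in>B U. scale (c b) b) = 0"
    proof (rule zero[of "\<lambda>U. \<Sum>b\<in>B U. scale (c b) b"])
      show "(\<Sum>b\<in>B X. scale (c b) b) \<in> X" if "X \<in> D" for X
        using B[OF that] sub[OF that] by (intro subspace_sum subspace_scale) auto
      show "(\<Sum>U\<in>D. \<Sum>b\<in>B U. scale (c b) b) = 0" using s sumB by simp
    qed fact
    then show "c x = 0" using independentD[of "B U" "B U" c x] U B[OF U(1)] by simp
  qed
  moreover have "span ?B = span (\<Union>D)"
  proof
    show "span ?B \<subseteq> span (\<Union>D)" using B by (intro span_mono) blast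
    have "U \<subseteq> span ?B" if "U \<in> D" for U
      using B that span_mono[of "B U" ?B] by blast
    then show "span (\<Union>D) \<subseteq> span ?B" by (intro span_minimal) auto
  qed
  ultimately have "dim (span (\<Union>D)) = card ?B" by (metis dim_span_eq_card_independent)
  also have "\<dots> = (\<Sum>U\<in>D. card (B U))"
    by (rule card_UN_disjoint) (use D B disj in auto)
  also have "\<dots> = (\<Sum>U\<in>D. dim U)" using B by simp
  finally show ?thesis .
qed

end

context vector_space_pair begin

text \<open>A basis of the kernel in \<open>S\<close> extends to a basis of \<open>S\<close>, and the added vectors are mapped to a basis of the image.\<close>

lemma rank_nullity:
  assumes f: "Vector_Spaces.linear s1 s2 f" and S: "vs1.subspace S" "fin_dim s1 S"
  shows "vs1.dim S = vs1.dim {x\<in>S. f x = 0} + vs2.dim (f ` S)"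
proof -
  let ?K = "{x\<in>S. f x = 0}"
  have K: "vs1.subspace ?K"
    by (intro vs1.subspaceI) (auto simp: vs1.subspace_0 vs1.subspace_add vs1.subspace_scale S
        linear_0[OF f] linear_add[OF f] linear_scale[OF f])
  obtain A where A: "finite A" "vs1.independent A" "A \<subseteq> ?K" "vs1.span A = ?K" "card A = vs1.dim ?K"
    using vs1.fin_dim_basis[OF vs1.fin_dim_subset[OF S(2)] K] by blast
  have "A \<subseteq> S" using A by blast
  then obtain B where B: "A \<subseteq> B" "B \<subseteq> S" "vs1.independent B" "S \<subseteq> vs1.span B"
    using vs1.maximal_independent_subset_extend A(2) by metis
  have finB: "finite B" using B S vs1.fin_dim_finite_independent by blast
  have dimS: "vs1.dim S = card B" using B vs1.dim_unique by blast
  let ?C = "B - A"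
  have inj: "inj_on f (vs1.span ?C)"
    unfolding linear_inj_on_iff_eq_0[OF f vs1.subspace_span]
  proof (intro ballI impI)
    fix x assume x: "x \<in> vs1.span ?C" "f x = 0"
    have "x \<in> S" using x B vs1.span_mono[of ?C S] S(1) vs1.span_minimal[of ?C S] by blast
    then have "x \<in> vs1.span A" using A x by blast
    then obtain u where u: "x = (\<Sum>v\<in>A. s1 (u v) v)"
      using vs1.span_finite A(1) by auto
    obtain w where w: "x = (\<Sum>v\<in>?C. s1 (w v) v)"
      using x vs1.span_finite[of ?C] finB by auto
    let ?c = "\<lambda>v. if v \<in> A then - u v else w v"
    have "(\<Sum>v\<in>B. s1 (?c v) v) = (\<Sum>v\<in>?C. s1 (?c v) v) + (\<Sum>v\<in>A. s1 (?c v) v)"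
      by (rule sum.subset_diff) (use B finB in auto)
    also have "(\<Sum>v\<in>A. s1 (?c v) v) = - x"
      unfolding u by (simp add: sum_negf vs1.scale_minus_left)
    also have "(\<Sum>v\<in>?C. s1 (?c v) v) = x" unfolding w by (rule sum.cong) auto
    finally have "(\<Sum>v\<in>B. s1 (?c v) v) = 0" by simp
    then have "?c v = 0" if "v \<in> B" for v
      using vs1.independentD[OF B(3) finB order.refl, of ?c v] that by blast
    then have "\<And>v. v \<in> ?C \<Longrightarrow> w v = 0" by fastforce
    then show "x = 0" unfolding w by simp
  qed
  have "vs2.independent (f ` ?C)"
    by (rule linear_independent_injective_image[OF f _ inj])
      (rule vs1.independent_mono[OF B(3)], blast)
  moreover have "f ` ?C \<subseteq> f ` S" using B by blast
  moreover have "f ` S \<subseteq> vs2.span (f ` ?C)"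
  proof -
    have "f ` S \<subseteq> f ` vs1.span B" using B by blast
    also have "\<dots> = vs2.span (f ` B)" using linear_span_image[OF f] by simp
    also have "\<dots> \<subseteq> vs2.span (f ` ?C)"
    proof (rule vs2.span_minimal)
      show "f ` B \<subseteq> vs2.span (f ` ?C)"
      proof safe
        fix b assume b: "b \<in> B"
        show "f b \<in> vs2.span (f ` ?C)"
        proof (cases "b \<in> A")
          case True
          then have "f b = 0" using A(3) by blast
          then show ?thesis using vs2.span_zero by simp
        next
          case False
          then show ?thesis using b by (intro vs2.span_base) blast
        qed
      qed
    qed simp
    finally show ?thesis .
  qed
  ultimately have "vs2.dim (f ` S) = card (f ` ?C)" by (intro vs2.dim_unique) auto
  also have "\<dots> = card ?C"
    using inj vs1.span_superset by (metis card_image inj_on_subset)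
  finally have "vs2.dim (f ` S) = card B - card A"
    using A B by (simp add: card_Diff_subset)
  moreover have "card A \<le> card B" using B finB card_mono by blast
  ultimately show ?thesis using dimS A by simp
qed

lemma fin_dim_image:
  assumes "Vector_Spaces.linear s1 s2 f" "fin_dim s1 S"
  shows "fin_dim s2 (f ` S)"
proof -
  obtain B where B: "finite B" "S \<subseteq> vs1.span B" using assms(2) fin_dim_def by blast
  have "f ` S \<subseteq> vs2.span (f ` B)"
    using B linear_span_image[OF assms(1)] by blast
  then show ?thesis unfolding fin_dim_def using B by (intro exI[of _ "f ` B"]) simp
qed

text \<open>Homomorphisms of representations are meaningful only on the space of the representation; an extension brings them
  into the scope of the theory of linear maps. It is obtained by prescribing the values on a basis of \<open>S\<close>.\<close>

lemma linear_extension_from_subspace: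
  assumes S: "vs1.subspace S" and add: "\<And>x y. x \<in> S \<Longrightarrow> y \<in> S \<Longrightarrow> T (x + y) = T x + T y"
    and scl: "\<And>c x. x \<in> S \<Longrightarrow> T (s1 c x) = s2 c (T x)"
  obtains f where "Vector_Spaces.linear s1 s2 f" "\<And>x. x \<in> S \<Longrightarrow> f x = T x"
proof -
  obtain B where B: "B \<subseteq> S" "vs1.independent B" "S \<subseteq> vs1.span B"
    by (rule vs1.basis_exists)
  let ?f = "construct B T"
  have lin: "Vector_Spaces.linear s1 s2 ?f" by (rule linear_construct[OF B(2)])
  have 0: "T 0 = 0" using scl[of 0 0] vs1.subspace_0[OF S] by simp
  have "vs1.subspace {x\<in>S. ?f x = T x}"
    by (intro vs1.subspaceI) (auto simp: vs1.subspace_0 vs1.subspace_add vs1.subspace_scale S add scl 0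
        linear_0[OF lin] linear_add[OF lin] linear_scale[OF lin])
  moreover have "B \<subseteq> {x\<in>S. ?f x = T x}" using B construct_basis by auto
  ultimately have "vs1.span B \<subseteq> {x\<in>S. ?f x = T x}" by (simp add: vs1.span_minimal)
  then have "?f x = T x" if "x \<in> S" for x using that B by blast
  then show thesis by (rule that[OF lin])
qed

lemma dim_eq_of_linear_bij:
  assumes S: "vs1.subspace S" and add: "\<And>x y. x \<in> S \<Longrightarrow> y \<in> S \<Longrightarrow> T (x + y) = T x + T y"
    and scl: "\<And>c x. x \<in> S \<Longrightarrow> T (s1 c x) = s2 c (T x)" and bij: "bij_betw T S S'"
  shows "vs2.dim S' = vs1.dim S" "fin_dim s1 S \<Longrightarrow> fin_dim s2 S'"
proof -
  obtain f where f: "Vector_Spaces.linear s1 s2 f" "\<And>x. x \<in> S \<Longrightarrow> f x = T x"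
    by (rule linear_extension_from_subspace[of S T]) (use S add scl in auto)
  have inj: "inj_on f S" using bij f unfolding bij_betw_def inj_on_def by simp
  have img: "f ` S = S'" using bij f unfolding bij_betw_def by force
  obtain B where B: "B \<subseteq> S" "vs1.independent B" "S \<subseteq> vs1.span B" "card B = vs1.dim S"
    by (rule vs1.basis_exists)
  have span: "vs1.span B = S" using B S vs1.span_minimal by blast
  have "vs2.independent (f ` B)"
    using linear_independent_injective_image[OF f(1) B(2)] span inj by simp
  moreover have "vs2.span (f ` B) = S'"
    using linear_span_image[OF f(1), of B] span img by simp
  ultimately have "vs2.dim S' = card (f ` B)"
    using vs2.dim_span_eq_card_independent[of "f ` B"] by simp
  then show "vs2.dim S' = vs1.dim S"
    using B(4) card_image[OF inj_on_subset[OF inj B(1)]] by simp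
  show "fin_dim s2 S'" if "fin_dim s1 S"
    using fin_dim_image[OF f(1) that] img by simp
qed

end

section \<open>Homomorphisms of representations\<close>

definition rep_hom :: "('g, 'm) monoid_scheme \<Rightarrow> ('f::field, 'u::ab_group_add, 'g) rep \<Rightarrow>
    ('f, 'w::ab_group_add, 'g) rep \<Rightarrow> ('u \<Rightarrow> 'w) \<Rightarrow> bool"
  where "rep_hom G \<sigma> \<pi> T \<longleftrightarrow>
    (\<forall>x\<in>spc \<sigma>. T x \<in> spc \<pi>) \<and>
    (\<forall>x\<in>spc \<sigma>. \<forall>y\<in>spc \<sigma>. T (x + y) = T x + T y) \<and>
    (\<forall>c. \<forall>x\<in>spc \<sigma>. T (scl \<sigma> c x) = scl \<pi> c (T x)) \<and>
    (\<forall>g\<in>carrier G. \<forall>x\<in>spc \<sigma>. T (act \<sigma> g x) = act \<pi> g (T x))"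

lemma rep_iso_iff: "rep_iso G \<sigma> \<pi> \<longleftrightarrow> (\<exists>T. rep_hom G \<sigma> \<pi> T \<and> bij_betw T (spc \<sigma>) (spc \<pi>))"
  proof
  assume "rep_iso G \<sigma> \<pi>"
  then obtain T where "bij_betw T (spc \<sigma>) (spc \<pi>)"
      "(\<forall>x\<in>spc \<sigma>. \<forall>y\<in>spc \<sigma>. T (x + y) = T x + T y) \<and> (\<forall>c. \<forall>x\<in>spc \<sigma>. T (scl \<sigma> c x) = scl \<pi> c (T x)) \<and>
      (\<forall>g\<in>carrier G. \<forall>x\<in>spc \<sigma>. T (act \<sigma> g x) = act \<pi> g (T x))"
    unfolding rep_iso_def by blast
  then show "\<exists>T. rep_hom G \<sigma> \<pi> T \<and> bij_betw T (spc \<sigma>) (spc \<pi>)"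
    by (intro exI[of _ T]) (simp add: rep_hom_def bij_betwE)
qed (auto simp: rep_iso_def rep_hom_def)

lemma rep_homD:
  assumes "rep_hom G \<sigma> \<pi> T"
  shows "x \<in> spc \<sigma> \<Longrightarrow> T x \<in> spc \<pi>"
    "x \<in> spc \<sigma> \<Longrightarrow> y \<in> spc \<sigma> \<Longrightarrow> T (x + y) = T x + T y"
    "x \<in> spc \<sigma> \<Longrightarrow> T (scl \<sigma> c x) = scl \<pi> c (T x)"
    "g \<in> carrier G \<Longrightarrow> x \<in> spc \<sigma> \<Longrightarrow> T (act \<sigma> g x) = act \<pi> g (T x)"
  using assms unfolding rep_hom_def by blast+

lemma rep_homI:
  assumes "\<And>x. x \<in> spc \<sigma> \<Longrightarrow> T x \<in> spc \<pi>"
    "\<And>x y. x \<in> spc \<sigma> \<Longrightarrow> y \<in> spc \<sigma> \<Longrightarrow> T (x + y) = T x + T y"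
    "\<And>c x. x \<in> spc \<sigma> \<Longrightarrow> T (scl \<sigma> c x) = scl \<pi> c (T x)"
    "\<And>g x. g \<in> carrier G \<Longrightarrow> x \<in> spc \<sigma> \<Longrightarrow> T (act \<sigma> g x) = act \<pi> g (T x)"
  shows "rep_hom G \<sigma> \<pi> T"
  using assms unfolding rep_hom_def by blast

lemma is_repD:
  assumes "is_rep G \<pi>"
  shows "vector_space (scl \<pi>)" "module.subspace (scl \<pi>) (spc \<pi>)"
    "g \<in> carrier G \<Longrightarrow> x \<in> spc \<pi> \<Longrightarrow> act \<pi> g x \<in> spc \<pi>"
    "g \<in> carrier G \<Longrightarrow> x \<in> spc \<pi> \<Longrightarrow> y \<in> spc \<pi> \<Longrightarrow> act \<pi> g (x + y) = act \<pi> g x + act \<pi> g y"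
    "g \<in> carrier G \<Longrightarrow> x \<in> spc \<pi> \<Longrightarrow> act \<pi> g (scl \<pi> c x) = scl \<pi> c (act \<pi> g x)"
    "x \<in> spc \<pi> \<Longrightarrow> act \<pi> \<one>\<^bsub>G\<^esub> x = x"
    "g \<in> carrier G \<Longrightarrow> h \<in> carrier G \<Longrightarrow> x \<in> spc \<pi> \<Longrightarrow> act \<pi> (g \<otimes>\<^bsub>G\<^esub> h) x = act \<pi> g (act \<pi> h x)"
  using assms unfolding is_rep_def by simp_all

lemma is_repI:
  assumes "vector_space (scl \<pi>)" "module.subspace (scl \<pi>) (spc \<pi>)"
    "\<And>g x. g \<in> carrier G \<Longrightarrow> x \<in> spc \<pi> \<Longrightarrow> act \<pi> g x \<in> spc \<pi>"
    "\<And>g x y. g \<in> carrier G \<Longrightarrow> x \<in> spc \<pi> \<Longrightarrow> y \<in> spc \<pi> \<Longrightarrow> act \<pi> g (x + y) = act \<pi> g x + act \<pi> g y"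
    "\<And>g c x. g \<in> carrier G \<Longrightarrow> x \<in> spc \<pi> \<Longrightarrow> act \<pi> g (scl \<pi> c x) = scl \<pi> c (act \<pi> g x)"
    "\<And>x. x \<in> spc \<pi> \<Longrightarrow> act \<pi> \<one>\<^bsub>G\<^esub> x = x"
    "\<And>g h x. g \<in> carrier G \<Longrightarrow> h \<in> carrier G \<Longrightarrow> x \<in> spc \<pi> \<Longrightarrow> act \<pi> (g \<otimes>\<^bsub>G\<^esub> h) x = act \<pi> g (act \<pi> h x)"
  shows "is_rep G \<pi>"
  using assms unfolding is_rep_def by simp

lemma subrep_iff:
  assumes "is_rep G \<pi>"
  shows "subrep G U \<pi> \<longleftrightarrow> U \<subseteq> spc \<pi> \<and> module.subspace (scl \<pi>) U \<and> (\<forall>g\<in>carrier G. \<forall>x\<in>U. act \<pi> g x \<in> U)"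
  using is_repD[OF assms] unfolding subrep_def is_rep_def by (auto simp: subset_iff)

lemma is_rep_restrict: "subrep G U \<pi> \<Longrightarrow> is_rep G (\<pi>\<lparr>spc := U\<rparr>)"
  unfolding subrep_def by blast

lemma subrep_restrict: "subrep G U \<pi> \<Longrightarrow> V \<subseteq> U \<Longrightarrow> subrep G V (\<pi>\<lparr>spc := U\<rparr>) \<longleftrightarrow> subrep G V \<pi>"
  unfolding subrep_def by auto

lemma subrep_refl: "is_rep G \<pi> \<Longrightarrow> subrep G (spc \<pi>) \<pi>"
  unfolding subrep_def by simp

lemma (in group) act_inv:
  assumes "is_rep G \<pi>" "g \<in> carrier G" "x \<in> spc \<pi>"
  shows "act \<pi> (inv g) (act \<pi> g x) = x" "act \<pi> g (act \<pi> (inv g) x) = x"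
  using is_repD(7)[OF assms(1), of "inv g" g x] is_repD(7)[OF assms(1), of g "inv g" x]
    is_repD(6)[OF assms(1,3)] assms by (simp_all add: r_inv l_inv)

lemma rep_hom_comp:
  assumes "rep_hom G \<sigma> \<pi> T" "rep_hom G \<pi> \<rho> S"
  shows "rep_hom G \<sigma> \<rho> (S \<circ> T)"
  using assms unfolding rep_hom_def by simp

lemma rep_hom_zero:
  assumes "is_rep G \<sigma>" "is_rep G \<pi>" "rep_hom G \<sigma> \<pi> T"
  shows "T 0 = 0"
proof -
  interpret s: vector_space "scl \<sigma>" using is_repD(1) assms(1) .
  interpret p: vector_space "scl \<pi>" using is_repD(1) assms(2) .
  have "0 \<in> spc \<sigma>" using s.subspace_0 is_repD(2) assms(1) by blast
  from rep_homD(3)[OF assms(3) this, of 0] show ?thesis by simp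
qed

lemma rep_hom_kernel:
  assumes "is_rep G \<sigma>" "is_rep G \<pi>" "rep_hom G \<sigma> \<pi> T"
  shows "subrep G {x\<in>spc \<sigma>. T x = 0} \<sigma>"
proof -
  interpret s: vector_space "scl \<sigma>" using is_repD(1) assms(1) .
  interpret p: vector_space "scl \<pi>" using is_repD(1) assms(2) .
  have sub: "s.subspace (spc \<sigma>)" using is_repD(2) assms(1) .
  have z: "act \<pi> g 0 = 0" if "g \<in> carrier G" for g
    using is_repD(5)[OF assms(2) that, of 0 0] p.subspace_0[OF is_repD(2)[OF assms(2)]] by simp
  have "s.subspace {x\<in>spc \<sigma>. T x = 0}"
    using sub rep_homD[OF assms(3)] rep_hom_zero[OF assms]
    by (auto simp: s.subspace_def)
  then show ?thesis
    unfolding subrep_iff[OF assms(1)]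
    using is_repD(3)[OF assms(1)] rep_homD(4)[OF assms(3)] z by auto
qed

lemma rep_hom_image:
  assumes "is_rep G \<sigma>" "is_rep G \<pi>" "rep_hom G \<sigma> \<pi> T"
  shows "subrep G (T ` spc \<sigma>) \<pi>"
proof -
  interpret s: vector_space "scl \<sigma>" using is_repD(1) assms(1) .
  interpret p: vector_space "scl \<pi>" using is_repD(1) assms(2) .
  have sub: "s.subspace (spc \<sigma>)" using is_repD(2) assms(1) .
  have "p.subspace (T ` spc \<sigma>)"
  proof (rule p.subspaceI)
    show "0 \<in> T ` spc \<sigma>" using rep_hom_zero[OF assms] s.subspace_0[OF sub] by force
    fix x y assume "x \<in> T ` spc \<sigma>" "y \<in> T ` spc \<sigma>"
    then obtain a b where "a \<in> spc \<sigma>" "b \<in> spc \<sigma>" "x = T a" "y = T b" by blast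
    then show "x + y \<in> T ` spc \<sigma>"
      using s.subspace_add[OF sub] rep_homD(2)[OF assms(3)] by (metis imageI)
  next
    fix c x assume "x \<in> T ` spc \<sigma>"
    then show "scl \<pi> c x \<in> T ` spc \<sigma>"
      using s.subspace_scale[OF sub] rep_homD(3)[OF assms(3)] by (metis (no_types, lifting) imageE imageI)
  qed
  moreover have "act \<pi> g y \<in> T ` spc \<sigma>" if "g \<in> carrier G" "y \<in> T ` spc \<sigma>" for g y
    using that rep_homD(4)[OF assms(3)] is_repD(3)[OF assms(1)] by (metis (no_types, lifting) imageE imageI)
  ultimately show ?thesis
    unfolding subrep_iff[OF assms(2)] using rep_homD(1)[OF assms(3)] by blast
qed

lemma rep_hom_inj:
  assumes "is_rep G \<sigma>" "is_rep G \<pi>" "rep_hom G \<sigma> \<pi> T"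
    and ker: "\<And>x. x \<in> spc \<sigma> \<Longrightarrow> T x = 0 \<Longrightarrow> x = 0"
  shows "inj_on T (spc \<sigma>)"
proof (rule inj_onI)
  fix x y assume xy: "x \<in> spc \<sigma>" "y \<in> spc \<sigma>" "T x = T y"
  interpret s: vector_space "scl \<sigma>" using is_repD(1) assms(1) .
  interpret p: vector_space "scl \<pi>" using is_repD(1) assms(2) .
  have sub: "s.subspace (spc \<sigma>)" using is_repD(2) assms(1) .
  have "T (x + scl \<sigma> (-1) y) = T x + scl \<pi> (-1) (T y)"
    using rep_homD(2)[OF assms(3) xy(1) s.subspace_scale[OF sub xy(2)]] rep_homD(3)[OF assms(3) xy(2)] by metis
  also have "\<dots> = 0" using xy by simp
  finally have "x + scl \<sigma> (-1) y = 0"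
    using ker s.subspace_add[OF sub xy(1) s.subspace_scale[OF sub xy(2)]] by blast
  then show "x = y" by simp
qed

lemma schur:
  assumes "irreducible_rep G \<sigma>" "irreducible_rep G \<pi>" "rep_hom G \<sigma> \<pi> T"
    and "x \<in> spc \<sigma>" "T x \<noteq> 0"
  shows "bij_betw T (spc \<sigma>) (spc \<pi>)"
proof -
  have s: "is_rep G \<sigma>" and p: "is_rep G \<pi>" using assms unfolding irreducible_rep_def by blast+
  note k = rep_hom_kernel[OF s p assms(3)] and i = rep_hom_image[OF s p assms(3)]
  from assms(1) k have "{x\<in>spc \<sigma>. T x = 0} = {0} \<or> {x\<in>spc \<sigma>. T x = 0} = spc \<sigma>"
    unfolding irreducible_rep_def by blast
  then have "{x\<in>spc \<sigma>. T x = 0} = {0}" using assms(4,5) by blast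
  then have "inj_on T (spc \<sigma>)" by (intro rep_hom_inj[OF s p assms(3)]) blast
  moreover have "T ` spc \<sigma> = {0} \<or> T ` spc \<sigma> = spc \<pi>"
    using i assms(2) unfolding irreducible_rep_def by blast
  ultimately show ?thesis using assms(4,5) unfolding bij_betw_def by blast
qed

lemma rep_iso_sym:
  assumes "is_rep G \<sigma>" "rep_iso G \<sigma> \<pi>"
  shows "rep_iso G \<pi> \<sigma>"
proof -
  obtain T where T: "rep_hom G \<sigma> \<pi> T" "bij_betw T (spc \<sigma>) (spc \<pi>)"
    using assms(2) unfolding rep_iso_iff by blast
  interpret s: vector_space "scl \<sigma>" using is_repD(1) assms(1) .
  have sub: "s.subspace (spc \<sigma>)" using is_repD(2) assms(1) .
  let ?S = "inv_into (spc \<sigma>) T"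
  have S: "bij_betw ?S (spc \<pi>) (spc \<sigma>)" by (rule bij_betw_inv_into[OF T(2)])
  have mem: "?S y \<in> spc \<sigma>" and TS: "T (?S y) = y" if "y \<in> spc \<pi>" for y
    using that T(2) bij_betw_inv_into_right[OF T(2)] bij_betwE[OF S] by blast+
  have eq: "?S (T x) = x" if "x \<in> spc \<sigma>" for x
    using bij_betw_inv_into_left[OF T(2) that] .
  have "rep_hom G \<pi> \<sigma> ?S"
  proof (rule rep_homI)
    fix x y assume xy: "x \<in> spc \<pi>" "y \<in> spc \<pi>"
    have "x + y = T (?S x + ?S y)" using rep_homD(2)[OF T(1) mem mem] TS xy by simp
    then show "?S (x + y) = ?S x + ?S y" using eq s.subspace_add[OF sub] mem xy by simp
  next
    fix c x assume x: "x \<in> spc \<pi>"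
    have "scl \<pi> c x = T (scl \<sigma> c (?S x))" using rep_homD(3)[OF T(1) mem] TS x by simp
    then show "?S (scl \<pi> c x) = scl \<sigma> c (?S x)" using eq s.subspace_scale[OF sub] mem x by simp
  next
    fix g x assume g: "g \<in> carrier G" and x: "x \<in> spc \<pi>"
    have "act \<pi> g x = T (act \<sigma> g (?S x))" using rep_homD(4)[OF T(1) g mem] TS x by simp
    then show "?S (act \<pi> g x) = act \<sigma> g (?S x)" using eq is_repD(3)[OF assms(1) g] mem x by simp
  qed (use mem in auto)
  with S show ?thesis unfolding rep_iso_iff by blast
qed

lemma rep_iso_trans:
  assumes "rep_iso G \<sigma> \<pi>" "rep_iso G \<pi> \<rho>"
  shows "rep_iso G \<sigma> \<rho>"
  using assms unfolding rep_iso_iff by (metis rep_hom_comp bij_betw_trans)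

lemma rep_iso_dim:
  assumes "is_rep G \<sigma>" "is_rep G \<pi>" "rep_iso G \<sigma> \<pi>"
  shows "vector_space.dim (scl \<pi>) (spc \<pi>) = vector_space.dim (scl \<sigma>) (spc \<sigma>)"
    "fin_dim (scl \<sigma>) (spc \<sigma>) \<Longrightarrow> fin_dim (scl \<pi>) (spc \<pi>)"
proof -
  obtain T where T: "rep_hom G \<sigma> \<pi> T" "bij_betw T (spc \<sigma>) (spc \<pi>)"
    using assms(3) unfolding rep_iso_iff by blast
  interpret s: vector_space "scl \<sigma>" using is_repD(1) assms(1) .
  interpret p: vector_space "scl \<pi>" using is_repD(1) assms(2) .
  interpret vector_space_pair "scl \<sigma>" "scl \<pi>" ..
  note l = dim_eq_of_linear_bij[OF is_repD(2)[OF assms(1)] rep_homD(2)[OF T(1)] rep_homD(3)[OF T(1)] T(2)]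
  show "p.dim (spc \<pi>) = s.dim (spc \<sigma>)" by (rule l(1))
  show "fin_dim (scl \<sigma>) (spc \<sigma>) \<Longrightarrow> fin_dim (scl \<pi>) (spc \<pi>)" by (rule l(2))
qed

lemma rep_iso_irreducible:
  assumes "irreducible_rep G \<sigma>" "is_rep G \<pi>" "rep_iso G \<sigma> \<pi>"
  shows "irreducible_rep G \<pi>"
proof -
  have s: "is_rep G \<sigma>" using assms unfolding irreducible_rep_def by blast
  interpret p: vector_space "scl \<pi>" using is_repD(1) assms(2) .
  obtain S where S: "rep_hom G \<pi> \<sigma> S" "bij_betw S (spc \<pi>) (spc \<sigma>)"
    using rep_iso_sym[OF s assms(3)] unfolding rep_iso_iff by blast
  have z: "S 0 = 0" by (rule rep_hom_zero[OF assms(2) s S(1)])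
  have z0: "0 \<in> spc \<pi>" using p.subspace_0 is_repD(2)[OF assms(2)] by blast
  have "U = {0} \<or> U = spc \<pi>" if U: "subrep G U \<pi>" for U
  proof -
    have Us: "U \<subseteq> spc \<pi>" using U unfolding subrep_def by blast
    have "rep_hom G (\<pi>\<lparr>spc := U\<rparr>) \<sigma> S" using S(1) Us unfolding rep_hom_def by (simp add: subset_iff)
    from rep_hom_image[OF is_rep_restrict[OF U] s this] have "subrep G (S ` U) \<sigma>" by simp
    then have "S ` U = {0} \<or> S ` U = spc \<sigma>" using assms(1) unfolding irreducible_rep_def by blast
    then have "S ` U = S ` {0} \<or> S ` U = S ` spc \<pi>" using z S(2) unfolding bij_betw_def by simp
    then show ?thesis
      using inj_on_image_eq_iff[of S "spc \<pi>"] S(2) Us z0 unfolding bij_betw_def by blast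
  qed
  moreover have "spc \<pi> \<noteq> {0}"
  proof
    assume "spc \<pi> = {0}"
    then have "spc \<sigma> = {0}" using S(2) z unfolding bij_betw_def by auto
    with assms(1) show False unfolding irreducible_rep_def by blast
  qed
  ultimately show ?thesis using assms(2) unfolding irreducible_rep_def by blast
qed

text \<open>The orbit of a nonzero vector spans a subrepresentation, which by irreducibility is everything; the orbit is finite.\<close>

lemma irreducible_cyclic:
  assumes "group G" "finite (carrier G)" "irreducible_rep G \<sigma>"
  shows "fin_dim (scl \<sigma>) (spc \<sigma>)" "vector_space.dim (scl \<sigma>) (spc \<sigma>) > 0"
proof -
  interpret group G by fact
  have s: "is_rep G \<sigma>" using assms unfolding irreducible_rep_def by blast
  interpret vector_space "scl \<sigma>" using is_repD(1) s .
  have sub: "subspace (spc \<sigma>)" using is_repD(2) s .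
  obtain x where x: "x \<in> spc \<sigma>" "x \<noteq> 0"
    using assms(3) subspace_0[OF sub] unfolding irreducible_rep_def by blast
  let ?O = "(\<lambda>g. act \<sigma> g x) ` carrier G"
  have O: "?O \<subseteq> spc \<sigma>" using is_repD(3)[OF s] x by blast
  then have Us: "span ?O \<subseteq> spc \<sigma>" using sub span_minimal by blast
  have inv_O: "act \<sigma> g y \<in> span ?O" if g: "g \<in> carrier G" and y: "y \<in> span ?O" for g y
  proof -
    have "act \<sigma> g 0 = 0" using is_repD(5)[OF s g, of 0 0] subspace_0[OF sub] by simp
    then have "subspace {y\<in>spc \<sigma>. act \<sigma> g y \<in> span ?O}"
      using is_repD(4,5)[OF s g] sub span_zero span_add span_scale by (auto simp: subspace_def)
    moreover have "?O \<subseteq> {y\<in>spc \<sigma>. act \<sigma> g y \<in> span ?O}"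
    proof (clarsimp, intro conjI)
      fix h assume h: "h \<in> carrier G"
      show "act \<sigma> h x \<in> spc \<sigma>" using is_repD(3)[OF s h] x by blast
      have "act \<sigma> g (act \<sigma> h x) = act \<sigma> (g \<otimes>\<^bsub>G\<^esub> h) x" using is_repD(7)[OF s g h] x by simp
      then show "act \<sigma> g (act \<sigma> h x) \<in> span ?O" using g h by (intro span_base) auto
    qed
    ultimately show ?thesis using y span_minimal by blast
  qed
  have "subrep G (span ?O) \<sigma>"
    unfolding subrep_iff[OF s] using Us inv_O by blast
  then have "span ?O = {0} \<or> span ?O = spc \<sigma>" using assms(3) unfolding irreducible_rep_def by blast
  moreover have "x \<in> span ?O" using is_repD(6)[OF s x(1)] by (intro span_base image_eqI[of _ _ "\<one>\<^bsub>G\<^esub>"]) auto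
  ultimately have "span ?O = spc \<sigma>" using x by blast
  then show fd: "fin_dim (scl \<sigma>) (spc \<sigma>)" using fin_dim_span assms(2) by (metis finite_imageI)
  show "dim (spc \<sigma>) > 0" using dim_pos[OF fd sub] x by blast
qed

section \<open>Complete reducibility\<close>

text \<open>Averaging over \<open>g\<close> makes a linear map equivariant, because \<open>g \<mapsto> h g\<close> permutes the group.\<close>

lemma rep_hom_average:
  fixes \<sigma> :: "('f::{field,ring_char_0}, 'u::ab_group_add, 'g) rep" and \<pi> :: "('f, 'w::ab_group_add, 'g) rep"
  assumes "group G" "is_rep G \<sigma>" "is_rep G \<pi>"
    and p: "\<And>x. x \<in> spc \<sigma> \<Longrightarrow> p x \<in> spc \<pi>"
      "\<And>x y. x \<in> spc \<sigma> \<Longrightarrow> y \<in> spc \<sigma> \<Longrightarrow> p (x + y) = p x + p y"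
      "\<And>c x. x \<in> spc \<sigma> \<Longrightarrow> p (scl \<sigma> c x) = scl \<pi> c (p x)"
  shows "rep_hom G \<sigma> \<pi> (\<lambda>x. scl \<pi> (1 / of_nat (card (carrier G))) (\<Sum>g\<in>carrier G. act \<pi> g (p (act \<sigma> (inv\<^bsub>G\<^esub> g) x))))"
    (is "rep_hom G \<sigma> \<pi> (\<lambda>x. scl \<pi> ?c (?q x))")
proof -
  interpret group G by fact
  interpret s: vector_space "scl \<sigma>" using is_repD(1) assms(2) .
  interpret v: vector_space "scl \<pi>" using is_repD(1) assms(3) .
  have subp: "v.subspace (spc \<pi>)" using is_repD(2) assms(3) .
  note rs = is_repD[OF assms(2)] and rp = is_repD[OF assms(3)]
  have m: "p (act \<sigma> (inv\<^bsub>G\<^esub> g) x) \<in> spc \<pi>" if "g \<in> carrier G" "x \<in> spc \<sigma>" for g x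
    using that p(1) rs(3) by simp
  have q: "?q x \<in> spc \<pi>" if "x \<in> spc \<sigma>" for x
    by (rule v.subspace_sum[OF subp]) (use rp(3) m that in simp)
  have act_sum: "act \<pi> g (\<Sum>h\<in>A. f h) = (\<Sum>h\<in>A. act \<pi> g (f h)) \<and> (\<Sum>h\<in>A. f h) \<in> spc \<pi>"
    if g: "g \<in> carrier G" and "\<And>h. h \<in> A \<Longrightarrow> f h \<in> spc \<pi>" for g f and A :: "'g set"
    using that(2)
  proof (induction A rule: infinite_finite_induct)
    case (infinite A)
    then show ?case using rp(5)[OF g, of 0 0] v.subspace_0[OF subp] by simp
  next
    case empty
    then show ?case using rp(5)[OF g, of 0 0] v.subspace_0[OF subp] by simp
  next
    case (insert a A)
    then show ?case using rp(4)[OF g, of "f a" "sum f A"] v.subspace_add[OF subp] by auto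
  qed
  show ?thesis
  proof (rule rep_homI)
    fix x assume "x \<in> spc \<sigma>"
    then show "scl \<pi> ?c (?q x) \<in> spc \<pi>" using q v.subspace_scale[OF subp] by blast
  next
    fix x y assume xy: "x \<in> spc \<sigma>" "y \<in> spc \<sigma>"
    have "?q (x + y) = (\<Sum>g\<in>carrier G. act \<pi> g (p (act \<sigma> (inv\<^bsub>G\<^esub> g) x)) + act \<pi> g (p (act \<sigma> (inv\<^bsub>G\<^esub> g) y)))"
      by (rule sum.cong) (use xy rs rp p m in auto)
    then show "scl \<pi> ?c (?q (x + y)) = scl \<pi> ?c (?q x) + scl \<pi> ?c (?q y)"
      by (simp add: sum.distrib v.scale_right_distrib)
  next
    fix c x assume x: "x \<in> spc \<sigma>"
    have "?q (scl \<sigma> c x) = (\<Sum>g\<in>carrier G. scl \<pi> c (act \<pi> g (p (act \<sigma> (inv\<^bsub>G\<^esub> g) x))))"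
      by (rule sum.cong) (use x rs rp p m in auto)
    then show "scl \<pi> ?c (?q (scl \<sigma> c x)) = scl \<pi> c (scl \<pi> ?c (?q x))"
      by (simp add: v.scale_sum_right mult.commute)
  next
    fix h x assume h: "h \<in> carrier G" and x: "x \<in> spc \<sigma>"
    have "act \<pi> h (?q x) = (\<Sum>g\<in>carrier G. act \<pi> h (act \<pi> g (p (act \<sigma> (inv\<^bsub>G\<^esub> g) x))))"
      by (rule conjunct1[OF act_sum[OF h]]) (use rp(3) m x in simp)
    also have "\<dots> = (\<Sum>g\<in>carrier G. act \<pi> (h \<otimes>\<^bsub>G\<^esub> g) (p (act \<sigma> (inv\<^bsub>G\<^esub> (h \<otimes>\<^bsub>G\<^esub> g)) (act \<sigma> h x))))"
    proof (rule sum.cong[OF refl])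
      fix g assume g: "g \<in> carrier G"
      have "act \<sigma> (inv\<^bsub>G\<^esub> (h \<otimes>\<^bsub>G\<^esub> g)) (act \<sigma> h x) = act \<sigma> (inv\<^bsub>G\<^esub> g) (act \<sigma> (inv\<^bsub>G\<^esub> h) (act \<sigma> h x))"
        using rs(7)[of "inv\<^bsub>G\<^esub> g" "inv\<^bsub>G\<^esub> h" "act \<sigma> h x"] rs(3) g h x by (simp add: inv_mult_group)
      also have "\<dots> = act \<sigma> (inv\<^bsub>G\<^esub> g) x" using act_inv(1)[OF assms(2) h x] by simp
      finally show "act \<pi> h (act \<pi> g (p (act \<sigma> (inv\<^bsub>G\<^esub> g) x))) =
          act \<pi> (h \<otimes>\<^bsub>G\<^esub> g) (p (act \<sigma> (inv\<^bsub>G\<^esub> (h \<otimes>\<^bsub>G\<^esub> g)) (act \<sigma> h x)))"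
        using rp(7)[OF h g m[OF g x]] by simp
    qed
    also have "\<dots> = ?q (act \<sigma> h x)"
      by (rule sum.reindex_bij_witness[of _ "\<lambda>g. inv\<^bsub>G\<^esub> h \<otimes>\<^bsub>G\<^esub> g" "\<lambda>g. h \<otimes>\<^bsub>G\<^esub> g"])
        (use h in \<open>auto simp: m_assoc[symmetric]\<close>)
    finally have "act \<pi> h (?q x) = ?q (act \<sigma> h x)" .
    then show "scl \<pi> ?c (?q (act \<sigma> h x)) = act \<pi> h (scl \<pi> ?c (?q x))"
      using rp(5)[OF h q[OF x]] by simp
  qed
qed

text \<open>The average of a linear projection onto \<open>U\<close> is an equivariant projection onto \<open>U\<close>; its kernel is the complement.\<close>

lemma maschke:
  fixes \<pi> :: "('f::{field,ring_char_0}, 'w::ab_group_add, 'g) rep"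
  assumes "group G" "finite (carrier G)" "is_rep G \<pi>" "subrep G U \<pi>"
  obtains U' where "subrep G U' \<pi>" "U \<inter> U' = {0}" "\<And>x. x \<in> spc \<pi> \<Longrightarrow> \<exists>u\<in>U. \<exists>u'\<in>U'. x = u + u'"
proof -
  interpret group G by fact
  interpret vector_space "scl \<pi>" using is_repD(1) assms(3) .
  interpret vector_space_pair "scl \<pi>" "scl \<pi>" ..
  have U: "U \<subseteq> spc \<pi>" "subspace U" "\<And>g x. g \<in> carrier G \<Longrightarrow> x \<in> U \<Longrightarrow> act \<pi> g x \<in> U"
    using assms(4) unfolding subrep_iff[OF assms(3)] by blast+
  have sub: "subspace (spc \<pi>)" using is_repD(2) assms(3) .
  have "Vector_Spaces.linear (scl \<pi>) (scl \<pi>) id" by (rule linear_id)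
  from linear_exists_left_inverse_on[OF this U(2)] obtain p
    where p: "\<And>x. p x \<in> U" "Vector_Spaces.linear (scl \<pi>) (scl \<pi>) p" "\<And>x. x \<in> U \<Longrightarrow> p x = x"
    by auto
  let ?c = "1 / of_nat (card (carrier G)) :: 'f"
  let ?q = "\<lambda>x. scl \<pi> ?c (\<Sum>g\<in>carrier G. act \<pi> g (p (act \<pi> (inv\<^bsub>G\<^esub> g) x)))"
  have q: "rep_hom G \<pi> (\<pi>\<lparr>spc := U\<rparr>) ?q"
    using rep_hom_average[OF assms(1,3) is_rep_restrict[OF assms(4)], of p]
      p(1) linear_add[OF p(2)] linear_scale[OF p(2)] by simp
  have n0: "of_nat (card (carrier G)) \<noteq> (0::'f)"
    using assms(2) one_closed by (auto simp: card_eq_0_iff)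
  have qU: "?q x = x" if x: "x \<in> U" for x
  proof -
    have "act \<pi> g (p (act \<pi> (inv\<^bsub>G\<^esub> g) x)) = x" if g: "g \<in> carrier G" for g
      using p(3)[OF U(3)[of "inv\<^bsub>G\<^esub> g" x]] act_inv(2)[OF assms(3) g] U x g by auto
    then have "(\<Sum>g\<in>carrier G. act \<pi> g (p (act \<pi> (inv\<^bsub>G\<^esub> g) x))) = (\<Sum>g\<in>carrier G. x)" by simp
    also have "\<dots> = scl \<pi> (of_nat (card (carrier G))) x" by (rule sum_constant_scale)
    finally show ?thesis using n0 by simp
  qed
  let ?U' = "{x\<in>spc \<pi>. ?q x = 0}"
  have mem: "?q x \<in> U" if "x \<in> spc \<pi>" for x using rep_homD(1)[OF q that] by simp
  have "subrep G ?U' \<pi>" using rep_hom_kernel[OF assms(3) is_rep_restrict[OF assms(4)] q] .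
  moreover have "U \<inter> ?U' = {0}" using qU U(1) subspace_0[OF U(2)] by force
  moreover have "\<exists>u\<in>U. \<exists>u'\<in>?U'. x = u + u'" if x: "x \<in> spc \<pi>" for x
  proof (intro bexI)
    have qx: "?q x \<in> spc \<pi>" using mem x U by blast
    show "x = ?q x + (x - ?q x)" by simp
    have d: "x - ?q x \<in> spc \<pi>" using x qx subspace_diff[OF sub] by blast
    have "?q x = ?q (?q x + (x - ?q x))" by simp
    also have "\<dots> = ?q (?q x) + ?q (x - ?q x)" by (rule rep_homD(2)[OF q qx d])
    finally have "?q (x - ?q x) = 0" using qU[OF mem[OF x]] by simp
    then show "x - ?q x \<in> ?U'" using d by simp
  qed (rule mem[OF x])
  ultimately show thesis by (rule that)
qed

lemma exists_irreducible_subrep: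
  assumes "is_rep G \<pi>" "subrep G U \<pi>" "fin_dim (scl \<pi>) U" "U \<noteq> {0}"
  obtains S where "subrep G S \<pi>" "S \<subseteq> U" "irreducible_rep G (\<pi>\<lparr>spc := S\<rparr>)"
proof -
  interpret vector_space "scl \<pi>" using is_repD(1) assms(1) .
  let ?P = "\<lambda>n. \<exists>S. subrep G S \<pi> \<and> S \<subseteq> U \<and> S \<noteq> {0} \<and> dim S = n"
  have "?P (dim U)" using assms by blast
  then have "?P (LEAST n. ?P n)" by (rule LeastI)
  then obtain S where S: "subrep G S \<pi>" "S \<subseteq> U" "S \<noteq> {0}" "dim S = (LEAST n. ?P n)" by blast
  have sub: "subspace X" if "subrep G X \<pi>" for X
    using that unfolding subrep_iff[OF assms(1)] by blast
  have "X = {0} \<or> X = S" if X: "subrep G X (\<pi>\<lparr>spc := S\<rparr>)" for X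
  proof (rule disjCI)
    assume ne: "X \<noteq> S"
    have XS: "X \<subseteq> S" using X unfolding subrep_def by simp
    have X': "subrep G X \<pi>" using X subrep_restrict[OF S(1) XS] by blast
    show "X = {0}"
    proof (rule ccontr)
      assume "X \<noteq> {0}"
      then have "?P (dim X)" using X' XS S(2) by blast
      then have "dim S \<le> dim X" unfolding S(4) by (rule Least_le)
      then have "X = S"
        using subspace_eq_of_dim_ge[OF fin_dim_subset[OF assms(3) S(2)] XS sub[OF X'] sub[OF S(1)]] by blast
      with ne show False by blast
    qed
  qed
  then have "irreducible_rep G (\<pi>\<lparr>spc := S\<rparr>)"
    using S(3) is_rep_restrict[OF S(1)] unfolding irreducible_rep_def by simp
  with S that show thesis by blast
qed

text \<open>Split off an irreducible subspace and decompose an invariant complement of it, which has smaller dimension.\<close>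

lemma exists_irreducible_decomp:
  fixes \<pi> :: "('f::{field,ring_char_0}, 'w::ab_group_add, 'g) rep"
  assumes "group G" "finite (carrier G)" "is_rep G \<pi>" "fin_dim (scl \<pi>) (spc \<pi>)"
  shows "\<exists>D. irreducible_decomp G \<pi> D"
proof -
  interpret vector_space "scl \<pi>" using is_repD(1) assms(3) .
  have "\<exists>D. irreducible_decomp G (\<pi>\<lparr>spc := U\<rparr>) D" if "subrep G U \<pi>" for U
    using that
  proof (induction "dim U" arbitrary: U rule: less_induct)
    case less
    have U: "U \<subseteq> spc \<pi>" "subspace U" using less.prems unfolding subrep_iff[OF assms(3)] by blast+
    have fU: "fin_dim (scl \<pi>) U" using assms(4) U fin_dim_subset by blast
    have rU: "is_rep G (\<pi>\<lparr>spc := U\<rparr>)" using is_rep_restrict[OF less.prems] .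
    show ?case
    proof (cases "U = {0}")
      case True
      have "irreducible_decomp G (\<pi>\<lparr>spc := U\<rparr>) {}"
        unfolding irreducible_decomp_def using True by simp
      then show ?thesis by blast
    next
      case False
      obtain S where S: "subrep G S \<pi>" "S \<subseteq> U" "irreducible_rep G (\<pi>\<lparr>spc := S\<rparr>)"
        using exists_irreducible_subrep[OF assms(3) less.prems fU False] by blast
      have SU: "subrep G S (\<pi>\<lparr>spc := U\<rparr>)" using subrep_restrict[OF less.prems S(2)] S(1) by blast
      obtain S' where S': "subrep G S' (\<pi>\<lparr>spc := U\<rparr>)" "S \<inter> S' = {0}"
          "\<And>x. x \<in> U \<Longrightarrow> \<exists>u\<in>S. \<exists>u'\<in>S'. x = u + u'"
        by (rule maschke[OF assms(1,2) rU SU]) simp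
      have S'U: "S' \<subseteq> U" using S'(1) unfolding subrep_def by simp
      have S'p: "subrep G S' \<pi>" using S'(1) subrep_restrict[OF less.prems S'U] by blast
      have subS': "subspace S'" and subS: "subspace S"
        using S'p S(1) unfolding subrep_iff[OF assms(3)] by blast+
      have S0: "S \<noteq> {0}" using S(3) unfolding irreducible_rep_def by simp
      have "dim S' < dim U"
      proof (rule ccontr)
        assume "\<not> dim S' < dim U"
        then have "S' = U" using subspace_eq_of_dim_ge[OF fU S'U subS' U(2)] by simp
        then have "S = {0}" using S'(2) S(2) by blast
        with S0 show False by blast
      qed
      from less.hyps[OF this S'p] obtain D where D: "irreducible_decomp G (\<pi>\<lparr>spc := S'\<rparr>) D" by blast
      have finD: "finite D" and subD: "\<And>X. X \<in> D \<Longrightarrow> subrep G X (\<pi>\<lparr>spc := S'\<rparr>)"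
        and irrD: "\<And>X. X \<in> D \<Longrightarrow> irreducible_rep G (\<pi>\<lparr>spc := X\<rparr>)"
        and spanD: "span (\<Union>D) = S'"
        and indD: "\<And>f. \<forall>X\<in>D. f X \<in> X \<Longrightarrow> (\<Sum>X\<in>D. f X) = 0 \<Longrightarrow> \<forall>X\<in>D. f X = 0"
        using D unfolding irreducible_decomp_def by simp_all
      have SD: "S \<notin> D"
      proof
        assume "S \<in> D"
        then have "S \<subseteq> S'" using subD unfolding subrep_def by fastforce
        then show False using S'(2) S0 subspace_0[OF subS] by blast
      qed
      have "irreducible_decomp G (\<pi>\<lparr>spc := U\<rparr>) (insert S D)"
        unfolding irreducible_decomp_def
      proof (intro conjI ballI allI impI)
        show "finite (insert S D)" using finD by simp
        fix X assume X: "X \<in> insert S D"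
        show "subrep G X (\<pi>\<lparr>spc := U\<rparr>)"
        proof (cases "X = S")
          case False
          then have x: "subrep G X (\<pi>\<lparr>spc := S'\<rparr>)" using X subD by blast
          then have "X \<subseteq> S'" unfolding subrep_def by simp
          then show ?thesis using x S'U unfolding subrep_def by auto
        qed (use SU in simp)
        show "irreducible_rep G (\<pi>\<lparr>spc := U\<rparr>\<lparr>spc := X\<rparr>)"
          using X irrD S(3) by auto
      next
        show "module.span (scl (\<pi>\<lparr>spc := U\<rparr>)) (\<Union>(insert S D)) = spc (\<pi>\<lparr>spc := U\<rparr>)"
        proof simp
          show "span (S \<union> \<Union>D) = U"
          proof
            have "\<Union>D \<subseteq> S'" using spanD span_superset[of "\<Union>D"] by simp
            then show "span (S \<union> \<Union>D) \<subseteq> U" using S(2) S'U U(2) by (intro span_minimal) auto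
            show "U \<subseteq> span (S \<union> \<Union>D)"
            proof
              fix x assume "x \<in> U"
              then obtain u u' where u: "u \<in> S" "u' \<in> S'" "x = u + u'" using S'(3) by blast
              have "u' \<in> span (S \<union> \<Union>D)" using u(2) spanD span_mono[of "\<Union>D" "S \<union> \<Union>D"] by blast
              then show "x \<in> span (S \<union> \<Union>D)" using u span_add span_base by blast
            qed
          qed
        qed
      next
        fix f X
        assume f: "(\<forall>X\<in>insert S D. f X \<in> X) \<and> (\<Sum>X\<in>insert S D. f X) = 0" and X: "X \<in> insert S D"
        have fs: "(\<Sum>X\<in>D. f X) \<in> S'"
        proof (rule subspace_sum[OF subS'])
          fix X assume "X \<in> D"
          then show "f X \<in> S'" using f subD[of X] unfolding subrep_def by auto
        qed
        have e: "f S + (\<Sum>X\<in>D. f X) = 0" using f finD SD by simp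
        then have "f S = - (\<Sum>X\<in>D. f X)" by (rule eq_neg_iff_add_eq_0[THEN iffD2])
        then have "f S \<in> S'" using fs subspace_neg[OF subS'] by simp
        then have fS: "f S = 0" using f S'(2) by blast
        then have "\<forall>X\<in>D. f X = 0" using e f by (intro indD) auto
        then show "f X = 0" using fS X by blast
      qed
      then show ?thesis by blast
    qed
  qed
  from this[OF subrep_refl[OF assms(3)]] show ?thesis by simp
qed

section \<open>Isotypic components and multiplicities\<close>

text \<open>For irreducible \<open>\<sigma>\<close> this is the sum of all subrepresentations isomorphic to \<open>\<sigma>\<close>, by Schur's lemma. Stated with
  homomorphisms, it visibly depends on no decomposition, and homomorphisms \<open>\<pi> \<rightarrow> \<rho>\<close> respect it.\<close>

definition isotypic :: "('g, 'm) monoid_scheme \<Rightarrow> ('f::field, 'u::ab_group_add, 'g) rep \<Rightarrow>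
    ('f, 'w::ab_group_add, 'g) rep \<Rightarrow> 'w set"
  where "isotypic G \<sigma> \<pi> = module.span (scl \<pi>) {T x | T x. rep_hom G \<sigma> \<pi> T \<and> x \<in> spc \<sigma>}"

lemma isotypic_subspace:
  assumes "is_rep G \<pi>"
  shows "module.subspace (scl \<pi>) (isotypic G \<sigma> \<pi>)" "isotypic G \<sigma> \<pi> \<subseteq> spc \<pi>"
proof -
  interpret vector_space "scl \<pi>" using is_repD(1) assms .
  show "subspace (isotypic G \<sigma> \<pi>)" unfolding isotypic_def by simp
  show "isotypic G \<sigma> \<pi> \<subseteq> spc \<pi>"
    unfolding isotypic_def by (rule span_minimal) (use rep_homD(1) is_repD(2)[OF assms] in blast)+
qed

lemma isotypic_hom:
  assumes "is_rep G \<pi>" "rep_hom G \<sigma> \<pi> T" "x \<in> spc \<sigma>"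
  shows "T x \<in> isotypic G \<sigma> \<pi>"
proof -
  interpret vector_space "scl \<pi>" using is_repD(1) assms(1) .
  show ?thesis unfolding isotypic_def using assms by (intro span_base) blast
qed

lemma isotypic_antimono:
  assumes "is_rep G \<pi>" "rep_hom G \<sigma>' \<sigma> S" "S ` spc \<sigma>' = spc \<sigma>"
  shows "isotypic G \<sigma> \<pi> \<subseteq> isotypic G \<sigma>' \<pi>"
proof -
  interpret vector_space "scl \<pi>" using is_repD(1) assms(1) .
  have "{T x | T x. rep_hom G \<sigma> \<pi> T \<and> x \<in> spc \<sigma>} \<subseteq> isotypic G \<sigma>' \<pi>"
  proof clarify
    fix T x assume T: "rep_hom G \<sigma> \<pi> T" "x \<in> spc \<sigma>"
    obtain y where "y \<in> spc \<sigma>'" "x = S y" using assms(3) T(2) by blast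
    with isotypic_hom[OF assms(1) rep_hom_comp[OF assms(2) T(1)]]
    show "T x \<in> isotypic G \<sigma>' \<pi>" by simp
  qed
  then show ?thesis unfolding isotypic_def[of G \<sigma>] by (intro span_minimal isotypic_subspace(1)[OF assms(1)])
qed

lemma isotypic_iso:
  assumes "is_rep G \<pi>" "is_rep G \<sigma>" "rep_iso G \<sigma> \<sigma>'"
  shows "isotypic G \<sigma> \<pi> = isotypic G \<sigma>' \<pi>"
proof -
  obtain S S' where S: "rep_hom G \<sigma> \<sigma>' S" "S ` spc \<sigma> = spc \<sigma>'"
      "rep_hom G \<sigma>' \<sigma> S'" "S' ` spc \<sigma>' = spc \<sigma>"
    using assms(3) rep_iso_sym[OF assms(2,3)] unfolding rep_iso_iff bij_betw_def by blast
  show ?thesis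
    using isotypic_antimono[OF assms(1) S(1,2)] isotypic_antimono[OF assms(1) S(3,4)] by (rule equalityI[rotated])
qed

lemma isotypic_functorial:
  assumes "is_rep G \<pi>" "is_rep G \<rho>" "rep_hom G \<pi> \<rho> \<Phi>" "x \<in> isotypic G \<sigma> \<pi>"
  shows "\<Phi> x \<in> isotypic G \<sigma> \<rho>"
proof -
  interpret p: vector_space "scl \<pi>" using is_repD(1) assms(1) .
  interpret r: vector_space "scl \<rho>" using is_repD(1) assms(2) .
  have sp: "p.subspace (spc \<pi>)" using is_repD(2) assms(1) .
  note sr = isotypic_subspace(1)[OF assms(2), of \<sigma>]
  let ?A = "{T x | T x. rep_hom G \<sigma> \<pi> T \<and> x \<in> spc \<sigma>}"
  have "p.subspace {x\<in>spc \<pi>. \<Phi> x \<in> isotypic G \<sigma> \<rho>}"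
    using sp r.subspace_0[OF sr] r.subspace_add[OF sr] r.subspace_scale[OF sr]
      rep_hom_zero[OF assms(1-3)] rep_homD[OF assms(3)]
    by (auto simp: p.subspace_def)
  moreover have "?A \<subseteq> {x\<in>spc \<pi>. \<Phi> x \<in> isotypic G \<sigma> \<rho>}"
  proof clarsimp
    fix T x assume T: "rep_hom G \<sigma> \<pi> T" and x: "x \<in> spc \<sigma>"
    show "T x \<in> spc \<pi> \<and> \<Phi> (T x) \<in> isotypic G \<sigma> \<rho>"
      using isotypic_hom[OF assms(2) rep_hom_comp[OF T assms(3)] x] rep_homD(1)[OF T x] by simp
  qed
  ultimately have "p.span ?A \<subseteq> {x\<in>spc \<pi>. \<Phi> x \<in> isotypic G \<sigma> \<rho>}" by (rule p.span_minimal[rotated])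
  with assms(4) show ?thesis unfolding isotypic_def by blast
qed

text \<open>The projections of a hom into a decomposed representation are homs as well, so Schur's lemma confines
  its image to the summands of the right type.\<close>

lemma isotypic_decomp:
  assumes p: "is_rep G \<pi>" and s: "irreducible_rep G \<sigma>" and D: "irreducible_decomp G \<pi> D"
  shows "isotypic G \<sigma> \<pi> = module.span (scl \<pi>) (\<Union>{U\<in>D. rep_iso G \<sigma> (\<pi>\<lparr>spc := U\<rparr>)})"
proof -
  interpret vector_space "scl \<pi>" using is_repD(1) p .
  have rs: "is_rep G \<sigma>" using s unfolding irreducible_rep_def by blast
  have finD: "finite D" and subD: "\<And>X. X \<in> D \<Longrightarrow> subrep G X \<pi>"
    and irrD: "\<And>X. X \<in> D \<Longrightarrow> irreducible_rep G (\<pi>\<lparr>spc := X\<rparr>)"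
    and spanD: "span (\<Union>D) = spc \<pi>" and dirD: "direct_family D"
    using D unfolding irreducible_decomp_def direct_family_def by simp_all
  have subspD: "subspace X" and actD: "\<And>g x. g \<in> carrier G \<Longrightarrow> x \<in> X \<Longrightarrow> act \<pi> g x \<in> X"
    and inD: "X \<subseteq> spc \<pi>" if "X \<in> D" for X
    using subD[OF that] unfolding subrep_iff[OF p] by blast+
  let ?E = "{U\<in>D. rep_iso G \<sigma> (\<pi>\<lparr>spc := U\<rparr>)}"
  have "\<forall>x. \<exists>f. x \<in> spc \<pi> \<longrightarrow> (\<forall>U\<in>D. f U \<in> U) \<and> x = (\<Sum>U\<in>D. f U)"
  proof
    fix x
    show "\<exists>f. x \<in> spc \<pi> \<longrightarrow> (\<forall>U\<in>D. f U \<in> U) \<and> x = (\<Sum>U\<in>D. f U)"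
    proof (cases "x \<in> spc \<pi>")
      case True
      with spanD have "x \<in> span (\<Union>D)" by simp
      from span_Union_sum[OF finD subspD this] show ?thesis by metis
    qed simp
  qed
  then obtain c where c: "\<And>x U. x \<in> spc \<pi> \<Longrightarrow> U \<in> D \<Longrightarrow> c x U \<in> U"
      "\<And>x. x \<in> spc \<pi> \<Longrightarrow> x = (\<Sum>U\<in>D. c x U)" by metis
  have uniq: "c x U = f U" if x: "x \<in> spc \<pi>" "\<And>U. U \<in> D \<Longrightarrow> f U \<in> U" "x = (\<Sum>U\<in>D. f U)" and U: "U \<in> D" for x f U
  proof -
    have "(\<forall>U\<in>D. c x U - f U \<in> U) \<and> (\<Sum>U\<in>D. c x U - f U) = 0"
      using c[OF x(1)] x(2,3) subspD subspace_diff by (simp add: sum_subtractf)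
    then have "\<forall>U\<in>D. c x U - f U = 0"
      using dirD[unfolded direct_family_def, rule_format, of "\<lambda>U. c x U - f U"] by blast
    with U show ?thesis by simp
  qed
  have sp: "subspace (spc \<pi>)" using is_repD(2) p .
  have sum_act: "act \<pi> g (\<Sum>U\<in>D. f U) = (\<Sum>U\<in>D. act \<pi> g (f U))"
    if g: "g \<in> carrier G" and f: "\<And>U. U \<in> D \<Longrightarrow> f U \<in> spc \<pi>" for g f
  proof -
    have "act \<pi> g (\<Sum>U\<in>E. f U) = (\<Sum>U\<in>E. act \<pi> g (f U)) \<and> (\<Sum>U\<in>E. f U) \<in> spc \<pi>" if "finite E" "E \<subseteq> D" for E
      using that
    proof (induction E)
      case empty
      then show ?case using is_repD(5)[OF p g, of 0 0] subspace_0[OF sp] by simp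
    next
      case (insert U E)
      then show ?case using is_repD(4)[OF p g, of "f U" "sum f E"] f subspace_add[OF sp] by auto
    qed
    then show ?thesis using finD by blast
  qed
  have chom: "rep_hom G \<pi> (\<pi>\<lparr>spc := U\<rparr>) (\<lambda>x. c x U)" if U: "U \<in> D" for U
  proof (rule rep_homI, simp_all)
    show "c x U \<in> U" if "x \<in> spc \<pi>" for x using c that U by blast
    show "c (x + y) U = c x U + c y U" if x: "x \<in> spc \<pi>" and y: "y \<in> spc \<pi>" for x y
    proof (rule uniq)
      show "x + y = (\<Sum>U\<in>D. c x U + c y U)"
        using arg_cong2[of x _ y _ "(+)", OF c(2)[OF x] c(2)[OF y]] by (simp only: sum.distrib)
      show "c x V + c y V \<in> V" if V: "V \<in> D" for V
        using subspace_add[OF subspD[OF V] c(1)[OF x V] c(1)[OF y V]] .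
    qed (use U subspace_add[OF sp x y] in auto)
    show "c (scl \<pi> a x) U = scl \<pi> a (c x U)" if x: "x \<in> spc \<pi>" for a x
    proof (rule uniq)
      show "scl \<pi> a x = (\<Sum>U\<in>D. scl \<pi> a (c x U))"
        using arg_cong[of x _ "scl \<pi> a", OF c(2)[OF x]] by (simp only: scale_sum_right)
      show "scl \<pi> a (c x V) \<in> V" if V: "V \<in> D" for V
        using subspace_scale[OF subspD[OF V] c(1)[OF x V]] .
    qed (use U subspace_scale[OF sp x] in auto)
    show "c (act \<pi> g x) U = act \<pi> g (c x U)" if g: "g \<in> carrier G" and x: "x \<in> spc \<pi>" for g x
    proof (rule uniq)
      show "act \<pi> g x \<in> spc \<pi>" using is_repD(3)[OF p g x] .
      show "act \<pi> g (c x V) \<in> V" if "V \<in> D" for V using actD[OF that g] c(1)[OF x that] by blast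
      show "act \<pi> g x = (\<Sum>U\<in>D. act \<pi> g (c x U))"
        using sum_act[OF g, of "c x"] c(1)[OF x] c(2)[OF x] inD by (metis (no_types, lifting) subsetD)
    qed fact
  qed
  have "{T x | T x. rep_hom G \<sigma> \<pi> T \<and> x \<in> spc \<sigma>} \<subseteq> span (\<Union>?E)"
  proof clarify
    fix T x assume T: "rep_hom G \<sigma> \<pi> T" and x: "x \<in> spc \<sigma>"
    have Tx: "T x \<in> spc \<pi>" using rep_homD(1)[OF T x] .
    have "c (T x) U \<in> span (\<Union>?E)" if U: "U \<in> D" for U
    proof (cases "c (T x) U = 0")
      case False
      have h: "rep_hom G \<sigma> (\<pi>\<lparr>spc := U\<rparr>) ((\<lambda>y. c y U) \<circ> T)" by (rule rep_hom_comp[OF T chom[OF U]])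
      have "bij_betw ((\<lambda>y. c y U) \<circ> T) (spc \<sigma>) (spc (\<pi>\<lparr>spc := U\<rparr>))"
        by (rule schur[OF s irrD[OF U] h x]) (use False in simp)
      with h have "rep_iso G \<sigma> (\<pi>\<lparr>spc := U\<rparr>)" unfolding rep_iso_iff by blast
      then show ?thesis using U c(1)[OF Tx U] by (intro span_base) blast
    qed (simp add: span_zero)
    then have "(\<Sum>U\<in>D. c (T x) U) \<in> span (\<Union>?E)" by (rule span_sum)
    then show "T x \<in> span (\<Union>?E)" using c(2)[OF Tx] by simp
  qed
  then have "isotypic G \<sigma> \<pi> \<subseteq> span (\<Union>?E)" unfolding isotypic_def by (simp add: span_minimal)
  moreover have "U \<subseteq> isotypic G \<sigma> \<pi>" if U: "U \<in> ?E" for U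
  proof
    fix y assume y: "y \<in> U"
    obtain T where T: "rep_hom G \<sigma> (\<pi>\<lparr>spc := U\<rparr>) T" "bij_betw T (spc \<sigma>) U"
      using U unfolding rep_iso_iff by auto
    have "rep_hom G \<sigma> \<pi> T" using T(1) inD U unfolding rep_hom_def by auto
    moreover obtain x where "x \<in> spc \<sigma>" "y = T x" using T(2) y unfolding bij_betw_def by blast
    ultimately show "y \<in> isotypic G \<sigma> \<pi>" using isotypic_hom[OF p] by blast
  qed
  then have "span (\<Union>?E) \<subseteq> isotypic G \<sigma> \<pi>"
    by (intro span_minimal isotypic_subspace(1)[OF p]) blast
  ultimately show ?thesis by (rule equalityI)
qed

text \<open>The number of summands of type \<open>\<sigma>\<close> in a decomposition is read off from the isotypic component, which does not
  refer to the decomposition. Hence the multiplicity is well defined.\<close>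

theorem multiplicity_times_dim:
  fixes \<pi> :: "('f::{field,ring_char_0}, 'w::ab_group_add, 'g) rep"
    and \<sigma> :: "('f, 'u::ab_group_add, 'g) rep"
  assumes G: "group G" "finite (carrier G)" and p: "is_rep G \<pi>" "fin_dim (scl \<pi>) (spc \<pi>)"
    and s: "irreducible_rep G \<sigma>"
  shows "multiplicity_rep G \<sigma> \<pi> * vector_space.dim (scl \<sigma>) (spc \<sigma>) = vector_space.dim (scl \<pi>) (isotypic G \<sigma> \<pi>)"
proof -
  interpret p: vector_space "scl \<pi>" using is_repD(1) p(1) .
  have rs: "is_rep G \<sigma>" using s unfolding irreducible_rep_def by blast
  interpret s: vector_space "scl \<sigma>" using is_repD(1) rs .
  let ?d = "s.dim (spc \<sigma>)"
  have d: "?d > 0" using irreducible_cyclic[OF G s] by blast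
  have key: "card {U\<in>D. rep_iso G \<sigma> (\<pi>\<lparr>spc := U\<rparr>)} * ?d = p.dim (isotypic G \<sigma> \<pi>)"
    if D: "irreducible_decomp G \<pi> D" for D
  proof -
    let ?E = "{U\<in>D. rep_iso G \<sigma> (\<pi>\<lparr>spc := U\<rparr>)}"
    have finD: "finite D" and subD: "\<And>X. X \<in> D \<Longrightarrow> subrep G X \<pi>" and dirD: "direct_family D"
      using D unfolding irreducible_decomp_def direct_family_def by simp_all
    have subspD: "p.subspace X" and inD: "X \<subseteq> spc \<pi>" if "X \<in> D" for X
      using subD[OF that] unfolding subrep_iff[OF p(1)] by blast+
    have dim: "p.dim U = ?d" if "U \<in> ?E" for U
      using rep_iso_dim(1)[OF rs is_rep_restrict[OF subD]] that by auto
    have "p.dim (isotypic G \<sigma> \<pi>) = p.dim (p.span (\<Union>?E))"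
      using isotypic_decomp[OF p(1) s D] by simp
    also have "\<dots> = (\<Sum>U\<in>?E. p.dim U)"
    proof (rule p.dim_direct_family)
      show "direct_family ?E" by (rule p.direct_family_subset[OF finD dirD]) (use subspD in auto)
      show "fin_dim (scl \<pi>) U" if "U \<in> ?E" for U using that p.fin_dim_subset[OF p(2) inD] by blast
    qed (use finD subspD in auto)
    also have "\<dots> = card ?E * ?d" using dim by simp
    finally show ?thesis by simp
  qed
  obtain D where D: "irreducible_decomp G \<pi> D"
    using exists_irreducible_decomp[OF G p] by blast
  have "multiplicity_rep G \<sigma> \<pi> = card {U\<in>D. rep_iso G \<sigma> (\<pi>\<lparr>spc := U\<rparr>)}"
    unfolding multiplicity_rep_def
  proof (rule the_equality)
    fix m assume "\<exists>D. irreducible_decomp G \<pi> D \<and> m = card {U\<in>D. rep_iso G \<sigma> (\<pi>\<lparr>spc := U\<rparr>)}"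
    then have "m * ?d = p.dim (isotypic G \<sigma> \<pi>)" using key by blast
    then have "m * ?d = card {U\<in>D. rep_iso G \<sigma> (\<pi>\<lparr>spc := U\<rparr>)} * ?d" using key[OF D] by (rule trans[OF _ sym])
    with d show "m = card {U\<in>D. rep_iso G \<sigma> (\<pi>\<lparr>spc := U\<rparr>)}" by simp
  qed (use D in blast)
  then show ?thesis using key[OF D] by simp
qed

lemma sum_apply: "(\<Sum>i\<in>A. f i) x = (\<Sum>i\<in>A. f i x)"
  by (induction A rule: infinite_finite_induct) auto

section \<open>Models on sequences, and the regular representation\<close>

lemma vector_space_fun_scale: "vector_space (fun_scale :: 'f::field \<Rightarrow> ('a \<Rightarrow> 'f) \<Rightarrow> 'a \<Rightarrow> 'f)"
  by unfold_locales (auto simp: fun_scale_def fun_eq_iff algebra_simps)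

text \<open>Transport of structure: an injective linear map carries the action to its image.\<close>

lemma rep_transport:
  fixes \<sigma> :: "('f::field, 'w::ab_group_add, 'g) rep" and s2 :: "'f \<Rightarrow> 'x::ab_group_add \<Rightarrow> 'x"
  assumes s: "is_rep G \<sigma>" and v2: "vector_space s2"
    and add: "\<And>x y. x \<in> spc \<sigma> \<Longrightarrow> y \<in> spc \<sigma> \<Longrightarrow> T (x + y) = T x + T y"
    and scale: "\<And>c x. x \<in> spc \<sigma> \<Longrightarrow> T (scl \<sigma> c x) = s2 c (T x)"
    and inj: "inj_on T (spc \<sigma>)"
  obtains \<pi> :: "('f, 'x, 'g) rep"
  where "scl \<pi> = s2" "spc \<pi> = T ` spc \<sigma>" "is_rep G \<pi>" "rep_hom G \<sigma> \<pi> T" "rep_iso G \<sigma> \<pi>"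
proof -
  interpret s: vector_space "scl \<sigma>" using is_repD(1) s .
  interpret n: vector_space s2 by (rule v2)
  have sub: "s.subspace (spc \<sigma>)" using is_repD(2) s .
  define S where "S = inv_into (spc \<sigma>) T"
  let ?\<pi> = "\<lparr>scl = s2, spc = T ` spc \<sigma>, act = \<lambda>g y. T (act \<sigma> g (S y))\<rparr>"
  have ST: "S (T x) = x" if "x \<in> spc \<sigma>" for x
    unfolding S_def using inv_into_f_f[OF inj that] .
  have hom: "rep_hom G \<sigma> ?\<pi> T"
    by (rule rep_homI) (use add scale ST in auto)
  have "is_rep G ?\<pi>"
  proof (rule is_repI)
    interpret vector_space_pair "scl \<sigma>" s2 ..
    obtain f where f: "Vector_Spaces.linear (scl \<sigma>) s2 f" "\<And>x. x \<in> spc \<sigma> \<Longrightarrow> f x = T x"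
      by (rule linear_extension_from_subspace[OF sub, of T]) (use add scale in auto)
    have "f ` spc \<sigma> = T ` spc \<sigma>" using f(2) by (rule image_cong[OF refl])
    then show "module.subspace (scl ?\<pi>) (spc ?\<pi>)"
      using linear_subspace_image[OF f(1) sub] by simp
    show "vector_space (scl ?\<pi>)" using v2 by simp
  next
    fix g x assume g: "g \<in> carrier G" and x: "x \<in> spc ?\<pi>"
    show "act ?\<pi> g x \<in> spc ?\<pi>" using g x ST is_repD(3)[OF s g] by auto
  next
    fix g x y assume g: "g \<in> carrier G" and "x \<in> spc ?\<pi>" "y \<in> spc ?\<pi>"
    then obtain u w where u: "x = T u" "y = T w" "u \<in> spc \<sigma>" "w \<in> spc \<sigma>" by auto
    have "x + y = T (u + w)" using u add by simp
    moreover have "u + w \<in> spc \<sigma>" using u s.subspace_add[OF sub] by blast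
    ultimately have "act ?\<pi> g (x + y) = T (act \<sigma> g (u + w))" using ST by simp
    also have "\<dots> = T (act \<sigma> g u) + T (act \<sigma> g w)"
      using add[OF is_repD(3)[OF s g u(3)] is_repD(3)[OF s g u(4)]] is_repD(4)[OF s g u(3,4)] by simp
    also have "\<dots> = act ?\<pi> g x + act ?\<pi> g y" using u ST by simp
    finally show "act ?\<pi> g (x + y) = act ?\<pi> g x + act ?\<pi> g y" .
  next
    fix g c x assume g: "g \<in> carrier G" and "x \<in> spc ?\<pi>"
    then obtain u where u: "x = T u" "u \<in> spc \<sigma>" by auto
    have "s2 c x = T (scl \<sigma> c u)" using u scale by simp
    moreover have "scl \<sigma> c u \<in> spc \<sigma>" using u s.subspace_scale[OF sub] by blast
    ultimately have "act ?\<pi> g (scl ?\<pi> c x) = T (act \<sigma> g (scl \<sigma> c u))" using ST by simp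
    also have "\<dots> = s2 c (T (act \<sigma> g u))"
      using scale[OF is_repD(3)[OF s g u(2)]] is_repD(5)[OF s g u(2)] by simp
    also have "\<dots> = scl ?\<pi> c (act ?\<pi> g x)" using u ST by simp
    finally show "act ?\<pi> g (scl ?\<pi> c x) = scl ?\<pi> c (act ?\<pi> g x)" .
  next
    fix x assume "x \<in> spc ?\<pi>"
    then obtain u where u: "x = T u" "u \<in> spc \<sigma>" by auto
    then show "act ?\<pi> \<one>\<^bsub>G\<^esub> x = x" using ST is_repD(6)[OF s u(2)] by simp
  next
    fix g h x assume g: "g \<in> carrier G" and h: "h \<in> carrier G" and "x \<in> spc ?\<pi>"
    then obtain u where u: "x = T u" "u \<in> spc \<sigma>" by auto
    then show "act ?\<pi> (g \<otimes>\<^bsub>G\<^esub> h) x = act ?\<pi> g (act ?\<pi> h x)"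
      using ST is_repD(3)[OF s h u(2)] is_repD(7)[OF s g h u(2)] by simp
  qed
  moreover have "rep_iso G \<sigma> ?\<pi>"
    unfolding rep_iso_iff using hom inj by (intro exI[of _ T]) (simp add: bij_betw_def)
  ultimately show thesis using that[of ?\<pi>] hom by simp
qed

text \<open>Coordinates with respect to a basis move a finite-dimensional representation into the sequences.\<close>

lemma exists_sequence_model:
  fixes \<sigma> :: "('f::field, 'w::ab_group_add, 'g) rep"
  assumes s: "is_rep G \<sigma>" and fd: "fin_dim (scl \<sigma>) (spc \<sigma>)"
  obtains \<pi> :: "('f, nat \<Rightarrow> 'f, 'g) rep"
  where "scl \<pi> = fun_scale" "is_rep G \<pi>" "rep_iso G \<sigma> \<pi>"
proof -
  interpret s: vector_space "scl \<sigma>" using is_repD(1) s .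
  have sub: "s.subspace (spc \<sigma>)" using is_repD(2) s .
  interpret n: vector_space "fun_scale :: 'f \<Rightarrow> (nat \<Rightarrow> 'f) \<Rightarrow> nat \<Rightarrow> 'f" by (rule vector_space_fun_scale)
  obtain B where B: "finite B" "s.independent B" "B \<subseteq> spc \<sigma>" "s.span B = spc \<sigma>"
    by (rule s.fin_dim_basis[OF fd sub])
  obtain b where b: "bij_betw b {..<card B} B"
    using ex_bij_betw_nat_finite[OF B(1)] unfolding atLeast0LessThan by blast
  define T where "T = (\<lambda>x i. if i < card B then s.representation B x (b i) else 0)"
  have add: "T (x + y) = T x + T y" if "x \<in> spc \<sigma>" "y \<in> spc \<sigma>" for x y
    using that s.representation_add[OF B(2), of y x] unfolding B(4) by (auto simp: T_def fun_eq_iff add.commute)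
  have scale: "T (scl \<sigma> c x) = fun_scale c (T x)" if "x \<in> spc \<sigma>" for c x
    using s.representation_scale[OF B(2), of x c] that unfolding B(4) T_def fun_scale_def by (simp add: fun_eq_iff)
  have inj: "inj_on T (spc \<sigma>)"
  proof (rule inj_onI)
    fix x y assume xy: "x \<in> spc \<sigma>" "y \<in> spc \<sigma>" "T x = T y"
    have "s.representation B x v = s.representation B y v" if v: "v \<in> B" for v
    proof -
      obtain i where "i < card B" "v = b i" using b v unfolding bij_betw_def by blast
      with fun_cong[OF xy(3), of i] show ?thesis by (simp add: T_def)
    qed
    then have "(\<Sum>v\<in>B. scl \<sigma> (s.representation B x v) v) = (\<Sum>v\<in>B. scl \<sigma> (s.representation B y v) v)"
      by simp
    then show "x = y" using s.sum_representation_eq[OF B(2) _ B(1) order.refl] xy B(4) by simp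
  qed
  show thesis by (rule rep_transport[OF s vector_space_fun_scale add scale inj]) (use that in auto)
qed

lemma is_rep_regular:
  assumes "group G"
  shows "is_rep G (regular_rep G :: ('f::field, 'g \<Rightarrow> 'f, 'g) rep)"
proof -
  interpret group G by fact
  interpret n: vector_space "fun_scale :: 'f \<Rightarrow> ('g \<Rightarrow> 'f) \<Rightarrow> 'g \<Rightarrow> 'f" by (rule vector_space_fun_scale)
  show ?thesis
  proof (rule is_repI, simp_all add: regular_rep_def)
    show "vector_space (fun_scale :: 'f \<Rightarrow> ('g \<Rightarrow> 'f) \<Rightarrow> 'g \<Rightarrow> 'f)" by (rule vector_space_fun_scale)
    show "n.subspace {a. \<forall>x. x \<notin> carrier G \<longrightarrow> a x = 0}"
      by (auto simp: n.subspace_def fun_scale_def)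
  qed (auto simp: fun_eq_iff fun_scale_def inv_mult_group m_assoc)
qed

lemma fin_dim_regular:
  assumes "finite (carrier G)"
  shows "fin_dim fun_scale (spc (regular_rep G :: ('f::field, 'g \<Rightarrow> 'f, 'g) rep))"
proof -
  interpret n: vector_space "fun_scale :: 'f \<Rightarrow> ('g \<Rightarrow> 'f) \<Rightarrow> 'g \<Rightarrow> 'f" by (rule vector_space_fun_scale)
  let ?e = "\<lambda>g x. if x = g then 1 else 0 :: 'f"
  have "a \<in> n.span (?e ` carrier G)" if a: "\<forall>x. x \<notin> carrier G \<longrightarrow> a x = 0" for a
  proof -
    have "a = (\<Sum>g\<in>carrier G. fun_scale (a g) (?e g))"
    proof
      fix x
      have "(\<Sum>g\<in>carrier G. fun_scale (a g) (?e g)) x = (\<Sum>g\<in>carrier G. if g = x then a x else 0)"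
        by (subst sum_apply) (auto simp: fun_scale_def intro: sum.cong)
      also have "\<dots> = a x" using a assms by simp
      finally show "a x = (\<Sum>g\<in>carrier G. fun_scale (a g) (?e g)) x" by simp
    qed
    also have "\<dots> \<in> n.span (?e ` carrier G)"
      by (intro n.span_sum n.span_scale n.span_base) blast
    finally show ?thesis .
  qed
  then show ?thesis unfolding fin_dim_def regular_rep_def
    using assms by (intro exI[of _ "?e ` carrier G"]) auto
qed

lemma is_rep_trivial: "is_rep G (trivial_rep :: ('f::field, 'f, 'g) rep)"
proof -
  have v: "vector_space ((*) :: 'f \<Rightarrow> 'f \<Rightarrow> 'f)" by unfold_locales (auto simp: algebra_simps)
  then have "module ((*) :: 'f \<Rightarrow> 'f \<Rightarrow> 'f)" by (simp add: module_iff_vector_space)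
  from module.subspace_UNIV[OF this] v show ?thesis by (intro is_repI) (auto simp: trivial_rep_def)
qed

section \<open>Hermitian geometry over the reals and the complex numbers at once\<close>

lemma cj_0 [simp]: "cj (0::'f::real_or_complex) = 0"
  using cj_add[of "0::'f" 0] by simp

lemma cj_eq_divide: "x \<noteq> 0 \<Longrightarrow> cj x = of_real ((norm x)\<^sup>2) / (x::'f::real_or_complex)"
  using mult_cj[of x] by (simp add: field_simps scaleR_conv_of_real)

lemma cj_mult: "cj (x * y) = cj x * cj (y::'f::real_or_complex)"
  by (cases "x = 0 \<or> y = 0") (auto simp: cj_eq_divide norm_mult power_mult_distrib)

lemma norm_cj [simp]: "norm (cj (x::'f::real_or_complex)) = norm x"
  by (cases "x = 0") (auto simp: cj_eq_divide norm_divide norm_mult power2_eq_square)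

lemma cj_eq_0_iff [simp]: "cj x = 0 \<longleftrightarrow> (x::'f::real_or_complex) = 0"
  by (metis norm_cj norm_eq_zero)

lemma cj_cj [simp]: "cj (cj x) = (x::'f::real_or_complex)"
proof (cases "x = 0")
  case False
  then have "cj x \<noteq> 0" by simp
  then have "cj (cj x) = of_real ((norm x)\<^sup>2) / cj x" by (subst cj_eq_divide) auto
  also have "\<dots> = x" using False by (simp add: cj_eq_divide[OF False])
  finally show ?thesis .
qed simp

lemma cj_of_real [simp]: "cj (of_real a :: 'f::real_or_complex) = of_real a"
  by (cases "a = 0") (auto simp: cj_eq_divide power2_eq_square)

lemma cj_minus [simp]: "cj (- x) = - cj (x::'f::real_or_complex)"
proof -
  have "cj (- x) + cj x = 0" using cj_add[of "-x" x] by simp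
  then show ?thesis by (rule eq_neg_iff_add_eq_0[THEN iffD2])
qed

lemma cj_sum: "cj (\<Sum>i\<in>A. f i) = (\<Sum>i\<in>A. cj (f i :: 'f::real_or_complex))"
  by (induction A rule: infinite_finite_induct) (auto simp: cj_add)

text \<open>An imaginary unit has norm \<open>1\<close>, so the axiom on \<open>x * cj x\<close> forces \<open>cj i = - i\<close>.\<close>

lemma real_or_imaginary_unit:
  obtains "\<forall>z::'f::real_or_complex. z \<in> \<real>" "\<forall>z::'f::real_or_complex. cj z = z"
  | i :: "'f::real_or_complex" where "\<not> (\<forall>z::'f::real_or_complex. z \<in> \<real>)" "i * i = -1" "cj i = - i"
proof (cases "\<forall>z::'f. z \<in> \<real>")
  case True
  moreover have "cj z = z" for z :: 'f using True by (metis Reals_cases cj_of_real)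
  ultimately show thesis using that(1) by blast
next
  case False
  then have "\<not> (\<forall>z::'f. \<exists>a. z = a *\<^sub>R 1)"
    by (metis Reals_of_real scaleR_conv_of_real mult.right_neutral)
  then obtain i :: 'f where i: "i * i = -1" using real_or_complex[where 'a='f] by blast
  then have "norm i * norm i = 1" by (metis norm_minus_cancel norm_mult norm_one)
  then have n: "(norm i)\<^sup>2 = 1" by (simp add: power2_eq_square)
  have "i \<noteq> 0" using i by auto
  moreover have "i * cj i = i * (- i)" using mult_cj[of i] i n by simp
  ultimately have "cj i = - i" using mult_left_cancel by blast
  with False i that(2) show thesis by blast
qed

context fd_hilbert_space begin

lemma fin_dim_any: "fin_dim smul S"
  using finite_dim unfolding fin_dim_def by blast

lemma ip_add_right: "ip x (y + z) = ip x y + ip x z"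
  by (metis ip_commute ip_add_left cj_add)

lemma ip_scale_right: "ip x (smul c y) = cj c * ip x y"
  by (metis ip_commute ip_scale_left cj_mult)

lemma ip_0_left [simp]: "ip 0 y = 0"
  using ip_scale_left[of 0 0 y] by simp

lemma ip_0_right [simp]: "ip x 0 = 0"
  using ip_scale_right[of x 0 0] by simp

lemma ip_minus_left [simp]: "ip (- x) y = - ip x y"
  using ip_add_left[of x "-x" y] by (simp add: eq_neg_iff_add_eq_0 add.commute)

lemma ip_minus_right [simp]: "ip x (- y) = - ip x y"
  using ip_add_right[of x y "-y"] by (simp add: eq_neg_iff_add_eq_0 add.commute)

lemma ip_diff_left: "ip (x - y) z = ip x z - ip y z"
  using ip_add_left[of x "-y" z] by simp

lemma ip_diff_right: "ip x (y - z) = ip x y - ip x z"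
  using ip_add_right[of x y "-z"] by simp

lemma ip_sum_left: "ip (\<Sum>i\<in>A. f i) y = (\<Sum>i\<in>A. ip (f i) y)"
  by (induction A rule: infinite_finite_induct) (auto simp: ip_add_left)

lemma ip_sum_right: "ip x (\<Sum>i\<in>A. f i) = (\<Sum>i\<in>A. ip x (f i))"
  by (induction A rule: infinite_finite_induct) (auto simp: ip_add_right)

lemma ip_self: "ip x x = of_real ((hnorm ip x)\<^sup>2)"
proof (cases "x = 0")
  case False
  then obtain t where "t > 0" "ip x x = of_real t" using ip_pos by blast
  then show ?thesis unfolding hnorm_def by simp
qed (simp add: hnorm_def)

lemma ip_self_eq_0 [simp]: "ip x x = 0 \<longleftrightarrow> x = 0"
  using ip_pos[of x] by (cases "x = 0") auto

lemma hnorm_eq_0 [simp]: "hnorm ip x = 0 \<longleftrightarrow> x = 0"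
  unfolding hnorm_def by simp

lemma hnorm_nonneg [simp]: "hnorm ip x \<ge> 0"
  unfolding hnorm_def by simp

lemma hnorm_scale: "hnorm ip (smul c x) = norm c * hnorm ip x"
  unfolding hnorm_def
  by (simp add: ip_scale_left ip_scale_right norm_mult real_sqrt_mult mult.assoc[symmetric] real_sqrt_mult_self)

lemma hnorm_minus: "hnorm ip (- x) = hnorm ip x"
  unfolding hnorm_def by simp

lemma ip_eq_0_commute: "ip x y = 0 \<longleftrightarrow> ip y x = 0"
  by (metis ip_commute cj_eq_0_iff)

lemma cauchy_schwarz: "norm (ip x y) \<le> hnorm ip x * hnorm ip y"
proof (cases "y = 0")
  case False
  let ?a = "ip x y" and ?n = "hnorm ip y"
  let ?m = "of_real (1 / ?n\<^sup>2) :: 'f"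
  let ?c = "?a * ?m"
  have cc: "cj ?c = cj ?a * ?m" by (simp only: cj_mult cj_of_real)
  have e: "?m * ip y y = 1" using False by (simp only: ip_self flip: of_real_mult) simp
  have "of_real ((hnorm ip (x - smul ?c y))\<^sup>2) = ip (x - smul ?c y) (x - smul ?c y)"
    by (simp only: ip_self)
  also have "\<dots> = ip x x - cj ?c * ?a - ?c * cj ?a + ?c * cj ?c * ip y y"
    unfolding ip_diff_left ip_diff_right ip_scale_left ip_scale_right ip_commute[of y x]
    by (simp add: algebra_simps)
  also have "?c * cj ?c * ip y y = ?c * cj ?a"
    by (simp only: cc mult.assoc e mult_1_right)
  also have "ip x x - cj ?c * ?a - ?c * cj ?a + ?c * cj ?a = ip x x - ?a * cj ?a * ?m"
    by (simp only: cc mult_ac) (simp add: algebra_simps)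
  also have "\<dots> = of_real ((hnorm ip x)\<^sup>2 - (norm ?a)\<^sup>2 * (1 / ?n\<^sup>2))"
    by (simp only: ip_self mult_cj scaleR_conv_of_real mult_1_right of_real_diff of_real_mult)
  finally have "(hnorm ip (x - smul ?c y))\<^sup>2 = (hnorm ip x)\<^sup>2 - (norm ?a)\<^sup>2 * (1 / ?n\<^sup>2)"
    unfolding of_real_eq_iff .
  then have "(norm ?a)\<^sup>2 * (1 / ?n\<^sup>2) \<le> (hnorm ip x)\<^sup>2"
    using zero_le_power2[of "hnorm ip (x - smul ?c y)"] by linarith
  then have "(norm ?a)\<^sup>2 * (1 / ?n\<^sup>2) * ?n\<^sup>2 \<le> (hnorm ip x)\<^sup>2 * ?n\<^sup>2" by (rule mult_right_mono) simp
  then have "(norm ?a)\<^sup>2 \<le> (hnorm ip x * ?n)\<^sup>2" using False by (simp add: power_mult_distrib)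
  then show ?thesis by (rule power2_le_imp_le) simp
qed simp

lemma hnorm_triangle: "hnorm ip (x + y) \<le> hnorm ip x + hnorm ip y"
proof -
  have sq: "norm (ip z z) = (hnorm ip z)\<^sup>2" for z by (simp add: hnorm_def)
  have "(hnorm ip (x + y))\<^sup>2 = norm (ip (x + y) (x + y))" by (simp add: sq)
  also have "\<dots> = norm (ip x x + ip x y + ip y x + ip y y)" by (simp add: ip_add_left ip_add_right algebra_simps)
  also have "\<dots> \<le> norm (ip x x) + norm (ip x y) + norm (ip y x) + norm (ip y y)"
    by (intro norm_triangle_mono order.refl)
  also have "\<dots> \<le> (hnorm ip x)\<^sup>2 + hnorm ip x * hnorm ip y + hnorm ip y * hnorm ip x + (hnorm ip y)\<^sup>2"
    unfolding sq by (intro add_mono order.refl cauchy_schwarz)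
  also have "\<dots> = (hnorm ip x + hnorm ip y)\<^sup>2" by (simp add: power2_eq_square algebra_simps)
  finally show ?thesis by (rule power2_le_imp_le) simp
qed

lemma Metric_space_hnorm: "Metric_space UNIV (\<lambda>x y. hnorm ip (x - y))"
proof
  show "hnorm ip (x - y) = hnorm ip (y - x)" for x y using hnorm_minus[of "x - y"] by simp
  show "hnorm ip (x - z) \<le> hnorm ip (x - y) + hnorm ip (y - z)" for x y z
    using hnorm_triangle[of "x - y" "y - z"] by simp
qed auto

section \<open>Orthonormal bases and orthogonal complements\<close>

definition orthonormal :: "'v set \<Rightarrow> bool"
  where "orthonormal B \<longleftrightarrow> (\<forall>a\<in>B. \<forall>b\<in>B. ip a b = (if a = b then 1 else 0))"

lemma orthonormal_sum:
  assumes "finite B" "orthonormal B" "b \<in> B"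
  shows "ip (\<Sum>a\<in>B. smul (c a) a) b = c b"
proof -
  have "ip (\<Sum>a\<in>B. smul (c a) a) b = (\<Sum>a\<in>B. if a = b then c a else 0)"
    unfolding ip_sum_left ip_scale_left
    by (rule sum.cong) (use assms(2,3) in \<open>auto simp: orthonormal_def\<close>)
  also have "\<dots> = c b" using assms by simp
  finally show ?thesis .
qed

lemma orthonormal_independent:
  assumes "finite B" "orthonormal B"
  shows "independent B"
proof (rule independent_if_scalars_zero[OF assms(1)])
  fix c b assume "(\<Sum>a\<in>B. smul (c a) a) = 0" "b \<in> B"
  then show "c b = 0" using orthonormal_sum[OF assms, of b c] by simp
qed

lemma orthonormal_residue:
  assumes "finite B" "orthonormal B" "b \<in> B"
  shows "ip (x - (\<Sum>a\<in>B. smul (ip x a) a)) b = 0"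
  using orthonormal_sum[OF assms, of "ip x"] by (simp add: ip_diff_left)

text \<open>An orthonormal set in \<open>U\<close> of maximal size spans \<open>U\<close>: otherwise the normalized residue of a vector outside
  its span could be added.\<close>

lemma exists_orthonormal_basis:
  assumes U: "subspace U"
  obtains B where "finite B" "orthonormal B" "B \<subseteq> U" "span B = U" "card B = dim U"
proof -
  let ?P = "\<lambda>n. \<exists>B. finite B \<and> orthonormal B \<and> B \<subseteq> U \<and> card B = n"
  have bound: "n \<le> dim U" if "?P n" for n
    using that independent_card_le[OF fin_dim_any _ _ U] orthonormal_independent by blast
  have "?P 0" by (intro exI[of _ "{}"]) (simp add: orthonormal_def)
  then have "?P (Greatest ?P)" by (rule GreatestI_nat) (use bound in blast)
  then obtain B where B: "finite B" "orthonormal B" "B \<subseteq> U" "card B = Greatest ?P" by blast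
  have "x \<in> span B" if x: "x \<in> U" for x
  proof (rule ccontr)
    assume nx: "x \<notin> span B"
    let ?y = "x - (\<Sum>a\<in>B. smul (ip x a) a)"
    have s: "(\<Sum>a\<in>B. smul (ip x a) a) \<in> span B"
      by (intro span_sum span_scale span_base)
    have y0: "?y \<noteq> 0" using nx s by auto
    have "span B \<subseteq> U" using B(3) U by (rule span_minimal)
    then have yU: "?y \<in> U" using s x subspace_diff[OF U] by blast
    let ?n = "hnorm ip ?y"
    let ?z = "smul (of_real (1 / ?n)) ?y"
    have zb: "ip ?z b = 0" if "b \<in> B" for b
      using orthonormal_residue[OF B(1,2) that] by (simp add: ip_scale_left)
    have "hnorm ip ?z = 1" using y0 unfolding hnorm_scale by (simp add: norm_divide)
    then have zz: "ip ?z ?z = 1" by (simp only: ip_self) simp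
    have "?z \<notin> B" using zb[of ?z] zz by auto
    moreover have "orthonormal (insert ?z B)"
      using B(2) zb zz ip_eq_0_commute[of ?z] \<open>?z \<notin> B\<close> unfolding orthonormal_def by auto
    moreover have "?z \<in> U" using yU subspace_scale[OF U] by blast
    ultimately have "?P (Suc (card B))"
      using B(1,3) by (intro exI[of _ "insert ?z B"]) auto
    then have "Suc (card B) \<le> Greatest ?P" by (rule Greatest_le_nat) (use bound in blast)
    with B(4) show False by simp
  qed
  then have "span B = U" using B(3) span_minimal[OF B(3) U] by blast
  moreover have "card B = dim U"
    using orthonormal_independent[OF B(1,2)] dim_span_eq_card_independent calculation by metis
  ultimately show thesis using that B by blast
qed

lemma orthonormal_expand:
  assumes "finite B" "orthonormal B" "x \<in> span B"
  shows "x = (\<Sum>a\<in>B. smul (ip x a) a)"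
proof -
  obtain c where c: "x = (\<Sum>a\<in>B. smul (c a) a)" using assms(3) span_finite[OF assms(1)] by auto
  have "ip x a = c a" if "a \<in> B" for a unfolding c by (rule orthonormal_sum[OF assms(1,2) that])
  then show ?thesis using c by simp
qed

lemma riesz_on_subspace:
  assumes U: "subspace U" and add: "\<And>x y. x \<in> U \<Longrightarrow> y \<in> U \<Longrightarrow> l (x + y) = l x + l y"
    and scale: "\<And>c x. x \<in> U \<Longrightarrow> l (smul c x) = c * l x"
  obtains u where "u \<in> U" "\<And>x. x \<in> U \<Longrightarrow> l x = ip x u"
proof -
  obtain B where B: "finite B" "orthonormal B" "B \<subseteq> U" "span B = U"
    by (rule exists_orthonormal_basis[OF U])
  let ?u = "\<Sum>b\<in>B. smul (cj (l b)) b"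
  have 0: "l 0 = 0" using scale[of 0 0] subspace_0[OF U] by simp
  have sum: "l (\<Sum>b\<in>A. smul (c b) b) = (\<Sum>b\<in>A. c b * l b) \<and> (\<Sum>b\<in>A. smul (c b) b) \<in> U"
    if "finite A" "A \<subseteq> U" for A c
    using that
  proof (induction A)
    case empty
    then show ?case using 0 subspace_0[OF U] by simp
  next
    case (insert b A)
    then show ?case
      using add[of "smul (c b) b" "\<Sum>b\<in>A. smul (c b) b"] scale[of b] subspace_add[OF U] subspace_scale[OF U] by auto
  qed
  have "l x = ip x ?u" if x: "x \<in> U" for x
  proof -
    have "l x = l (\<Sum>b\<in>B. smul (ip x b) b)" using orthonormal_expand[OF B(1,2)] x B(4) by simp
    also have "\<dots> = (\<Sum>b\<in>B. ip x b * l b)" using sum[OF B(1,3)] by blast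
    also have "\<dots> = ip x ?u" by (simp add: ip_sum_right ip_scale_right mult.commute)
    finally show ?thesis .
  qed
  moreover have "?u \<in> U" by (rule conjunct2[OF sum[OF B(1,3)]])
  ultimately show thesis using that by blast
qed

definition perp :: "'v set \<Rightarrow> 'v set"
  where "perp S = {x. \<forall>y\<in>S. ip x y = 0}"

lemma subspace_perp: "subspace (perp S)"
  by (rule subspaceI) (auto simp: perp_def ip_add_left ip_scale_left)

lemma perp_span: "perp (span S) = perp S"
proof -
  have "ip x y = 0" if "x \<in> perp S" "y \<in> span S" for x y
  proof -
    have "subspace {y. ip x y = 0}"
      by (rule subspaceI) (auto simp: ip_add_right ip_scale_right)
    moreover have "S \<subseteq> {y. ip x y = 0}" using that(1) by (auto simp: perp_def)
    ultimately have "span S \<subseteq> {y. ip x y = 0}" by (rule span_minimal[rotated])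
    with that(2) show ?thesis by blast
  qed
  then show ?thesis using span_superset[of S] by (fastforce simp: perp_def)
qed

lemma perp_disjoint: "x \<in> S \<Longrightarrow> x \<in> perp S \<Longrightarrow> x = 0"
  unfolding perp_def using ip_self_eq_0 by blast

definition orthogonal_projection :: "'v set \<Rightarrow> ('v \<Rightarrow> 'v) \<Rightarrow> bool"
  where "orthogonal_projection U P \<longleftrightarrow> Vector_Spaces.linear smul smul P \<and> (\<forall>x. P x \<in> U) \<and> (\<forall>x\<in>U. P x = x) \<and>
    (\<forall>x. x - P x \<in> perp U) \<and> (\<forall>x\<in>perp U. P x = 0)"

definition proj :: "'v set \<Rightarrow> 'v \<Rightarrow> 'v"
  where "proj U = (SOME P. orthogonal_projection U P)"

lemma proj_props:
  assumes U: "subspace U"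
  shows "Vector_Spaces.linear smul smul (proj U)" "proj U x \<in> U" "x \<in> U \<Longrightarrow> proj U x = x"
    "x - proj U x \<in> perp U" "x \<in> perp U \<Longrightarrow> proj U x = 0"
    "proj U (x + y) = proj U x + proj U y" "proj U (smul c x) = smul c (proj U x)"
proof -
  obtain B where B: "finite B" "orthonormal B" "B \<subseteq> U" "span B = U"
    by (rule exists_orthonormal_basis[OF U])
  let ?P = "\<lambda>x. \<Sum>b\<in>B. smul (ip x b) b"
  have "Vector_Spaces.linear smul smul ?P"
    unfolding Vector_Spaces.linear_iff using vector_space_axioms
    by (auto simp: ip_add_left ip_scale_left scale_left_distrib sum.distrib scale_sum_right)
  moreover have "?P x \<in> U" for x using B(3) by (intro subspace_sum[OF U] subspace_scale[OF U]) auto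
  moreover have "?P x = x" if "x \<in> U" for x using orthonormal_expand[OF B(1,2)] that B(4) by simp
  moreover have "x - ?P x \<in> perp U" for x
  proof -
    have "x - ?P x \<in> perp B" unfolding perp_def using orthonormal_residue[OF B(1,2)] by blast
    then show ?thesis using perp_span[of B] B(4) by simp
  qed
  moreover have "?P x = 0" if "x \<in> perp U" for x
    using that B(3) by (intro sum.neutral) (auto simp: perp_def)
  ultimately have "orthogonal_projection U ?P" unfolding orthogonal_projection_def by fast
  then have "orthogonal_projection U (proj U)" unfolding proj_def by (rule someI[of "orthogonal_projection U"])
  then show "Vector_Spaces.linear smul smul (proj U)" "proj U x \<in> U" "x \<in> U \<Longrightarrow> proj U x = x"
    "x - proj U x \<in> perp U" "x \<in> perp U \<Longrightarrow> proj U x = 0"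
    "proj U (x + y) = proj U x + proj U y" "proj U (smul c x) = smul c (proj U x)"
    unfolding orthogonal_projection_def Vector_Spaces.linear_iff by blast+
qed

lemma dim_perp:
  assumes U: "subspace U"
  shows "dim U + dim (perp U) = dim UNIV"
proof -
  interpret vector_space_pair smul smul ..
  define P where "P = proj U"
  note P = proj_props[OF U, folded P_def]
  have "{x\<in>UNIV. P x = 0} = perp U"
    using P(4,5) by (auto) (metis diff_zero)
  moreover have "range P = U" using P(2,3) by (auto simp: image_iff) metis
  ultimately show ?thesis using rank_nullity[OF P(1) subspace_UNIV fin_dim_any] by simp
qed

section \<open>Linear isometries\<close>

text \<open>The norms of \<open>x\<close>, \<open>y\<close> and \<open>x + y\<close> determine \<open>\<langle>x, y\<rangle> + cj \<langle>x, y\<rangle>\<close>; over the complex numbers, \<open>i x\<close> in place of \<open>x\<close>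
  gives the other half.\<close>

lemma isometry_ip:
  assumes f: "Vector_Spaces.linear smul smul f" and n: "\<And>x. hnorm ip (f x) = hnorm ip x"
  shows "ip (f x) (f y) = ip x y"
proof -
  have fadd: "f (x + y) = f x + f y" and fscale: "f (smul c x) = smul c (f x)" for c x y
    using f unfolding Vector_Spaces.linear_iff by auto
  have re: "ip (f x) (f y) + cj (ip (f x) (f y)) = ip x y + cj (ip x y)" for x y
  proof -
    have "ip (x + y) (x + y) = ip x x + ip y y + (ip x y + cj (ip x y))" for x y
      by (simp add: ip_add_left ip_add_right ip_commute[of y x])
    from this[of x y] this[of "f x" "f y"] show ?thesis
      using n[of "x + y"] n[of x] n[of y] unfolding fadd ip_self by simp
  qed
  show ?thesis
  proof (cases rule: real_or_imaginary_unit[where 'f='f])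
    case 1
    with re[of x y] have "2 * ip (f x) (f y) = 2 * ip x y" by simp
    then show ?thesis by simp
  next
    case (2 i)
    have "i * ip (f x) (f y) - i * cj (ip (f x) (f y)) = i * ip x y - i * cj (ip x y)"
      using re[of "smul i x" y] 2 by (simp add: fscale ip_scale_left cj_mult)
    then have "i * (ip (f x) (f y) - cj (ip (f x) (f y))) = i * (ip x y - cj (ip x y))"
      by (simp add: right_diff_distrib)
    moreover have "i \<noteq> 0" using 2 by auto
    ultimately have "ip (f x) (f y) - cj (ip (f x) (f y)) = ip x y - cj (ip x y)" by simp
    then have "(ip (f x) (f y) - cj (ip (f x) (f y))) + (ip (f x) (f y) + cj (ip (f x) (f y))) =
        (ip x y - cj (ip x y)) + (ip x y + cj (ip x y))" using re[of x y] by simp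
    then have "2 * ip (f x) (f y) = 2 * ip x y" by (simp add: algebra_simps)
    then show ?thesis by simp
  qed
qed

lemma Aut_iff: "f \<in> carrier (Aut smul ip) \<longleftrightarrow>
    Vector_Spaces.linear smul smul f \<and> bij f \<and> (\<forall>x y. ip (f x) (f y) = ip x y)"
  unfolding Aut_def using isometry_ip by (auto simp: hnorm_def)

lemma Aut_add: "f \<in> carrier (Aut smul ip) \<Longrightarrow> f (x + y) = f x + f y"
  unfolding Aut_iff Vector_Spaces.linear_iff by blast

lemma Aut_scale: "f \<in> carrier (Aut smul ip) \<Longrightarrow> f (smul c x) = smul c (f x)"
  unfolding Aut_iff Vector_Spaces.linear_iff by blast

lemma Aut_ip: "f \<in> carrier (Aut smul ip) \<Longrightarrow> ip (f x) (f y) = ip x y"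
  unfolding Aut_iff by blast

lemma group_Aut: "group (Aut smul ip)"
proof (rule groupI)
  fix f g assume fg: "f \<in> carrier (Aut smul ip)" "g \<in> carrier (Aut smul ip)"
  then show "f \<otimes>\<^bsub>Aut smul ip\<^esub> g \<in> carrier (Aut smul ip)"
    unfolding Aut_iff by (auto simp: Aut_def Vector_Spaces.linear_iff bij_comp)
next
  show "\<one>\<^bsub>Aut smul ip\<^esub> \<in> carrier (Aut smul ip)"
    unfolding Aut_iff by (auto simp: Aut_def Vector_Spaces.linear_iff vector_space_axioms)
next
  fix f assume f: "f \<in> carrier (Aut smul ip)"
  then have b: "bij f" unfolding Aut_iff by blast
  have s: "f (inv_into UNIV f x) = x" for x using b by (simp add: bij_is_surj surj_f_inv_f)
  have i: "inv_into UNIV f (f x) = x" for x using b by (simp add: bij_is_inj)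
  have "inv_into UNIV f (x + y) = inv_into UNIV f x + inv_into UNIV f y" for x y
    using i[of "inv_into UNIV f x + inv_into UNIV f y"] unfolding Aut_add[OF f] s .
  moreover have "inv_into UNIV f (smul c x) = smul c (inv_into UNIV f x)" for c x
    using i[of "smul c (inv_into UNIV f x)"] unfolding Aut_scale[OF f] s .
  moreover have "ip (inv_into UNIV f x) (inv_into UNIV f y) = ip x y" for x y
    using Aut_ip[OF f, of "inv_into UNIV f x" "inv_into UNIV f y"] unfolding s by simp
  ultimately have "inv_into UNIV f \<in> carrier (Aut smul ip)"
    unfolding Aut_iff using b by (auto simp: Vector_Spaces.linear_iff vector_space_axioms bij_imp_bij_inv)
  moreover have "inv_into UNIV f \<otimes>\<^bsub>Aut smul ip\<^esub> f = \<one>\<^bsub>Aut smul ip\<^esub>"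
    using i by (auto simp: Aut_def)
  ultimately show "\<exists>g\<in>carrier (Aut smul ip). g \<otimes>\<^bsub>Aut smul ip\<^esub> f = \<one>\<^bsub>Aut smul ip\<^esub>" by blast
qed (auto simp: Aut_def)

abbreviation Grp :: "('v \<Rightarrow> 'v) set \<Rightarrow> ('v \<Rightarrow> 'v) monoid"
  where "Grp G \<equiv> (Aut smul ip)\<lparr>carrier := G\<rparr>"

lemma Grp_simps [simp]: "carrier (Grp G) = G" "mult (Grp G) = (\<circ>)" "one (Grp G) = id"
  by (simp_all add: Aut_def)

end

lemma (in fd_hilbert_space) subgroup_AutI:
  assumes "\<And>f. f \<in> H \<Longrightarrow> f \<in> carrier (Aut smul ip)" "id \<in> H"
    "\<And>f g. f \<in> H \<Longrightarrow> g \<in> H \<Longrightarrow> f \<circ> g \<in> H" "\<And>f. f \<in> H \<Longrightarrow> \<exists>g\<in>H. g \<circ> f = id"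
  shows "subgroup H (Aut smul ip)"
proof -
  interpret group "Aut smul ip" by (rule group_Aut)
  show ?thesis
  proof (rule subgroupI)
    fix f assume f: "f \<in> H"
    obtain g where g: "g \<in> H" "g \<circ> f = id" using assms(4)[OF f] by blast
    then have "g \<otimes>\<^bsub>Aut smul ip\<^esub> f = \<one>\<^bsub>Aut smul ip\<^esub>" by (simp add: Aut_def)
    then have "inv\<^bsub>Aut smul ip\<^esub> f = g" using inv_equality assms(1) f g(1) by blast
    then show "inv\<^bsub>Aut smul ip\<^esub> f \<in> H" using g(1) by simp
  qed (use assms in \<open>auto simp: Aut_def\<close>)
qed

locale isometry_group = fd_hilbert_space smul ip
  for smul :: "'f::real_or_complex \<Rightarrow> 'v::ab_group_add \<Rightarrow> 'v" and ip +
  fixes G :: "('v \<Rightarrow> 'v) set"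
  assumes fin_sub: "finite_subgroup G (Aut smul ip)"
begin

lemma finite_G: "finite G" and subgroup_G: "subgroup G (Aut smul ip)"
  using fin_sub unfolding finite_subgroup_def by auto

lemma G_Aut: "g \<in> G \<Longrightarrow> g \<in> carrier (Aut smul ip)"
  using subgroup.subset[OF subgroup_G] by blast

lemmas G_add = Aut_add[OF G_Aut] and G_scale = Aut_scale[OF G_Aut] and G_ip = Aut_ip[OF G_Aut]

lemma group_Grp: "group (Grp G)"
  using subgroup.subgroup_is_group[OF subgroup_G group_Aut] by simp

lemma id_G: "id \<in> G"
  using monoid.one_closed[OF group.is_monoid[OF group_Grp]] by simp

lemma comp_G: "g \<in> G \<Longrightarrow> h \<in> G \<Longrightarrow> g \<circ> h \<in> G"
  using monoid.m_closed[OF group.is_monoid[OF group_Grp]] by simp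

definition ginv :: "('v \<Rightarrow> 'v) \<Rightarrow> 'v \<Rightarrow> 'v"
  where "ginv g = inv\<^bsub>Grp G\<^esub> g"

lemma ginv_G: "g \<in> G \<Longrightarrow> ginv g \<in> G"
  using group.inv_closed[OF group_Grp, of g] unfolding ginv_def by simp

lemma ginv_left [simp]: "g \<in> G \<Longrightarrow> ginv g (g x) = x"
  and ginv_right [simp]: "g \<in> G \<Longrightarrow> g (ginv g x) = x"
  using group.l_inv[OF group_Grp, of g] group.r_inv[OF group_Grp, of g] unfolding ginv_def
  by (auto simp: fun_eq_iff)

lemma ip_ginv: "g \<in> G \<Longrightarrow> ip (g x) y = ip x (ginv g y)"
  using G_ip[of g x "ginv g y"] by simp

lemma G_0: "g \<in> G \<Longrightarrow> g 0 = 0"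
  using G_scale[of g 0 0] by simp

lemma is_rep_natural: "is_rep (Grp G) (natural_rep smul)"
  by (rule is_repI) (auto simp: natural_rep_def vector_space_axioms subspace_UNIV G_add G_scale)

lemma natural_simps [simp]: "scl (natural_rep smul) = smul" "spc (natural_rep smul) = UNIV" "act (natural_rep smul) g = g"
  by (simp_all add: natural_rep_def)

lemma perp_invariant:
  assumes "\<And>g x. g \<in> G \<Longrightarrow> x \<in> U \<Longrightarrow> g x \<in> U" "g \<in> G" "x \<in> perp U"
  shows "g x \<in> perp U"
  using assms ginv_G by (auto simp: perp_def ip_ginv)

end

section \<open>Counting dimensions\<close>

context vector_space_pair begin

lemma subspace_common_kernel:
  assumes "vs1.subspace S" "\<And>i. i < (k::nat) \<Longrightarrow> Vector_Spaces.linear s1 s2 (f i)"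
  shows "vs1.subspace {x\<in>S. \<forall>i<k. f i x = 0}"
  using assms(1) linear_0[OF assms(2)] linear_add[OF assms(2)] linear_scale[OF assms(2)]
  by (auto simp: vs1.subspace_def)

text \<open>By rank-nullity, imposing one more equation \<open>f i x = 0\<close> costs at most \<open>dim T\<close> dimensions.\<close>

lemma dim_common_kernel_ge:
  assumes S: "vs1.subspace S" "fin_dim s1 S" and T: "vs2.subspace T" "fin_dim s2 T"
    and f: "\<And>i. i < k \<Longrightarrow> Vector_Spaces.linear s1 s2 (f i)" "\<And>i x. i < k \<Longrightarrow> x \<in> S \<Longrightarrow> f i x \<in> T"
  shows "vs1.dim S \<le> vs1.dim {x\<in>S. \<forall>i<k. f i x = 0} + k * vs2.dim T"
  using f
proof (induction k)
  case (Suc k)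
  let ?X = "{x\<in>S. \<forall>i<k. f i x = 0}"
  have X: "vs1.subspace ?X" by (rule subspace_common_kernel[OF S(1)]) (use Suc.prems in simp)
  have fX: "fin_dim s1 ?X" using vs1.fin_dim_subset[OF S(2)] by simp
  have l: "Vector_Spaces.linear s1 s2 (f k)" using Suc.prems by simp
  have "vs1.dim S \<le> vs1.dim ?X + k * vs2.dim T" by (rule Suc.IH) (use Suc.prems in auto)
  moreover have "vs1.dim ?X = vs1.dim {x\<in>?X. f k x = 0} + vs2.dim (f k ` ?X)"
    by (rule rank_nullity[OF l X fX])
  moreover have "{x\<in>?X. f k x = 0} = {x\<in>S. \<forall>i<Suc k. f i x = 0}" by (auto simp: less_Suc_eq)
  moreover have "vs2.dim (f k ` ?X) \<le> vs2.dim T"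
    by (rule vs2.dim_mono_fin[OF T(2) _ linear_subspace_image[OF l X] T(1)]) (use Suc.prems in auto)
  ultimately show ?case by simp
qed simp

text \<open>The hypothesis \<open>onto\<close> makes each equation cost exactly \<open>dim T\<close>, in whatever order they are imposed.\<close>

lemma dim_common_kernel_eq:
  assumes S: "vs1.subspace S" "fin_dim s1 S" and T: "vs2.subspace T" "fin_dim s2 T"
    and f: "\<And>i. i < k \<Longrightarrow> Vector_Spaces.linear s1 s2 (f i)" "\<And>i x. i < k \<Longrightarrow> x \<in> S \<Longrightarrow> f i x \<in> T"
    and onto: "\<And>j. j < k \<Longrightarrow> T \<subseteq> f j ` {x\<in>S. \<forall>i<k. i \<noteq> j \<longrightarrow> f i x = 0}"
  shows "vs1.dim S = vs1.dim {x\<in>S. \<forall>i<k. f i x = 0} + k * vs2.dim T"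
  using f onto
proof (induction k)
  case (Suc k)
  let ?X = "{x\<in>S. \<forall>i<k. f i x = 0}"
  have X: "vs1.subspace ?X" by (rule subspace_common_kernel[OF S(1)]) (use Suc.prems in simp)
  have fX: "fin_dim s1 ?X" using vs1.fin_dim_subset[OF S(2)] by simp
  have l: "Vector_Spaces.linear s1 s2 (f k)" using Suc.prems by simp
  have "vs1.dim S = vs1.dim ?X + k * vs2.dim T"
  proof (rule Suc.IH)
    fix j assume "j < k"
    then have "T \<subseteq> f j ` {x\<in>S. \<forall>i<Suc k. i \<noteq> j \<longrightarrow> f i x = 0}" by (intro Suc.prems(3)) simp
    also have "\<dots> \<subseteq> f j ` {x\<in>S. \<forall>i<k. i \<noteq> j \<longrightarrow> f i x = 0}" by (intro image_mono) auto
    finally show "T \<subseteq> f j ` {x\<in>S. \<forall>i<k. i \<noteq> j \<longrightarrow> f i x = 0}" .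
  qed (use Suc.prems in auto)
  moreover have "vs1.dim ?X = vs1.dim {x\<in>?X. f k x = 0} + vs2.dim (f k ` ?X)"
    by (rule rank_nullity[OF l X fX])
  moreover have "{x\<in>?X. f k x = 0} = {x\<in>S. \<forall>i<Suc k. f i x = 0}" by (auto simp: less_Suc_eq)
  moreover have "f k ` ?X = T"
  proof
    show "f k ` ?X \<subseteq> T" using Suc.prems(2) by auto
    have "T \<subseteq> f k ` {x\<in>S. \<forall>i<Suc k. i \<noteq> k \<longrightarrow> f i x = 0}" by (rule Suc.prems(3)) simp
    also have "\<dots> \<subseteq> f k ` ?X" by (intro image_mono) auto
    finally show "T \<subseteq> f k ` ?X" .
  qed
  ultimately show ?case by simp
qed simp

end

section \<open>The trivial representation\<close>

lemma trivial_simps [simp]: "scl (trivial_rep :: ('f::field, 'f, 'g) rep) = (*)"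
  "spc (trivial_rep :: ('f::field, 'f, 'g) rep) = UNIV" "act (trivial_rep :: ('f::field, 'f, 'g) rep) g x = x"
  by (simp_all add: trivial_rep_def)

lemma irreducible_trivial: "irreducible_rep G (trivial_rep :: ('f::field, 'f, 'g) rep)"
  unfolding irreducible_rep_def
proof (intro conjI allI impI)
  show "is_rep G (trivial_rep :: ('f, 'f, 'g) rep)" by (rule is_rep_trivial)
  show "spc (trivial_rep :: ('f, 'f, 'g) rep) \<noteq> {0}" by (simp, metis UNIV_I singletonD zero_neq_one)
  fix U assume U: "subrep G U (trivial_rep :: ('f, 'f, 'g) rep)"
  have m: "module ((*) :: 'f \<Rightarrow> 'f \<Rightarrow> 'f)"
    using is_repD(1)[OF is_rep_trivial[where 'f='f]] by (simp add: module_iff_vector_space)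
  have sub: "module.subspace (*) U" using U unfolding subrep_iff[OF is_rep_trivial] by simp
  have "c \<in> U" if "u \<in> U" "u \<noteq> 0" for c u
    using module.subspace_scale[OF m sub that(1), of "c / u"] that(2) by simp
  moreover have "0 \<in> U" using module.subspace_0[OF m sub] .
  ultimately show "U = {0} \<or> U = spc (trivial_rep :: ('f, 'f, 'g) rep)" by auto
qed

lemma dim_trivial: "vector_space.dim ((*) :: 'f::field \<Rightarrow> 'f \<Rightarrow> 'f) UNIV = 1"
proof -
  have v: "vector_space ((*) :: 'f \<Rightarrow> 'f \<Rightarrow> 'f)"
    using is_repD(1)[OF is_rep_trivial[where 'f='f]] by simp
  then have m: "module ((*) :: 'f \<Rightarrow> 'f \<Rightarrow> 'f)" by (simp add: module_iff_vector_space)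
  have "x \<in> module.span (*) {1}" for x :: 'f
    using module.span_scale[OF m module.span_base[OF m], of 1 "{1}" x] by simp
  then show ?thesis
    by (intro vector_space.dim_unique[OF v, of "{1}"]) (auto simp: vector_space.dependent_single[OF v])
qed

lemma rep_hom_from_trivial:
  assumes p: "is_rep G \<pi>" and x: "x \<in> spc \<pi>" "\<And>g. g \<in> carrier G \<Longrightarrow> act \<pi> g x = x"
  shows "rep_hom G trivial_rep \<pi> (\<lambda>c. scl \<pi> c x)"
proof -
  interpret vector_space "scl \<pi>" using is_repD(1) p .
  show ?thesis
    by (rule rep_homI) (use x is_repD(5)[OF p] subspace_scale[OF is_repD(2)[OF p] x(1)] in \<open>auto simp: scale_left_distrib\<close>)
qed

text \<open>A homomorphism out of the trivial representation amounts to a fixed vector, the image of \<open>1\<close>.\<close>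

lemma isotypic_trivial:
  assumes p: "is_rep G \<pi>"
  shows "isotypic G trivial_rep \<pi> = {x\<in>spc \<pi>. \<forall>g\<in>carrier G. act \<pi> g x = x}"
proof -
  interpret vector_space "scl \<pi>" using is_repD(1) p .
  let ?F = "{x\<in>spc \<pi>. \<forall>g\<in>carrier G. act \<pi> g x = x}"
  have sp: "subspace (spc \<pi>)" using is_repD(2) p .
  have "act \<pi> g 0 = 0" if "g \<in> carrier G" for g
    using is_repD(5)[OF p that, of 0 0] subspace_0[OF sp] by simp
  then have "subspace ?F"
    using subspace_0[OF sp] subspace_add[OF sp] subspace_scale[OF sp] is_repD(4,5)[OF p]
    by (auto simp: subspace_def)
  moreover have "{T x | T x. rep_hom G trivial_rep \<pi> T \<and> x \<in> spc trivial_rep} \<subseteq> ?F"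
    using rep_homD(1,4) by fastforce
  ultimately have "isotypic G trivial_rep \<pi> \<subseteq> ?F" unfolding isotypic_def by (intro span_minimal)
  moreover have "x \<in> isotypic G trivial_rep \<pi>" if "x \<in> ?F" for x
    using isotypic_hom[OF p rep_hom_from_trivial[OF p, of x], of 1] that by simp
  ultimately show ?thesis by blast
qed

lemma isotypic_into_trivial:
  fixes \<sigma> :: "('f::field, 'w::ab_group_add, 'g) rep"
  assumes "irreducible_rep G \<sigma>" "\<not> rep_iso G \<sigma> (trivial_rep :: ('f, 'f, 'g) rep)"
  shows "isotypic G \<sigma> (trivial_rep :: ('f, 'f, 'g) rep) = {0}"
proof -
  have v: "vector_space ((*) :: 'f \<Rightarrow> 'f \<Rightarrow> 'f)"
    using is_repD(1)[OF is_rep_trivial[where 'f='f]] by simp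
  then have m: "module ((*) :: 'f \<Rightarrow> 'f \<Rightarrow> 'f)" by (simp add: module_iff_vector_space)
  have "T x = 0" if T: "rep_hom G \<sigma> (trivial_rep :: ('f, 'f, 'g) rep) T" and x: "x \<in> spc \<sigma>" for T x
    using schur[OF assms(1) irreducible_trivial T x] assms(2) T unfolding rep_iso_iff by blast
  then have "{T x | T x. rep_hom G \<sigma> (trivial_rep :: ('f, 'f, 'g) rep) T \<and> x \<in> spc \<sigma>} \<subseteq> {0}" by blast
  then have "isotypic G \<sigma> (trivial_rep :: ('f, 'f, 'g) rep) \<subseteq> {0}"
    unfolding isotypic_def using module.span_minimal[OF m _ module.subspace_single_0[OF m]] by simp
  moreover have "0 \<in> isotypic G \<sigma> (trivial_rep :: ('f, 'f, 'g) rep)"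
    unfolding isotypic_def using module.span_zero[OF m] by simp
  ultimately show ?thesis by blast
qed

text \<open>The fixed vectors are the functions that are constant on \<open>G\<close>.\<close>

lemma dim_fixed_regular:
  assumes "group G" "finite (carrier G)"
  shows "vector_space.dim fun_scale (isotypic G trivial_rep (regular_rep G :: ('f::field, 'g \<Rightarrow> 'f, 'g) rep)) = 1"
proof -
  interpret group G by fact
  interpret n: vector_space "fun_scale :: 'f \<Rightarrow> ('g \<Rightarrow> 'f) \<Rightarrow> 'g \<Rightarrow> 'f" by (rule vector_space_fun_scale)
  let ?e = "\<lambda>x. if x \<in> carrier G then 1 else 0 :: 'f"
  let ?F = "isotypic G trivial_rep (regular_rep G :: ('f, 'g \<Rightarrow> 'f, 'g) rep)"
  have F: "?F = {a. (\<forall>x. x \<notin> carrier G \<longrightarrow> a x = 0) \<and>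
      (\<forall>g\<in>carrier G. (\<lambda>x. if x \<in> carrier G then a (inv\<^bsub>G\<^esub> g \<otimes>\<^bsub>G\<^esub> x) else 0) = a)}"
    unfolding isotypic_trivial[OF is_rep_regular[OF assms(1)]] by (simp add: regular_rep_def)
  have "?e \<in> ?F" unfolding F by auto
  moreover have "a \<in> n.span {?e}" if a: "a \<in> ?F" for a
  proof -
    have "a x = a \<one>\<^bsub>G\<^esub> * ?e x" for x
    proof (cases "x \<in> carrier G")
      case True
      then have "(\<lambda>y. if y \<in> carrier G then a (inv\<^bsub>G\<^esub> x \<otimes>\<^bsub>G\<^esub> y) else 0) = a" using a unfolding F by blast
      from fun_cong[OF this, of x] True show ?thesis by simp
    qed (use a F in auto)
    then have "a = fun_scale (a \<one>\<^bsub>G\<^esub>) ?e" unfolding fun_scale_def by (intro ext)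
    then show ?thesis using n.span_scale[OF n.span_base[of ?e "{?e}"], of "a \<one>\<^bsub>G\<^esub>"] by simp
  qed
  moreover have "?e \<noteq> 0" using one_closed by (auto simp: fun_eq_iff)
  ultimately show ?thesis by (intro n.dim_unique[of "{?e}"]) (auto simp: n.dependent_single)
qed

section \<open>The inequality in terms of isotypic components\<close>

text \<open>The case \<open>m = 0\<close> fits in: the quotient is then \<open>\<infinity>\<close> if \<open>n > 0\<close>, and \<open>0\<close> if \<open>n = 0\<close>.\<close>

lemma quotient_le_iff:
  "(ereal (real n) - x * of_bool False) / ereal (real m) \<le> ereal (real k) \<longleftrightarrow> n \<le> k * m"
proof (cases "m = 0")
  case True
  then show ?thesis by (cases "n = 0") (auto simp: divide_ereal_def)
next
  case False
  have "(ereal (real n) - x * of_bool False) / ereal (real m) = ereal (real n / real m)" using False by simp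
  moreover have "real n / real m \<le> real k \<longleftrightarrow> real n \<le> real (k * m)" using False by (simp add: divide_le_eq)
  ultimately show ?thesis by (simp only: ereal_less_eq(3) of_nat_le_iff)
qed

text \<open>Adding \<open>1\<close> on the left instead of subtracting it on the right avoids truncation. If \<open>r = \<infinity>\<close>, the quotient is \<open>-\<infinity>\<close>.\<close>

lemma quotient_trivial_le_iff:
  "(ereal (real n) - (ereal_of_enat r - 1) * of_bool True) / ereal (real 1) \<le> ereal (real k) \<longleftrightarrow>
    enat n + 1 \<le> enat k + r"
proof (cases r)
  case (enat q)
  have "(ereal (real n) - (ereal_of_enat r - 1) * of_bool True) / ereal (real 1) = ereal (real n - (real q - 1))"
    using enat by (simp add: one_ereal_def)
  moreover have "enat n + 1 \<le> enat k + r \<longleftrightarrow> n + 1 \<le> k + q" using enat by (simp add: one_enat_def)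
  ultimately show ?thesis by auto
qed (simp add: one_ereal_def)

context isometry_group begin

definition fixed :: "'v set"
  where "fixed = {x. \<forall>g\<in>G. g x = x}"

lemma subspace_fixed: "subspace fixed"
  by (rule subspaceI) (auto simp: fixed_def G_0 G_add G_scale)

lemma fixed_eq_isotypic: "fixed = isotypic (Grp G) trivial_rep (natural_rep smul)"
  unfolding isotypic_trivial[OF is_rep_natural] by (simp add: fixed_def)

abbreviation regular :: "('f, ('v \<Rightarrow> 'v) \<Rightarrow> 'f, 'v \<Rightarrow> 'v) rep"
  where "regular \<equiv> regular_rep (Grp G)"

lemma is_rep_reg: "is_rep (Grp G) regular"
  by (rule is_rep_regular[OF group_Grp])

lemma regular_simps: "scl regular = fun_scale" "spc regular = {a. \<forall>x. x \<notin> G \<longrightarrow> a x = 0}"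
  "act regular g a = (\<lambda>x. if x \<in> G then a (ginv g \<circ> x) else 0)"
  by (simp_all add: regular_rep_def ginv_def cong: if_cong)

lemma fin_dim_reg: "fin_dim fun_scale (spc regular)"
  using fin_dim_regular[of "Grp G"] finite_G by simp

text \<open>Multiplying the inequality for \<open>\<pi>\<close> by \<open>dim \<pi>\<close> turns multiplicities into dimensions of isotypic components. The trivial
  representation is one-dimensional and occurs once in the regular one.\<close>

lemma star_condition_iff:
  "star_condition smul ip G k \<longleftrightarrow> (\<forall>\<pi>\<in>(irreps (Grp G) :: ('f, nat \<Rightarrow> 'f, 'v \<Rightarrow> 'v) rep set).
    if rep_iso (Grp G) \<pi> (trivial_rep :: ('f, 'f, 'v \<Rightarrow> 'v) rep)
    then enat (dim fixed) + 1 \<le> enat k + min_nontrivial_dim TYPE('f) (Grp G)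
    else dim (isotypic (Grp G) \<pi> (natural_rep smul))
      \<le> k * vector_space.dim fun_scale (isotypic (Grp G) \<pi> regular))"
proof -
  let ?r = "min_nontrivial_dim TYPE('f) (Grp G)"
  have fin: "finite (carrier (Grp G))" using finite_G by simp
  have fdV: "fin_dim (scl (natural_rep smul)) (spc (natural_rep smul))" by (simp add: fin_dim_any)
  have fdR: "fin_dim (scl regular) (spc regular)" using fin_dim_reg by (simp add: regular_simps(1))
  have "(ereal (real (multiplicity_rep (Grp G) \<pi> (natural_rep smul))) - (ereal_of_enat ?r - 1) *
          of_bool (rep_iso (Grp G) \<pi> (trivial_rep :: ('f, 'f, 'v \<Rightarrow> 'v) rep)))
        / ereal (real (multiplicity_rep (Grp G) \<pi> regular)) \<le> ereal (real k) \<longleftrightarrow>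
      (if rep_iso (Grp G) \<pi> (trivial_rep :: ('f, 'f, 'v \<Rightarrow> 'v) rep) then enat (dim fixed) + 1 \<le> enat k + ?r
       else dim (isotypic (Grp G) \<pi> (natural_rep smul))
         \<le> k * vector_space.dim fun_scale (isotypic (Grp G) \<pi> regular))"
    if pi: "\<pi> \<in> irreps (Grp G)" for \<pi> :: "('f, nat \<Rightarrow> 'f, 'v \<Rightarrow> 'v) rep"
  proof -
    have irr: "irreducible_rep (Grp G) \<pi>" using pi unfolding irreps_def by blast
    then have rp: "is_rep (Grp G) \<pi>" unfolding irreducible_rep_def by blast
    let ?d = "vector_space.dim (scl \<pi>) (spc \<pi>)"
    note d = irreducible_cyclic(2)[OF group_Grp fin irr]
    have V: "multiplicity_rep (Grp G) \<pi> (natural_rep smul) * ?d = dim (isotypic (Grp G) \<pi> (natural_rep smul))"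
      using multiplicity_times_dim[OF group_Grp fin is_rep_natural fdV irr] by simp
    have R: "multiplicity_rep (Grp G) \<pi> regular * ?d = vector_space.dim fun_scale (isotypic (Grp G) \<pi> regular)"
      using multiplicity_times_dim[OF group_Grp fin is_rep_reg fdR irr] by (simp add: regular_simps(1))
    show ?thesis
    proof (cases "rep_iso (Grp G) \<pi> (trivial_rep :: ('f, 'f, 'v \<Rightarrow> 'v) rep)")
      case True
      have "?d = 1" using rep_iso_dim(1)[OF rp is_rep_trivial True] dim_trivial by simp
      moreover have "isotypic (Grp G) \<pi> (natural_rep smul) = fixed"
        using isotypic_iso[OF is_rep_natural rp True] fixed_eq_isotypic by simp
      moreover have "vector_space.dim fun_scale (isotypic (Grp G) \<pi> regular) = 1"
        using isotypic_iso[OF is_rep_reg rp True] dim_fixed_regular[OF group_Grp fin] by simp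
      ultimately have "multiplicity_rep (Grp G) \<pi> (natural_rep smul) = dim fixed"
        "multiplicity_rep (Grp G) \<pi> regular = 1" using V R by simp_all
      then show ?thesis using True quotient_trivial_le_iff[of "dim fixed" ?r k] by simp
    next
      case False
      let ?n = "multiplicity_rep (Grp G) \<pi> (natural_rep smul)" and ?m = "multiplicity_rep (Grp G) \<pi> regular"
      have "?n \<le> k * ?m \<longleftrightarrow> ?n * ?d \<le> (k * ?m) * ?d" using d by simp
      also have "\<dots> \<longleftrightarrow> ?n * ?d \<le> k * (?m * ?d)" by (simp only: mult.assoc)
      finally show ?thesis using False quotient_le_iff[of ?n "ereal_of_enat ?r - 1" ?m k] V R by simp
    qed
  qed
  then show ?thesis unfolding star_condition_def orbit_bound_def SUP_le_iff by (intro ball_cong) auto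
qed

section \<open>The span of some orbits and its orthogonal complement\<close>

text \<open>For fixed \<open>w\<close> this is a homomorphism to the regular representation; its kernel consists of the vectors orthogonal to
  the orbit of \<open>w\<close>.\<close>

definition coeffs :: "'v \<Rightarrow> 'v \<Rightarrow> ('v \<Rightarrow> 'v) \<Rightarrow> 'f"
  where "coeffs w x = (\<lambda>h. if h \<in> G then ip x (h w) else 0)"

lemma coeffs_hom: "rep_hom (Grp G) (natural_rep smul) regular (coeffs w)"
  by (rule rep_homI)
    (auto simp: regular_simps coeffs_def fun_eq_iff ip_add_left fun_scale_def ip_scale_left ip_ginv comp_G ginv_G)

lemma coeffs_linear: "Vector_Spaces.linear smul fun_scale (coeffs w)"
  unfolding Vector_Spaces.linear_iff using vector_space_axioms vector_space_fun_scale
  by (auto simp: coeffs_def fun_eq_iff ip_add_left fun_scale_def ip_scale_left)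

lemma coeffs_eq_0_iff: "coeffs w x = 0 \<longleftrightarrow> (\<forall>h\<in>G. ip x (h w) = 0)"
  by (auto simp: coeffs_def fun_eq_iff)

definition orbit_span :: "nat \<Rightarrow> (nat \<Rightarrow> 'v) \<Rightarrow> 'v set"
  where "orbit_span k v = span {h (v i) | h i. h \<in> G \<and> i < k}"

lemma orbit_span_base: "h \<in> G \<Longrightarrow> i < k \<Longrightarrow> h (v i) \<in> orbit_span k v"
  unfolding orbit_span_def by (rule span_base) blast

lemma orbit_span_base': "i < k \<Longrightarrow> v i \<in> orbit_span k v"
  using orbit_span_base[OF id_G] by simp

lemma subspace_orbit_span: "subspace (orbit_span k v)"
  unfolding orbit_span_def by simp

lemma perp_orbit_span: "x \<in> perp (orbit_span k v) \<longleftrightarrow> (\<forall>i<k. \<forall>h\<in>G. ip x (h (v i)) = 0)"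
  unfolding orbit_span_def perp_span by (auto simp: perp_def)

lemma perp_orbit_span_coeffs: "x \<in> perp (orbit_span k v) \<longleftrightarrow> (\<forall>i<k. coeffs (v i) x = 0)"
  unfolding perp_orbit_span coeffs_eq_0_iff ..

lemma perp_orbit_span_invariant: "g \<in> G \<Longrightarrow> x \<in> perp (orbit_span k v) \<Longrightarrow> g x \<in> perp (orbit_span k v)"
  unfolding perp_orbit_span using ip_ginv comp_G[OF ginv_G] by (metis comp_apply)

lemma orbit_span_invariant:
  assumes "g \<in> G" "x \<in> orbit_span k v"
  shows "g x \<in> orbit_span k v"
proof -
  have "subspace {x. g x \<in> orbit_span k v}"
    using subspace_orbit_span[of k v] assms(1)
    by (auto simp: subspace_def G_add G_scale G_0)
  moreover have "{h (v i) | h i. h \<in> G \<and> i < k} \<subseteq> {x. g x \<in> orbit_span k v}"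
    using orbit_span_base[OF comp_G[OF assms(1)]] by fastforce
  ultimately have "orbit_span k v \<subseteq> {x. g x \<in> orbit_span k v}"
    unfolding orbit_span_def[of k v] by (intro span_minimal) (simp_all add: orbit_span_def)
  with assms(2) show ?thesis by blast
qed

end

section \<open>Changing a group off the span of some orbits\<close>

context isometry_group begin

text \<open>Averaging makes the inner product on \<open>U\<close> invariant under \<open>\<sigma>\<close>. The averaged form is extended by the original one
  on \<open>perp U\<close>, so that it is again an inner product on the whole space and has orthonormal bases. A linear map that carries
  an orthonormal basis of \<open>U\<close> for the new form to one for the old form conjugates \<open>\<sigma>\<close> into isometries.\<close>

lemma unitarize:
  assumes s: "is_rep (Grp G) \<sigma>" and scl: "scl \<sigma> = smul" and spc: "spc \<sigma> = U"
  obtains \<tau> where "\<And>g x. g \<in> G \<Longrightarrow> x \<in> U \<Longrightarrow> \<tau> g x \<in> U"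
    "\<And>g x y. g \<in> G \<Longrightarrow> x \<in> U \<Longrightarrow> y \<in> U \<Longrightarrow> \<tau> g (x + y) = \<tau> g x + \<tau> g y"
    "\<And>g c x. g \<in> G \<Longrightarrow> x \<in> U \<Longrightarrow> \<tau> g (smul c x) = smul c (\<tau> g x)"
    "\<And>g x y. g \<in> G \<Longrightarrow> x \<in> U \<Longrightarrow> y \<in> U \<Longrightarrow> ip (\<tau> g x) (\<tau> g y) = ip x y"
    "\<And>x. x \<in> U \<Longrightarrow> \<tau> id x = x"
    "\<And>g h x. g \<in> G \<Longrightarrow> h \<in> G \<Longrightarrow> x \<in> U \<Longrightarrow> \<tau> (g \<circ> h) x = \<tau> g (\<tau> h x)"
    "\<And>g x. g \<in> G \<Longrightarrow> x \<in> U \<Longrightarrow> act \<sigma> g x \<noteq> x \<Longrightarrow> \<exists>y\<in>U. \<tau> g y \<noteq> y"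
proof -
  note sD = is_repD[OF s, unfolded scl spc Grp_simps]
  have U: "subspace U" by (rule sD(2))
  define P where "P = proj U"
  note P = proj_props[OF U, folded P_def]
  note Padd = P(6) and Pscale = P(7)
  let ?a = "act \<sigma>"
  define ip' where "ip' = (\<lambda>x y. (\<Sum>g\<in>G. ip (?a g (P x)) (?a g (P y))) + ip (x - P x) (y - P y))"
  have H': "fd_hilbert_space smul ip'"
  proof (unfold_locales)
    fix x y z c
    show "ip' (x + y) z = ip' x z + ip' y z"
      by (simp add: ip'_def Padd P(2) sD(4) ip_add_left sum.distrib add_diff_add)
    show "ip' (smul c x) y = c * ip' x y"
      by (simp add: ip'_def Pscale P(2) sD(5) ip_scale_left sum_distrib_left distrib_left
          flip: scale_right_diff_distrib)
    show "ip' y x = cj (ip' x y)"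
      unfolding ip'_def cj_add cj_sum by (intro arg_cong2[where f="(+)"] sum.cong refl ip_commute)
  next
    fix x :: 'v assume x: "x \<noteq> 0"
    let ?t = "(\<Sum>g\<in>G. (hnorm ip (?a g (P x)))\<^sup>2) + (hnorm ip (x - P x))\<^sup>2"
    have "?t > 0"
    proof (cases "P x = 0")
      case True
      then have "(hnorm ip (x - P x))\<^sup>2 > 0" using x by simp
      then show ?thesis by (intro add_nonneg_pos sum_nonneg) auto
    next
      case False
      then have "(hnorm ip (?a id (P x)))\<^sup>2 > 0" using sD(6) P(2) by simp
      then have "(\<Sum>g\<in>G. (hnorm ip (?a g (P x)))\<^sup>2) > 0"
        using finite_G id_G by (intro sum_pos2[of _ id]) auto
      then show ?thesis by (intro add_pos_nonneg) auto
    qed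
    moreover have "ip' x x = of_real ?t" unfolding ip'_def ip_self by simp
    ultimately show "\<exists>t>0. ip' x x = of_real t" by blast
  next
    show "\<exists>B. finite B \<and> span B = UNIV" by (rule finite_dim)
  qed
  interpret I: fd_hilbert_space smul ip' by (rule H')
  interpret vector_space_pair smul smul ..
  obtain B where B: "finite B" "orthonormal B" "B \<subseteq> U" "span B = U" "card B = dim U"
    by (rule exists_orthonormal_basis[OF U])
  obtain C where C: "finite C" "I.orthonormal C" "C \<subseteq> U" "span C = U" "card C = dim U"
    by (rule I.exists_orthonormal_basis[OF U])
  have "\<exists>f. Vector_Spaces.linear smul smul f \<and> f ` C = B \<and> f ` U = U \<and> inj_on f U"
    by (rule finite_basis_to_basis_subspace_isomorphism[OF U U refl])
      (use B C I.orthonormal_independent[OF C(1,2)] orthonormal_independent[OF B(1,2)] in auto)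
  then obtain S where S: "Vector_Spaces.linear smul smul S" "S ` C = B" "S ` U = U" "inj_on S U" by blast
  note Sadd = linear_add[OF S(1)] and Sscale = linear_scale[OF S(1)] and Ssum = linear_sum[OF S(1)]
  have Sip: "ip (S x) (S y) = ip' x y" if x: "x \<in> U" and y: "y \<in> U" for x y
  proof -
    have bb: "ip (S b) (S c) = ip' b c" if "b \<in> C" "c \<in> C" for b c
    proof -
      have "S b = S c \<longleftrightarrow> b = c" using that C(3) S(4) unfolding inj_on_def by blast
      moreover have "S b \<in> B" "S c \<in> B" using that S(2) by blast+
      ultimately show ?thesis using that B(2) C(2) unfolding orthonormal_def I.orthonormal_def by simp
    qed
    have bS: "ip (S b) (S y) = ip' b y" if b: "b \<in> C" for b
    proof -
      have e: "y = (\<Sum>c\<in>C. smul (ip' y c) c)" using I.orthonormal_expand[OF C(1,2)] y C(4) by simp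
      have "ip (S b) (S (\<Sum>c\<in>C. smul (ip' y c) c)) = ip' b (\<Sum>c\<in>C. smul (ip' y c) c)"
        unfolding Ssum Sscale ip_sum_right I.ip_sum_right ip_scale_right I.ip_scale_right
        by (rule sum.cong) (use bb b in auto)
      then show ?thesis using e by simp
    qed
    have e: "x = (\<Sum>c\<in>C. smul (ip' x c) c)" using I.orthonormal_expand[OF C(1,2)] x C(4) by simp
    have "ip (S (\<Sum>c\<in>C. smul (ip' x c) c)) (S y) = ip' (\<Sum>c\<in>C. smul (ip' x c) c) y"
      unfolding Ssum Sscale ip_sum_left I.ip_sum_left ip_scale_left I.ip_scale_left
      by (rule sum.cong) (use bS in auto)
    then show ?thesis using e by simp
  qed
  have inv': "ip' (?a g x) (?a g y) = ip' x y" if g: "g \<in> G" and x: "x \<in> U" and y: "y \<in> U" for g x y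
  proof -
    have m: "?a g x \<in> U" "?a g y \<in> U" using sD(3)[OF g] x y by blast+
    have "ip' (?a g x) (?a g y) = (\<Sum>h\<in>G. ip (?a h (?a g x)) (?a h (?a g y)))"
      unfolding ip'_def using m by (simp add: P(3))
    also have "\<dots> = (\<Sum>h\<in>G. ip (?a (h \<circ> g) x) (?a (h \<circ> g) y))"
      by (rule sum.cong) (use sD(7) g x y in auto)
    also have "\<dots> = (\<Sum>h\<in>G. ip (?a h x) (?a h y))"
      by (rule sum.reindex_bij_witness[of _ "\<lambda>h. h \<circ> ginv g" "\<lambda>h. h \<circ> g"])
        (use g in \<open>auto simp: comp_G ginv_G fun_eq_iff\<close>)
    also have "\<dots> = ip' x y" unfolding ip'_def using x y by (simp add: P(3))
    finally show ?thesis .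
  qed
  define R where "R = inv_into U S"
  have R: "R x \<in> U" "S (R x) = x" if "x \<in> U" for x
    using that S(3) inv_into_into[of x S U] f_inv_into_f[of x S U] unfolding R_def by simp_all
  have RS: "R (S x) = x" if "x \<in> U" for x using inv_into_f_f[OF S(4) that] unfolding R_def .
  have SU: "S x \<in> U" if "x \<in> U" for x using S(3) that by blast
  have Radd: "R (x + y) = R x + R y" if "x \<in> U" "y \<in> U" for x y
    using RS[of "R x + R y"] Sadd[of "R x" "R y"] R that subspace_add[OF U] by simp
  have Rscale: "R (smul c x) = smul c (R x)" if "x \<in> U" for c x
    using RS[of "smul c (R x)"] Sscale[of c "R x"] R that subspace_scale[OF U] by simp
  have Rip: "ip' (R x) (R y) = ip x y" if "x \<in> U" "y \<in> U" for x y
    using Sip[of "R x" "R y"] R that by simp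
  show thesis
  proof (rule that[of "\<lambda>g x. S (?a g (R x))"])
    fix g x y assume g: "g \<in> G" and x: "x \<in> U" and y: "y \<in> U"
    show "S (?a g (R (x + y))) = S (?a g (R x)) + S (?a g (R y))"
      using x y g R by (simp add: Radd sD(4) Sadd)
    show "ip (S (?a g (R x))) (S (?a g (R y))) = ip x y"
      using Sip[OF sD(3)[OF g R(1)[OF x]] sD(3)[OF g R(1)[OF y]]] inv'[OF g R(1)[OF x] R(1)[OF y]] Rip[OF x y]
      by simp
  next
    fix g c x assume g: "g \<in> G" and x: "x \<in> U"
    show "S (?a g (R x)) \<in> U" using SU sD(3) R x g by blast
    show "S (?a g (R (smul c x))) = smul c (S (?a g (R x)))"
      using x g R by (simp add: Rscale sD(5) Sscale)
  next
    fix x assume "x \<in> U"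
    then show "S (?a id (R x)) = x" using R sD(6) by simp
  next
    fix g h x assume "g \<in> G" "h \<in> G" "x \<in> U"
    then show "S (?a (g \<circ> h) (R x)) = S (?a g (R (S (?a h (R x)))))"
      using R sD(3,7) RS by simp
  next
    fix g x assume g: "g \<in> G" and x: "x \<in> U" "?a g x \<noteq> x"
    have "S (?a g (R (S x))) \<noteq> S x"
      using RS[OF x(1)] sD(3)[OF g x(1)] x S(4) unfolding inj_on_def by metis
    then show "\<exists>y\<in>U. S (?a g (R y)) \<noteq> y" using SU[OF x(1)] by blast
  qed
qed

text \<open>Isometries that act like \<open>g\<close> on \<open>perp U\<close> and like \<open>\<tau> g\<close> on \<open>U\<close> compose blockwise, so they form a group.\<close>

lemma twisted_group:
  assumes U: "subspace U" and GU: "\<And>g x. g \<in> G \<Longrightarrow> x \<in> U \<Longrightarrow> g x \<in> U"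
    and t_in: "\<And>g x. g \<in> G \<Longrightarrow> x \<in> U \<Longrightarrow> \<tau> g x \<in> U"
    and t_add: "\<And>g x y. g \<in> G \<Longrightarrow> x \<in> U \<Longrightarrow> y \<in> U \<Longrightarrow> \<tau> g (x + y) = \<tau> g x + \<tau> g y"
    and t_scale: "\<And>g c x. g \<in> G \<Longrightarrow> x \<in> U \<Longrightarrow> \<tau> g (smul c x) = smul c (\<tau> g x)"
    and t_ip: "\<And>g x y. g \<in> G \<Longrightarrow> x \<in> U \<Longrightarrow> y \<in> U \<Longrightarrow> ip (\<tau> g x) (\<tau> g y) = ip x y"
    and t_id: "\<And>x. x \<in> U \<Longrightarrow> \<tau> id x = x"
    and t_comp: "\<And>g h x. g \<in> G \<Longrightarrow> h \<in> G \<Longrightarrow> x \<in> U \<Longrightarrow> \<tau> (g \<circ> h) x = \<tau> g (\<tau> h x)"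
  obtains H where "subgroup H (Aut smul ip)" "\<And>x. x \<in> perp U \<Longrightarrow> orbit H x = orbit G x"
    "\<And>x. x \<in> U \<Longrightarrow> orbit H x = {\<tau> g x | g. g \<in> G}"
proof -
  define P where "P = proj U"
  note P = proj_props[OF U, folded P_def]
  note Padd = P(6) and Pscale = P(7)
  have Gperp: "g x \<in> perp U" if "g \<in> G" "x \<in> perp U" for g x
    using perp_invariant[of U g x] GU that by blast
  define F where "F = (\<lambda>g x. g (x - P x) + \<tau> g (P x))"
  have F_eq: "F g x = g (x - P x) + \<tau> g (P x)" for g x by (simp add: F_def)
  have PF: "P (F g x) = \<tau> g (P x)" if g: "g \<in> G" for g x
    unfolding F_def Padd using P(5)[OF Gperp[OF g P(4)]] P(3)[OF t_in[OF g P(2)]] by simp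
  have F_comp: "F g (F h x) = F (g \<circ> h) x" if g: "g \<in> G" and h: "h \<in> G" for g h x
  proof -
    have "F h x - P (F h x) = h (x - P x)" unfolding PF[OF h] by (simp add: F_def)
    then show ?thesis unfolding F_eq[of g] PF[OF h] using t_comp[OF g h P(2)] by (simp add: F_def)
  qed
  have F_id: "F id = id" unfolding F_def using t_id[OF P(2)] by (simp add: fun_eq_iff)
  have ip_split: "ip (a + u) (b + w) = ip a b + ip u w"
    if "a \<in> perp U" "b \<in> perp U" "u \<in> U" "w \<in> U" for a b u w
  proof -
    have "ip a w = 0" "ip b u = 0" using that unfolding perp_def by blast+
    moreover from this have "ip u b = 0" using ip_eq_0_commute by blast
    ultimately show ?thesis by (simp add: ip_add_left ip_add_right)
  qed
  have F_ip: "ip (F g x) (F g y) = ip x y" if g: "g \<in> G" for g x y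
  proof -
    have "ip (F g x) (F g y) = ip (x - P x) (y - P y) + ip (P x) (P y)"
      unfolding F_def using ip_split[OF Gperp[OF g P(4)] Gperp[OF g P(4)] t_in[OF g P(2)] t_in[OF g P(2)]]
        G_ip[OF g] t_ip[OF g P(2) P(2)] by simp
    also have "\<dots> = ip (x - P x + P x) (y - P y + P y)"
      by (rule ip_split[OF P(4) P(4) P(2) P(2), symmetric])
    finally show ?thesis by simp
  qed
  have F_add: "F g (x + y) = F g x + F g y" if g: "g \<in> G" for g x y
    unfolding F_def Padd t_add[OF g P(2) P(2)] using G_add[OF g, of "x - P x" "y - P y"]
    by (simp add: algebra_simps)
  have F_scale: "F g (smul c x) = smul c (F g x)" if g: "g \<in> G" for g c x
    unfolding F_def Pscale t_scale[OF g P(2)] using G_scale[OF g, of c "x - P x"]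
    by (simp add: scale_right_distrib scale_right_diff_distrib)
  have F_inv: "F (ginv g) \<circ> F g = id" "F g \<circ> F (ginv g) = id" if g: "g \<in> G" for g
  proof -
    have e: "ginv g \<circ> g = id" "g \<circ> ginv g = id" using g by (auto simp: fun_eq_iff)
    have "F (ginv g) (F g x) = x" "F g (F (ginv g) x) = x" for x
      unfolding F_comp[OF ginv_G[OF g] g] F_comp[OF g ginv_G[OF g]] e F_id by simp_all
    then show "F (ginv g) \<circ> F g = id" "F g \<circ> F (ginv g) = id" by (simp_all add: fun_eq_iff)
  qed
  have F_Aut: "F g \<in> carrier (Aut smul ip)" if g: "g \<in> G" for g
    unfolding Aut_iff using F_add[OF g] F_scale[OF g] F_ip[OF g] o_bij[OF F_inv[OF g]]
    by (simp add: Vector_Spaces.linear_iff vector_space_axioms)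
  have "subgroup (F ` G) (Aut smul ip)"
  proof (rule subgroup_AutI)
    show "id \<in> F ` G" using F_id id_G by force
    show "f \<circ> f' \<in> F ` G" if ff: "f \<in> F ` G" "f' \<in> F ` G" for f f'
    proof -
      obtain g g' where g: "g \<in> G" "g' \<in> G" "f = F g" "f' = F g'" using ff by blast
      then have "f \<circ> f' = F (g \<circ> g')" using F_comp by (simp add: fun_eq_iff)
      then show ?thesis using comp_G g by blast
    qed
    show "\<exists>f'\<in>F ` G. f' \<circ> f = id" if "f \<in> F ` G" for f
      using that F_inv(1) ginv_G by blast
  qed (use F_Aut in blast)
  moreover have "orbit (F ` G) x = orbit G x" if x: "x \<in> perp U" for x
  proof -
    have "F g x = g x" if g: "g \<in> G" for g
      unfolding F_def P(5)[OF x] using t_scale[OF g subspace_0[OF U], of 0] by simp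
    then show ?thesis unfolding orbit_def image_image by (intro image_cong refl)
  qed
  moreover have "orbit (F ` G) x = {\<tau> g x | g. g \<in> G}" if x: "x \<in> U" for x
  proof -
    have "F g x = \<tau> g x" if g: "g \<in> G" for g
      unfolding F_def P(3)[OF x] using G_0[OF g] by simp
    then have "(\<lambda>g. F g x) ` G = (\<lambda>g. \<tau> g x) ` G" by (intro image_cong refl)
    then show ?thesis unfolding orbit_def image_image by (simp add: setcompr_eq_image)
  qed
  ultimately show thesis by (rule that)
qed

text \<open>Here the twisted action on the complement of the orbits is the trivial one.\<close>

lemma other_group_if_nontrivial_off_orbits:
  assumes "g \<in> G" "x \<in> perp (orbit_span k v)" "g x \<noteq> x"
  shows "\<exists>H. subgroup H (Aut smul ip) \<and> H \<noteq> G \<and> (\<forall>i<k. orbit H (v i) = orbit G (v i))"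
proof -
  let ?N = "perp (orbit_span k v)"
  obtain H where H: "subgroup H (Aut smul ip)" "\<And>x. x \<in> perp ?N \<Longrightarrow> orbit H x = orbit G x"
    "\<And>x. x \<in> ?N \<Longrightarrow> orbit H x = {x | g. g \<in> G}"
    by (rule twisted_group[of ?N "\<lambda>_ x. x"]) (use subspace_perp perp_orbit_span_invariant in blast)+
  have "g x \<in> orbit G x" unfolding orbit_def using assms(1) by blast
  moreover have "g x \<notin> orbit H x" using H(3)[OF assms(2)] assms(3) by auto
  ultimately have "H \<noteq> G" by auto
  moreover have "v i \<in> perp ?N" if "i < k" for i
    using orbit_span_base'[OF that, of v] ip_eq_0_commute unfolding perp_def by blast
  ultimately show ?thesis using H(1,2) by blast
qed

text \<open>Here \<open>G\<close> fixes a subspace whose dimension is that of a smallest nontrivial representation, and the twisted action on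
  it is a unitary copy of that representation.\<close>

lemma other_group_if_large_fixed_space:
  assumes large: "min_nontrivial_dim TYPE('f) (Grp G) \<le> enat (dim (fixed \<inter> perp (orbit_span k v)))"
  shows "\<exists>H. subgroup H (Aut smul ip) \<and> H \<noteq> G \<and> (\<forall>i<k. orbit H (v i) = orbit G (v i))"
proof -
  let ?N = "perp (orbit_span k v)"
  let ?R = "{enat (vector_space.dim (scl \<pi>) (spc \<pi>)) | \<pi> :: ('f, nat \<Rightarrow> 'f, 'v \<Rightarrow> 'v) rep.
      scl \<pi> = fun_scale \<and> is_rep (Grp G) \<pi> \<and>
      (\<exists>B. finite B \<and> spc \<pi> \<subseteq> module.span (scl \<pi>) B) \<and>
      \<not> (\<forall>g\<in>carrier (Grp G). \<forall>x\<in>spc \<pi>. act \<pi> g x = x)}"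
  have m: "min_nontrivial_dim TYPE('f) (Grp G) = Inf ?R" unfolding min_nontrivial_dim_def ..
  have "?R \<noteq> {}"
  proof
    assume "?R = {}"
    then have "Inf ?R = Orderings.top" by (simp only: Inf_empty)
    with m have "min_nontrivial_dim TYPE('f) (Grp G) = Orderings.top" by (rule trans)
    with large show False by (simp add: top_enat_def)
  qed
  then have "Inf ?R \<in> ?R" by (metis (no_types, lifting) wellorder_InfI ex_in_conv)
  then obtain \<rho> :: "('f, nat \<Rightarrow> 'f, 'v \<Rightarrow> 'v) rep" where \<rho>: "Inf ?R = enat (vector_space.dim (scl \<rho>) (spc \<rho>))"
      "scl \<rho> = fun_scale" "is_rep (Grp G) \<rho>" "\<exists>B. finite B \<and> spc \<rho> \<subseteq> module.span (scl \<rho>) B"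
      "\<not> (\<forall>g\<in>carrier (Grp G). \<forall>x\<in>spc \<rho>. act \<rho> g x = x)" by blast
  interpret n: vector_space "fun_scale :: 'f \<Rightarrow> (nat \<Rightarrow> 'f) \<Rightarrow> nat \<Rightarrow> 'f" by (rule vector_space_fun_scale)
  interpret vector_space_pair "fun_scale :: 'f \<Rightarrow> (nat \<Rightarrow> 'f) \<Rightarrow> nat \<Rightarrow> 'f" smul ..
  have sub\<rho>: "n.subspace (spc \<rho>)" using is_repD(2)[OF \<rho>(3)] \<rho>(2) by simp
  have fd\<rho>: "fin_dim fun_scale (spc \<rho>)" using \<rho>(2,4) unfolding fin_dim_def by simp
  have "n.dim (spc \<rho>) \<le> dim (fixed \<inter> ?N)" using large \<rho>(1,2) m by simp
  then obtain U where U: "subspace U" "U \<subseteq> fixed \<inter> ?N" "dim U = n.dim (spc \<rho>)"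
    using subspace_of_dim[OF fin_dim_any subspace_inter[OF subspace_fixed subspace_perp]] by metis
  obtain B where B: "finite B" "n.independent B" "B \<subseteq> spc \<rho>" "n.span B = spc \<rho>" "card B = n.dim (spc \<rho>)"
    by (rule n.fin_dim_basis[OF fd\<rho> sub\<rho>])
  obtain C where C: "finite C" "independent C" "C \<subseteq> U" "span C = U" "card C = dim U"
    by (rule fin_dim_basis[OF fin_dim_any U(1)])
  have "\<exists>f. Vector_Spaces.linear fun_scale smul f \<and> f ` B = C \<and> f ` spc \<rho> = U \<and> inj_on f (spc \<rho>)"
    by (rule finite_basis_to_basis_subspace_isomorphism[OF sub\<rho> U(1) U(3)[symmetric]]) (use B C in auto)
  then obtain E where E: "Vector_Spaces.linear fun_scale smul E" "E ` spc \<rho> = U" "inj_on E (spc \<rho>)" by blast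
  obtain \<sigma> :: "('f, 'v, 'v \<Rightarrow> 'v) rep" where \<sigma>: "scl \<sigma> = smul" "spc \<sigma> = E ` spc \<rho>" "is_rep (Grp G) \<sigma>"
      "rep_hom (Grp G) \<rho> \<sigma> E"
    by (rule rep_transport[OF \<rho>(3) vector_space_axioms, of E])
      (use linear_add[OF E(1)] linear_scale[OF E(1)] E(3) \<rho>(2) in auto)
  obtain \<tau> where \<tau>: "\<And>g x. g \<in> G \<Longrightarrow> x \<in> U \<Longrightarrow> \<tau> g x \<in> U"
    "\<And>g x y. g \<in> G \<Longrightarrow> x \<in> U \<Longrightarrow> y \<in> U \<Longrightarrow> \<tau> g (x + y) = \<tau> g x + \<tau> g y"
    "\<And>g c x. g \<in> G \<Longrightarrow> x \<in> U \<Longrightarrow> \<tau> g (smul c x) = smul c (\<tau> g x)"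
    "\<And>g x y. g \<in> G \<Longrightarrow> x \<in> U \<Longrightarrow> y \<in> U \<Longrightarrow> ip (\<tau> g x) (\<tau> g y) = ip x y"
    "\<And>x. x \<in> U \<Longrightarrow> \<tau> id x = x"
    "\<And>g h x. g \<in> G \<Longrightarrow> h \<in> G \<Longrightarrow> x \<in> U \<Longrightarrow> \<tau> (g \<circ> h) x = \<tau> g (\<tau> h x)"
    "\<And>g x. g \<in> G \<Longrightarrow> x \<in> U \<Longrightarrow> act \<sigma> g x \<noteq> x \<Longrightarrow> \<exists>y\<in>U. \<tau> g y \<noteq> y"
    by (rule unitarize[OF \<sigma>(3,1,2)[unfolded E(2)]]) blast
  obtain g x where gx: "g \<in> G" "x \<in> spc \<rho>" "act \<rho> g x \<noteq> x" using \<rho>(5) by auto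
  have "act \<sigma> g (E x) = E (act \<rho> g x)" using rep_homD(4)[OF \<sigma>(4)] gx by simp
  also have "\<dots> \<noteq> E x" using E(3) gx is_repD(3)[OF \<rho>(3), of g x] unfolding inj_on_def by auto
  finally obtain y where y: "y \<in> U" "\<tau> g y \<noteq> y" using \<tau>(7)[OF gx(1), of "E x"] E(2) gx(2) by blast
  have fixU: "h u = u" if "h \<in> G" "u \<in> U" for h u using that U(2) unfolding fixed_def by blast
  have GU: "h u \<in> U" if "h \<in> G" "u \<in> U" for h u
    using fixU[OF that] that(2) by simp
  obtain H where H: "subgroup H (Aut smul ip)" "\<And>x. x \<in> perp U \<Longrightarrow> orbit H x = orbit G x"
    "\<And>x. x \<in> U \<Longrightarrow> orbit H x = {\<tau> g x | g. g \<in> G}"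
    by (rule twisted_group[of U \<tau>]) ((rule U(1) GU \<tau>(1-6); assumption) | blast)+
  have "\<tau> g y \<in> orbit H y" using H(3)[OF y(1)] gx(1) by blast
  moreover have "orbit G y = (\<lambda>_. y) ` G" unfolding orbit_def by (rule image_cong[OF refl fixU[OF _ y(1)]])
  then have "orbit G y = {y}" using id_G by auto
  ultimately have "H \<noteq> G" using y(2) by auto
  moreover have "v i \<in> perp U" if "i < k" for i
    using orbit_span_base'[OF that, of v] ip_eq_0_commute U(2) unfolding perp_def by blast
  ultimately show ?thesis using H(1,2) by blast
qed

text \<open>A nonzero vector \<open>x\<close> of \<open>V\<^sub>\<pi>\<close> with \<open>\<pi>\<close> nontrivial cannot be fixed: otherwise \<open>y \<mapsto> \<langle>y, x\<rangle>\<close> would be a homomorphism to the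
  trivial representation that does not vanish on \<open>V\<^sub>\<pi>\<close>.\<close>

theorem orbits_fail_to_determine:
  assumes "\<not> star_condition smul ip G k"
  shows "\<exists>H. subgroup H (Aut smul ip) \<and> H \<noteq> G \<and> (\<forall>i<k. orbit H (v i) = orbit G (v i))"
proof -
  let ?N = "perp (orbit_span k v)"
  interpret n: vector_space "fun_scale :: 'f \<Rightarrow> (('v \<Rightarrow> 'v) \<Rightarrow> 'f) \<Rightarrow> ('v \<Rightarrow> 'v) \<Rightarrow> 'f"
    by (rule vector_space_fun_scale)
  interpret vector_space_pair smul "fun_scale :: 'f \<Rightarrow> (('v \<Rightarrow> 'v) \<Rightarrow> 'f) \<Rightarrow> ('v \<Rightarrow> 'v) \<Rightarrow> 'f" ..
  obtain \<pi> :: "('f, nat \<Rightarrow> 'f, 'v \<Rightarrow> 'v) rep" where "\<pi> \<in> irreps (Grp G)"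
    and bad: "\<not> (if rep_iso (Grp G) \<pi> (trivial_rep :: ('f, 'f, 'v \<Rightarrow> 'v) rep)
      then enat (dim fixed) + 1 \<le> enat k + min_nontrivial_dim TYPE('f) (Grp G)
      else dim (isotypic (Grp G) \<pi> (natural_rep smul)) \<le> k * n.dim (isotypic (Grp G) \<pi> regular))"
    using assms unfolding star_condition_iff by blast
  then have irr: "irreducible_rep (Grp G) \<pi>" unfolding irreps_def by blast
  then have rp: "is_rep (Grp G) \<pi>" unfolding irreducible_rep_def by blast
  have count: "dim (isotypic (Grp G) \<sigma> (natural_rep smul)) \<le>
      dim (isotypic (Grp G) \<sigma> (natural_rep smul) \<inter> ?N) + k * n.dim (isotypic (Grp G) \<sigma> regular)"
    for \<sigma> :: "('f, 'w::ab_group_add, 'v \<Rightarrow> 'v) rep"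
  proof -
    let ?S = "isotypic (Grp G) \<sigma> (natural_rep smul)" and ?T = "isotypic (Grp G) \<sigma> regular"
    have "dim ?S \<le> dim {x\<in>?S. \<forall>i<k. coeffs (v i) x = 0} + k * n.dim ?T"
    proof (rule dim_common_kernel_ge)
      show "subspace ?S" using isotypic_subspace(1)[OF is_rep_natural, of \<sigma>] by simp
      show "n.subspace ?T" using isotypic_subspace(1)[OF is_rep_reg, of \<sigma>] by (simp add: regular_simps(1))
      show "fin_dim fun_scale ?T" using n.fin_dim_subset[OF fin_dim_reg isotypic_subspace(2)[OF is_rep_reg]] .
      show "coeffs (v i) x \<in> ?T" if "x \<in> ?S" for i x
        by (rule isotypic_functorial[OF is_rep_natural is_rep_reg coeffs_hom that])
    qed (rule fin_dim_any coeffs_linear)+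
    moreover have "{x\<in>?S. \<forall>i<k. coeffs (v i) x = 0} = ?S \<inter> ?N" using perp_orbit_span_coeffs by blast
    ultimately show ?thesis by simp
  qed
  show ?thesis
  proof (cases "rep_iso (Grp G) \<pi> (trivial_rep :: ('f, 'f, 'v \<Rightarrow> 'v) rep)")
    case True
    have fin: "finite (carrier (Grp G))" using finite_G by simp
    have "dim fixed \<le> dim (fixed \<inter> ?N) + k"
      using count[of trivial_rep] dim_fixed_regular[OF group_Grp fin, where 'f='f] fixed_eq_isotypic by simp
    moreover have "enat k + min_nontrivial_dim TYPE('f) (Grp G) < enat (dim fixed + 1)"
      using bad True by (simp add: one_enat_def)
    moreover from this obtain r where r: "min_nontrivial_dim TYPE('f) (Grp G) = enat r"
      by (cases "min_nontrivial_dim TYPE('f) (Grp G)") auto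
    ultimately have "min_nontrivial_dim TYPE('f) (Grp G) \<le> enat (dim (fixed \<inter> ?N))" by simp
    then show ?thesis by (rule other_group_if_large_fixed_space)
  next
    case False
    let ?S = "isotypic (Grp G) \<pi> (natural_rep smul)"
    have "dim (?S \<inter> ?N) \<noteq> 0" using count[of \<pi>] bad False by auto
    moreover have "0 \<in> ?S \<inter> ?N"
      using isotypic_subspace(1)[OF is_rep_natural, of \<pi>] subspace_0 subspace_perp by simp
    ultimately have "\<not> ?S \<inter> ?N \<subseteq> {0}" using dim_0 by (metis empty_iff subset_singletonD)
    then obtain x where x: "x \<in> ?S" "x \<in> ?N" "x \<noteq> 0" unfolding subset_iff by auto
    have "\<exists>g\<in>G. g x \<noteq> x"
    proof (rule ccontr)
      assume "\<not> (\<exists>g\<in>G. g x \<noteq> x)"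
      then have fx: "g x = x" if "g \<in> G" for g using that by blast
      have hom: "rep_hom (Grp G) (natural_rep smul) (trivial_rep :: ('f, 'f, 'v \<Rightarrow> 'v) rep) (\<lambda>y. ip y x)"
      proof (rule rep_homI)
        fix g y assume "g \<in> carrier (Grp G)"
        then show "ip (act (natural_rep smul) g y) x = act trivial_rep g (ip y x)"
          using G_ip[of g y x] fx[of g] by simp
      qed (auto simp: ip_add_left ip_scale_left)
      have "ip x x \<in> isotypic (Grp G) \<pi> (trivial_rep :: ('f, 'f, 'v \<Rightarrow> 'v) rep)"
        by (rule isotypic_functorial[OF is_rep_natural is_rep_trivial hom x(1)])
      then have "ip x x = 0" using isotypic_into_trivial[OF irr False] by blast
      with x(3) show False by simp
    qed
    then show ?thesis using other_group_if_nontrivial_off_orbits x(2) by blast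
  qed
qed

end

section \<open>Local maxima are generic\<close>

definition local_maxima :: "'a topology \<Rightarrow> ('a \<Rightarrow> nat) \<Rightarrow> 'a set"
  where "local_maxima X f = {x. \<exists>N. openin X N \<and> x \<in> N \<and> (\<forall>y\<in>N. f y \<le> f x)}"

text \<open>Openness: near a local maximum \<open>x\<close>, semicontinuity forces \<open>f\<close> to be constant. Density: on a nonempty open set the
  bounded function attains its maximum.\<close>

lemma generic_local_maxima:
  assumes lsc: "\<And>x. x \<in> topspace X \<Longrightarrow> \<exists>N. openin X N \<and> x \<in> N \<and> (\<forall>y\<in>N. f x \<le> f y)"
    and bounded: "\<And>x. x \<in> topspace X \<Longrightarrow> f x \<le> b"
  shows "generic X (local_maxima X f)"
  unfolding generic_def
proof
  show "openin X (local_maxima X f)"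
  proof (rule iffD2[OF openin_subopen], rule ballI)
    fix x assume "x \<in> local_maxima X f"
    then obtain N where N: "openin X N" "x \<in> N" "\<forall>y\<in>N. f y \<le> f x" unfolding local_maxima_def by blast
    have "x \<in> topspace X" using N(2) openin_subset[OF N(1)] by auto
    obtain N' where N': "openin X N'" "x \<in> N'" "\<forall>y\<in>N'. f x \<le> f y"
      using lsc[OF \<open>x \<in> topspace X\<close>] by blast
    have "N \<inter> N' \<subseteq> local_maxima X f"
    proof
      fix y assume y: "y \<in> N \<inter> N'"
      then have "f x \<le> f y" using N'(3) by simp
      then have "\<forall>z\<in>N. f z \<le> f y" using N(3) le_trans by fast
      then show "y \<in> local_maxima X f" unfolding local_maxima_def using N(1) y by blast
    qed
    then show "\<exists>T. openin X T \<and> x \<in> T \<and> T \<subseteq> local_maxima X f"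
      using N N' openin_Int by (intro exI[of _ "N \<inter> N'"]) auto
  qed
  show "(X closure_of local_maxima X f) = topspace X"
  proof (rule iffD2[OF dense_intersects_open], intro allI impI)
    fix T assume T: "openin X T \<and> T \<noteq> {}"
    then have "f ` T \<subseteq> {..b}" using bounded openin_subset[of X T] by auto
    then have "finite (f ` T)" by (rule finite_subset) simp
    then have "Max (f ` T) \<in> f ` T" "\<And>y. y \<in> T \<Longrightarrow> f y \<le> Max (f ` T)" using T by auto
    then obtain x where "x \<in> T" "\<forall>y\<in>T. f y \<le> f x" by force
    then show "local_maxima X f \<inter> T \<noteq> {}" unfolding local_maxima_def using T by blast
  qed
qed

lemma generic_Int: "generic X A \<Longrightarrow> generic X B \<Longrightarrow> generic X (A \<inter> B)"
  unfolding generic_def dense_intersects_open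
  by (metis (no_types, lifting) Int_assoc inf_commute openin_Int)

lemma openin_finite_nonzero:
  assumes "finite P" "\<And>p. p \<in> P \<Longrightarrow> continuous_map X euclidean (\<phi> p :: 'a \<Rightarrow> 'f::real_normed_field)"
  shows "openin X {x\<in>topspace X. \<forall>p\<in>P. \<phi> p x \<noteq> 0}"
  using assms
proof (induction P)
  case (insert p P)
  have "openin X {x\<in>topspace X. \<phi> p x \<in> - {0}}"
    by (rule openin_continuous_map_preimage[of X euclidean]) (use insert.prems in auto)
  moreover have "openin X {x\<in>topspace X. \<forall>p\<in>P. \<phi> p x \<noteq> 0}" using insert by simp
  ultimately have "openin X ({x\<in>topspace X. \<phi> p x \<in> - {0}} \<inter> {x\<in>topspace X. \<forall>p\<in>P. \<phi> p x \<noteq> 0})"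
    by (rule openin_Int)
  moreover have "{x\<in>topspace X. \<phi> p x \<in> - {0}} \<inter> {x\<in>topspace X. \<forall>p\<in>P. \<phi> p x \<noteq> 0} =
      {x\<in>topspace X. \<forall>p\<in>insert p P. \<phi> p x \<noteq> 0}" by auto
  ultimately show ?case by simp
qed simp

lemma continuous_map_times:
  fixes f g :: "'a \<Rightarrow> 'f::real_normed_field"
  assumes "continuous_map X euclidean f" "continuous_map X euclidean g"
  shows "continuous_map X euclidean (\<lambda>x. f x * g x)"
  using assms by (simp add: continuous_map_atin tendsto_mult)

context fd_hilbert_space begin

lemma topspace_htopology [simp]: "topspace (htopology ip) = UNIV"
  unfolding htopology_def using Metric_space.topspace_mtopology[OF Metric_space_hnorm] .

lemma topspace_pow: "topspace (htopology_pow ip k) = {..<k} \<rightarrow>\<^sub>E UNIV"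
  unfolding htopology_pow_def by simp

lemma lipschitz_continuous:
  fixes f :: "'v \<Rightarrow> 'f"
  assumes "\<And>x y. norm (f x - f y) \<le> C * hnorm ip (x - y)"
  shows "continuous_map (htopology ip) euclidean f"
proof -
  interpret M: Metric_space UNIV "\<lambda>x y. hnorm ip (x - y)" by (rule Metric_space_hnorm)
  have "\<exists>\<delta>>0. \<forall>x. x \<in> UNIV \<and> hnorm ip (a - x) < \<delta> \<longrightarrow> dist (f a) (f x) < \<epsilon>" if e: "\<epsilon> > 0" for a \<epsilon>
  proof (intro exI[of _ "\<epsilon> / (\<bar>C\<bar> + 1)"] conjI allI impI)
    show "\<epsilon> / (\<bar>C\<bar> + 1) > 0" using e by simp
    fix x assume x: "x \<in> UNIV \<and> hnorm ip (a - x) < \<epsilon> / (\<bar>C\<bar> + 1)"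
    have "dist (f a) (f x) \<le> C * hnorm ip (a - x)" using assms by (simp add: dist_norm)
    also have "\<dots> \<le> (\<bar>C\<bar> + 1) * hnorm ip (a - x)" by (intro mult_right_mono) auto
    also have "\<dots> < \<epsilon>" using x by (simp add: pos_less_divide_eq mult.commute)
    finally show "dist (f a) (f x) < \<epsilon>" .
  qed
  then have "continuous_map M.mtopology Met_TC.mtopology f"
    unfolding M.metric_continuous_map[OF Met_TC.Metric_space_axioms] by auto
  then show ?thesis unfolding htopology_def by simp
qed

lemma continuous_ip_left: "continuous_map (htopology ip) euclidean (\<lambda>x. ip x z)"
  by (rule lipschitz_continuous[of _ "hnorm ip z"]) (metis ip_diff_left cauchy_schwarz mult.commute)

lemma continuous_ip_right: "continuous_map (htopology ip) euclidean (\<lambda>x. ip z x)"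
  by (rule lipschitz_continuous[of _ "hnorm ip z"]) (metis ip_diff_right cauchy_schwarz)

lemma continuous_coordinate:
  assumes "i < k"
  shows "continuous_map (htopology_pow ip k) (htopology ip) (\<lambda>v. v i)"
  unfolding htopology_pow_def by (rule continuous_map_product_projection) (use assms in simp)

lemma line_in_open:
  assumes N: "openin (htopology_pow ip k) N" "v \<in> N"
  obtains \<delta> :: real where "\<delta> > 0"
    "\<And>t. \<bar>t\<bar> < \<delta> \<Longrightarrow> (\<lambda>i\<in>{..<k}. v i + smul (of_real t) (u i)) \<in> N"
proof -
  interpret M: Metric_space UNIV "\<lambda>x y. hnorm ip (x - y)" by (rule Metric_space_hnorm)
  let ?L = "\<lambda>t::real. \<lambda>i\<in>{..<k}. v i + smul (of_real t) (u i)"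
  have "continuous_map euclidean (htopology ip) (\<lambda>t::real. a + smul (of_real t) b)" for a b
  proof -
    have "\<exists>\<delta>>0. \<forall>t. t \<in> UNIV \<and> dist s t < \<delta> \<longrightarrow>
        hnorm ip ((a + smul (of_real s) b) - (a + smul (of_real t) b)) < \<epsilon>" if e: "\<epsilon> > 0" for s \<epsilon> :: real
    proof (intro exI[of _ "\<epsilon> / (hnorm ip b + 1)"] conjI allI impI)
      have p: "hnorm ip b + 1 > 0" using hnorm_nonneg[of b] by linarith
      show "\<epsilon> / (hnorm ip b + 1) > 0" using e p by simp
      fix t assume t: "t \<in> UNIV \<and> dist s t < \<epsilon> / (hnorm ip b + 1)"
      have "(a + smul (of_real s) b) - (a + smul (of_real t) b) = smul (of_real (s - t)) b"
        by (simp add: scale_left_diff_distrib)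
      then have "hnorm ip ((a + smul (of_real s) b) - (a + smul (of_real t) b)) = \<bar>s - t\<bar> * hnorm ip b"
        by (simp only: hnorm_scale norm_of_real)
      also have "\<dots> \<le> \<bar>s - t\<bar> * (hnorm ip b + 1)" by (intro mult_left_mono) auto
      also have "\<dots> < \<epsilon>" using t p by (simp add: pos_less_divide_eq dist_real_def)
      finally show "hnorm ip ((a + smul (of_real s) b) - (a + smul (of_real t) b)) < \<epsilon>" .
    qed
    then have "continuous_map Met_TC.mtopology M.mtopology (\<lambda>t::real. a + smul (of_real t) b)"
      unfolding Met_TC.metric_continuous_map[OF Metric_space_hnorm] by auto
    then show ?thesis unfolding htopology_def by simp
  qed
  then have "continuous_map euclidean (htopology_pow ip k) ?L"
    unfolding htopology_pow_def continuous_map_componentwise by auto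
  then have "openin euclidean {t\<in>topspace euclidean. ?L t \<in> N}"
    by (rule openin_continuous_map_preimage) (rule N(1))
  then have o: "open {t\<in>topspace euclidean. ?L t \<in> N}" by (rule open_openin[THEN iffD2])
  have "v \<in> {..<k} \<rightarrow>\<^sub>E UNIV" using N openin_subset topspace_pow by blast
  then have L0: "?L 0 = v" by (auto simp: fun_eq_iff PiE_def extensional_def)
  have "0 \<in> {t\<in>topspace euclidean. ?L t \<in> N}" by (rule CollectI, rule conjI, simp, subst L0, rule N(2))
  then obtain \<delta> where \<delta>: "\<delta> > 0" "ball 0 \<delta> \<subseteq> {t\<in>topspace euclidean. ?L t \<in> N}"
    by (rule openE[OF o])
  have "?L t \<in> N" if "\<bar>t\<bar> < \<delta>" for t
  proof -
    have "t \<in> ball 0 \<delta>" using that by simp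
    with \<delta>(2) show ?thesis by blast
  qed
  then show thesis using that[of \<delta>] \<delta>(1) by blast
qed

text \<open>The matrix of the inner products is diagonally dominant: compare the two sides of the relation at the largest
  coefficient.\<close>

lemma near_dual_independent:
  assumes B: "finite B" and near: "\<And>b c. b \<in> B \<Longrightarrow> c \<in> B \<Longrightarrow>
      norm (ip (w b) (y c) - (if b = c then 1 else 0)) < 1 / (real (card B) + 1)"
    and z: "(\<Sum>b\<in>B. smul (u b) (w b)) = 0" and b: "b \<in> B"
  shows "u b = 0"
proof -
  let ?n = "real (card B) + 1"
  let ?m = "Max ((\<lambda>b. norm (u b)) ` B)"
  have "?m \<in> (\<lambda>b. norm (u b)) ` B" using B b by (intro Max_in) auto
  then obtain c where c: "c \<in> B" "norm (u c) = ?m" by force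
  have max: "norm (u a) \<le> norm (u c)" if "a \<in> B" for a using that B c(2) by simp
  let ?d = "\<lambda>a. ip (w a) (y c) - (if a = c then 1 else 0)"
  have "(\<Sum>a\<in>B. u a * ip (w a) (y c)) = 0"
    using arg_cong[OF z, of "\<lambda>x. ip x (y c)"] by (simp add: ip_sum_left ip_scale_left)
  moreover have "(\<Sum>a\<in>B. u a * (if a = c then 1 else 0)) = (\<Sum>a\<in>B. if a = c then u a else 0)"
    by (rule sum.cong) auto
  moreover have "(\<Sum>a\<in>B. if a = c then u a else 0) = u c" using B c(1) by simp
  ultimately have "u c = - (\<Sum>a\<in>B. u a * ?d a)" by (simp add: right_diff_distrib sum_subtractf)
  then have "norm (u c) = norm (\<Sum>a\<in>B. u a * ?d a)" by simp
  also have "\<dots> \<le> (\<Sum>a\<in>B. norm (u a * ?d a))" by (rule norm_sum)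
  also have "\<dots> \<le> (\<Sum>a\<in>B. norm (u c) * (1 / ?n))"
    unfolding norm_mult by (intro sum_mono mult_mono max less_imp_le[OF near[OF _ c(1)]]) auto
  also have "\<dots> = norm (u c) * (real (card B) / ?n)" by simp
  finally have "norm (u c) * (1 - real (card B) / ?n) \<le> 0" by (simp add: right_diff_distrib)
  moreover have "1 - real (card B) / ?n > 0" by (simp add: field_simps)
  ultimately have "norm (u c) \<le> 0" by (simp add: mult_le_0_iff)
  with max[OF b] show ?thesis by simp
qed

text \<open>Polarization with \<open>x + y\<close> and \<open>i x + y\<close>. Over the reals, the quarter turns of the plane in the two
  directions have the same quadratic form, namely zero.\<close>

lemma quadratic_form_determines:
  assumes nr: "\<not> (\<forall>z::'f. z \<in> \<real>)"
    and f: "f \<in> carrier (Aut smul ip)" and g: "g \<in> carrier (Aut smul ip)"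
    and eq: "\<And>x. ip (f x) x = ip (g x) x"
  shows "f = g"
proof -
  obtain i :: 'f where i: "i * i = -1" "cj i = - i" using nr real_or_imaginary_unit[where 'f='f] by metis
  define A where "A = (\<lambda>x. f x - g x)"
  have Aadd: "A (x + y) = A x + A y" for x y unfolding A_def Aut_add[OF f] Aut_add[OF g] by simp
  have Ascale: "A (smul c x) = smul c (A x)" for c x
    unfolding A_def Aut_scale[OF f] Aut_scale[OF g] by (simp add: scale_right_diff_distrib)
  have A0: "ip (A x) x = 0" for x unfolding A_def using eq[of x] by (simp add: ip_diff_left)
  have s: "ip (A x) y + ip (A y) x = 0" for x y
    using A0[of "x + y"] A0[of x] A0[of y] by (simp add: Aadd ip_add_left ip_add_right add.commute)
  have "ip (A x) y = 0" for x y
  proof -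
    have "i * ip (A x) y - i * ip (A y) x = 0"
      using s[of "smul i x" y] i(2) by (simp add: Ascale ip_scale_left ip_scale_right)
    then have "i * (ip (A x) y - ip (A y) x) = 0" by (simp add: right_diff_distrib)
    moreover have "i \<noteq> 0" using i(1) by auto
    ultimately have "ip (A x) y - ip (A y) x = 0" by simp
    then have "(ip (A x) y + ip (A y) x) + (ip (A x) y - ip (A y) x) = 0" using s[of x y] by simp
    then have "2 * ip (A x) y = 0" by (simp add: algebra_simps)
    then show ?thesis by simp
  qed
  then have "A x = 0" for x using ip_self_eq_0 by blast
  then show ?thesis unfolding A_def by (simp add: fun_eq_iff)
qed

end

section \<open>Tuples in general position\<close>

context isometry_group begin

text \<open>All the conditions \<open>\<langle>g v\<^sub>i, v\<^sub>j\<rangle> \<noteq> \<langle>h v\<^sub>i, v\<^sub>j\<rangle>\<close> form one finite family, so that the number of those that hold can be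
  maximized.\<close>

definition gap :: "(('v \<Rightarrow> 'v) \<times> ('v \<Rightarrow> 'v) \<times> nat \<times> nat) \<Rightarrow> (nat \<Rightarrow> 'v) \<Rightarrow> 'f"
  where "gap = (\<lambda>(g, h, i, j) v. ip (g (v i)) (v j) - ip (h (v i)) (v j))"

definition gap_indices :: "nat \<Rightarrow> (('v \<Rightarrow> 'v) \<times> ('v \<Rightarrow> 'v) \<times> nat \<times> nat) set"
  where "gap_indices k = G \<times> G \<times> {..<k} \<times> {..<k}"

definition gap_count :: "nat \<Rightarrow> (nat \<Rightarrow> 'v) \<Rightarrow> nat"
  where "gap_count k v = card {p\<in>gap_indices k. gap p v \<noteq> 0}"

text \<open>Local maximality is all that is used about generic tuples: no small change of \<open>v\<close> enlarges the span of the orbits or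
  separates more inner products.\<close>

definition general_position :: "nat \<Rightarrow> (nat \<Rightarrow> 'v) set"
  where "general_position k = local_maxima (htopology_pow ip k) (\<lambda>v. dim (orbit_span k v))
    \<inter> local_maxima (htopology_pow ip k) (gap_count k)"

lemma finite_gap_indices: "finite (gap_indices k)"
  unfolding gap_indices_def using finite_G by simp

lemma continuous_coefficient:
  assumes g: "g \<in> G" and i: "i < k"
  shows "continuous_map (htopology_pow ip k) euclidean (\<lambda>v. ip (g (v i)) z)"
  using continuous_map_compose[OF continuous_coordinate[OF i] continuous_ip_left[of "ginv g z"]]
  by (simp add: o_def ip_ginv[OF g])

text \<open>Expanding in an orthonormal basis reduces joint continuity of the inner product to continuity in each variable.\<close>

lemma continuous_gap:
  assumes "p \<in> gap_indices k"
  shows "continuous_map (htopology_pow ip k) euclidean (gap p)"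
proof -
  obtain g h i j where p: "p = (g, h, i, j)" "g \<in> G" "h \<in> G" "i < k" "j < k"
    using assms unfolding gap_indices_def by auto
  obtain B where B: "finite B" "orthonormal B" "span B = UNIV"
    using exists_orthonormal_basis[OF subspace_UNIV] by metis
  have c: "continuous_map (htopology_pow ip k) euclidean (\<lambda>v. ip (f (v i)) (v j))" if f: "f \<in> G" for f
  proof -
    have "ip x y = (\<Sum>b\<in>B. ip x b * ip b y)" for x y
    proof -
      have "x = (\<Sum>b\<in>B. smul (ip x b) b)" using orthonormal_expand[OF B(1,2)] B(3) by simp
      then have "ip x y = ip (\<Sum>b\<in>B. smul (ip x b) b) y" by simp
      then show ?thesis by (simp add: ip_sum_left ip_scale_left)
    qed
    then have "(\<lambda>v. ip (f (v i)) (v j)) = (\<lambda>v. \<Sum>b\<in>B. ip (f (v i)) b * ip b (v j))" by (intro ext)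
    moreover have "continuous_map (htopology_pow ip k) euclidean (\<lambda>v. \<Sum>b\<in>B. ip (f (v i)) b * ip b (v j))"
      using continuous_map_compose[OF continuous_coordinate[OF p(5)] continuous_ip_right]
      by (intro continuous_map_sum continuous_map_times continuous_coefficient f p(4) B(1)) (simp add: o_def)
    ultimately show ?thesis by simp
  qed
  show ?thesis unfolding p(1) gap_def using continuous_map_diff[OF c[OF p(2)] c[OF p(3)]] by simp
qed

lemma generic_gap_count: "generic (htopology_pow ip k) (local_maxima (htopology_pow ip k) (gap_count k))"
proof (rule generic_local_maxima)
  fix v assume v: "v \<in> topspace (htopology_pow ip k)"
  let ?P = "{p\<in>gap_indices k. gap p v \<noteq> 0}"
  let ?N = "{w\<in>topspace (htopology_pow ip k). \<forall>p\<in>?P. gap p w \<noteq> 0}"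
  have "openin (htopology_pow ip k) ?N"
    by (rule openin_finite_nonzero) (use finite_gap_indices continuous_gap in auto)
  moreover have "gap_count k v \<le> gap_count k w" if "w \<in> ?N" for w
    unfolding gap_count_def using that finite_gap_indices by (intro card_mono) auto
  ultimately show "\<exists>N. openin (htopology_pow ip k) N \<and> v \<in> N \<and> (\<forall>w\<in>N. gap_count k v \<le> gap_count k w)"
    using v by (intro exI[of _ ?N]) auto
next
  show "gap_count k v \<le> card (gap_indices k)" for v
    unfolding gap_count_def using finite_gap_indices by (intro card_mono) auto
qed

text \<open>A basis of the span is made of vectors \<open>h v\<^sub>i\<close>. After a small change of \<open>v\<close> they are still almost dual to the dual basis,
  so they stay independent: the dimension is lower semicontinuous.\<close>

lemma generic_orbit_span:
  "generic (htopology_pow ip k) (local_maxima (htopology_pow ip k) (\<lambda>v. dim (orbit_span k v)))"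
proof (rule generic_local_maxima)
  show "dim (orbit_span k v) \<le> dim UNIV" for v
    by (rule dim_mono_fin[OF fin_dim_any]) (auto simp: subspace_orbit_span)
  fix v assume v: "v \<in> topspace (htopology_pow ip k)"
  let ?E = "{h (v i) | h i. h \<in> G \<and> i < k}"
  obtain B where B: "B \<subseteq> ?E" "independent B" "?E \<subseteq> span B" "card B = dim ?E" by (rule basis_exists)
  have dimB: "card B = dim (orbit_span k v)" unfolding B(4) orbit_span_def by simp
  have finB: "finite B" using fin_dim_finite_independent[OF fin_dim_any[of UNIV] B(2)] by simp
  have "\<forall>b\<in>B. \<exists>h i. h \<in> G \<and> i < k \<and> b = h (v i)" using B(1) by blast
  then obtain h i where hi: "\<And>b. b \<in> B \<Longrightarrow> h b \<in> G \<and> i b < k \<and> b = h b (v (i b))" by metis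
  have "\<exists>y. \<forall>b\<in>B. ip b y = (if b = c then 1 else 0)" if c: "c \<in> B" for c
  proof -
    obtain y where y: "y \<in> span B" "\<And>x. x \<in> span B \<Longrightarrow> representation B x c = ip x y"
      by (rule riesz_on_subspace[OF subspace_span, of B "\<lambda>x. representation B x c"])
        (auto simp: representation_add[OF B(2)] representation_scale[OF B(2)])
    have "ip b y = (if b = c then 1 else 0)" if b: "b \<in> B" for b
      using y(2)[OF span_base[OF b]] representation_basis[OF B(2) b] by auto
    then show ?thesis by blast
  qed
  then obtain y where y: "\<And>b c. b \<in> B \<Longrightarrow> c \<in> B \<Longrightarrow> ip b (y c) = (if b = c then 1 else 0)" by metis
  \<comment> \<open>the tolerance required by \<open>near_dual_independent\<close>\<close>
  let ?e = "1 / (real (card B) + 1)"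
  let ?O = "\<lambda>(b, c). {w\<in>topspace (htopology_pow ip k). ip (h b (w (i b))) (y c) \<in> ball (if b = c then 1 else 0) ?e}"
  let ?N = "(\<Inter>p\<in>B \<times> B. ?O p) \<inter> topspace (htopology_pow ip k)"
  have o: "openin (htopology_pow ip k) (?O p)" if p: "p \<in> B \<times> B" for p
  proof -
    obtain b c where bc: "p = (b, c)" "b \<in> B" using p by blast
    have "openin (htopology_pow ip k)
        {w\<in>topspace (htopology_pow ip k). ip (h b (w (i b))) (y c) \<in> ball (if b = c then 1 else 0) ?e}"
      by (rule openin_continuous_map_preimage[OF continuous_coefficient]) (use hi[OF bc(2)] in auto)
    then show ?thesis using bc(1) by simp
  qed
  have "openin (htopology_pow ip k) ?N"
    by (rule openin_INT) (use finB o in auto)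
  moreover have "v \<in> ?N" using v y hi by auto
  moreover have "dim (orbit_span k v) \<le> dim (orbit_span k w)" if w: "w \<in> ?N" for w
  proof -
    interpret vector_space_pair smul smul ..
    let ?w = "\<lambda>b. h b (w (i b))"
    obtain f where f: "Vector_Spaces.linear smul smul f" "\<And>b. b \<in> B \<Longrightarrow> f b = ?w b"
      using linear_independent_extend[OF B(2), of ?w] by blast
    have near: "norm (ip (?w b) (y c) - (if b = c then 1 else 0)) < ?e" if "b \<in> B" "c \<in> B" for b c
    proof -
      have "w \<in> ?O (b, c)" using w that by blast
      then show ?thesis by (simp add: dist_norm norm_minus_commute)
    qed
    have "x = 0" if x: "x \<in> span B" "f x = 0" for x
    proof -
      obtain u where u: "x = (\<Sum>b\<in>B. smul (u b) b)" using x(1) span_finite[OF finB] by auto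
      have "(\<Sum>b\<in>B. smul (u b) (?w b)) = (\<Sum>b\<in>B. smul (u b) (f b))" by (rule sum.cong) (simp_all add: f(2))
      also have "\<dots> = f x" unfolding u linear_sum[OF f(1)] linear_scale[OF f(1)] ..
      finally have "(\<Sum>b\<in>B. smul (u b) (?w b)) = 0" using x(2) by simp
      then have "u b = 0" if "b \<in> B" for b using near_dual_independent[OF finB near _ that] by blast
      then show "x = 0" unfolding u by simp
    qed
    then have "{x\<in>span B. f x = 0} \<subseteq> {0}" by blast
    moreover have "0 \<in> {x\<in>span B. f x = 0}" using linear_0[OF f(1)] span_zero by simp
    ultimately have ker: "{x\<in>span B. f x = 0} = {0}" by blast
    have "dim (span B) = dim {x\<in>span B. f x = 0} + dim (f ` span B)"
      by (rule rank_nullity[OF f(1) subspace_span fin_dim_any])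
    then have "dim (span B) = dim (f ` span B)" unfolding ker dim_0 by simp
    moreover have "f ` span B \<subseteq> orbit_span k w"
    proof -
      have "f ` B \<subseteq> orbit_span k w" using f(2) hi orbit_span_base by auto
      then have "span (f ` B) \<subseteq> orbit_span k w" by (rule span_minimal[OF _ subspace_orbit_span])
      then show ?thesis using linear_span_image[OF f(1)] by simp
    qed
    then have "dim (f ` span B) \<le> dim (orbit_span k w)"
      by (intro dim_mono_fin[OF fin_dim_any _ _ subspace_orbit_span] linear_subspace_image[OF f(1)] subspace_span)
    ultimately show ?thesis using dimB dim_span_eq_card_independent[OF B(2)] by simp
  qed
  ultimately show "\<exists>N. openin (htopology_pow ip k) N \<and> v \<in> N \<and>
      (\<forall>w\<in>N. dim (orbit_span k v) \<le> dim (orbit_span k w))"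
    by blast
qed

lemma generic_general_position: "generic (htopology_pow ip k) (general_position k)"
  unfolding general_position_def by (rule generic_Int[OF generic_orbit_span generic_gap_count])

text \<open>If the gap vanished at \<open>v\<close>, then along a line through \<open>v\<close> it would be a polynomial of degree two in the parameter; nearby it
  would become nonzero while the other gaps persist, against local maximality.\<close>

lemma general_position_gap:
  assumes v: "v \<in> general_position k" and gh: "g \<in> G" "h \<in> G" "g \<noteq> h" and ij: "i < k" "j < k"
    and or: "i \<noteq> j \<or> \<not> (\<forall>z::'f. z \<in> \<real>)"
  shows "ip (g (v i)) (v j) \<noteq> ip (h (v i)) (v j)"
proof
  assume eq: "ip (g (v i)) (v j) = ip (h (v i)) (v j)"
  let ?X = "htopology_pow ip k"
  let ?q = "(g, h, i, j)"
  have q: "?q \<in> gap_indices k" using gh ij unfolding gap_indices_def by simp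
  obtain N where N: "openin ?X N" "v \<in> N" "\<forall>w\<in>N. gap_count k w \<le> gap_count k v"
    using v unfolding general_position_def local_maxima_def by blast
  define A where "A = (\<lambda>x. g x - h x)"
  have Aadd: "A (x + y) = A x + A y" for x y unfolding A_def using gh by (simp add: G_add)
  have Ascale: "A (smul c x) = smul c (A x)" for c x
    unfolding A_def using gh by (simp add: G_scale scale_right_diff_distrib)
  have gapA: "gap ?q w = ip (A (w i)) (w j)" for w unfolding gap_def A_def by (simp add: ip_diff_left)
  \<comment> \<open>a direction in which the leading coefficient of the gap is nonzero\<close>
  have "\<exists>u. ip (A (u i)) (u j) \<noteq> 0"
  proof (cases "i = j")
    case True
    then have "\<not> (\<forall>z::'f. z \<in> \<real>)" using or by simp
    then have "\<exists>x. ip (g x) x \<noteq> ip (h x) x"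
      using quadratic_form_determines[OF _ G_Aut[OF gh(1)] G_Aut[OF gh(2)]] gh(3) by blast
    then obtain x where "ip (A x) x \<noteq> 0" unfolding A_def by (auto simp: ip_diff_left)
    then show ?thesis using True by (intro exI[of _ "\<lambda>_. x"]) simp
  next
    case False
    obtain x where "g x \<noteq> h x" using gh(3) by blast
    then have "ip (A x) (A x) \<noteq> 0" unfolding A_def by simp
    then show ?thesis using False by (intro exI[of _ "\<lambda>l. if l = i then x else A x"]) auto
  qed
  then obtain u where u: "ip (A (u i)) (u j) \<noteq> 0" by blast
  let ?P = "{p\<in>gap_indices k. gap p v \<noteq> 0}"
  let ?N = "N \<inter> {w\<in>topspace ?X. \<forall>p\<in>?P. gap p w \<noteq> 0}"
  have "openin ?X ?N"
    by (rule openin_Int[OF N(1)], rule openin_finite_nonzero) (use finite_gap_indices continuous_gap in auto)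
  moreover have "v \<in> ?N" using N(1,2) openin_subset by blast
  ultimately obtain \<delta> :: real where \<delta>: "\<delta> > 0"
      "\<And>t. \<bar>t\<bar> < \<delta> \<Longrightarrow> (\<lambda>i\<in>{..<k}. v i + smul (of_real t) (u i)) \<in> ?N"
    by (rule line_in_open[where u = u]) blast
  let ?L = "\<lambda>t::real. \<lambda>i\<in>{..<k}. v i + smul (of_real t) (u i)"
  have zero: "gap ?q (?L t) = 0" if t: "\<bar>t\<bar> < \<delta>" for t
  proof (rule ccontr)
    assume nz: "gap ?q (?L t) \<noteq> 0"
    have L: "?L t \<in> N" "\<forall>p\<in>?P. gap p (?L t) \<noteq> 0" using \<delta>(2)[OF t] by blast+
    have "gap ?q v = 0" using eq unfolding gap_def by simp
    then have "?P \<subset> {p\<in>gap_indices k. gap p (?L t) \<noteq> 0}" using L(2) nz q by blast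
    then have "gap_count k v < gap_count k (?L t)"
      unfolding gap_count_def using finite_gap_indices by (intro psubset_card_mono) auto
    moreover have "gap_count k (?L t) \<le> gap_count k v" using N(3) L(1) by blast
    ultimately show False by simp
  qed
  define b where "b = ip (A (v i)) (u j) + ip (A (u i)) (v j)"
  define c where "c = ip (A (u i)) (u j)"
  have expand: "gap ?q (?L t) = of_real t * (b + of_real t * c)" for t
  proof -
    have "gap ?q (?L t) = ip (A (v i + smul (of_real t) (u i))) (v j + smul (of_real t) (u j))"
      unfolding gapA using ij by simp
    also have "\<dots> = ip (A (v i)) (v j) + of_real t * (b + of_real t * c)"
      by (simp add: Aadd Ascale ip_add_left ip_add_right ip_scale_left ip_scale_right b_def c_def algebra_simps)
    also have "ip (A (v i)) (v j) = 0" using eq unfolding A_def by (simp add: ip_diff_left)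
    finally show ?thesis by (simp only: add_0)
  qed
  have "b + of_real t * c = 0" if "\<bar>t\<bar> < \<delta>" "t \<noteq> 0" for t
    using trans[OF sym[OF expand] zero[OF that(1)]] that(2) by simp
  \<comment> \<open>a linear polynomial with two roots vanishes\<close>
  from this[of "\<delta> / 2"] this[of "\<delta> / 3"] \<delta>(1)
  have "b + of_real (\<delta> / 2) * c = 0" "b + of_real (\<delta> / 3) * c = 0" by simp_all
  then have "of_real (\<delta> / 2) * c = of_real (\<delta> / 3) * c" by (metis add_left_cancel)
  then have "c = 0" using \<delta>(1) by (simp only: mult_cancel_right of_real_eq_iff) simp
  with u show False unfolding c_def by blast
qed

end

section \<open>Generic orbits span as much as the inequality permits\<close>

context isometry_group begin

abbreviation sub_rep :: "'v set \<Rightarrow> ('f, 'v, 'v \<Rightarrow> 'v) rep"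
  where "sub_rep T \<equiv> (natural_rep smul)\<lparr>spc := T\<rparr>"

lemma subrep_natural: "subrep (Grp G) T (natural_rep smul) \<longleftrightarrow> subspace T \<and> (\<forall>g\<in>G. \<forall>x\<in>T. g x \<in> T)"
  unfolding subrep_iff[OF is_rep_natural] by simp

text \<open>The \<open>t\<close> for which the system can be solved form a subrepresentation of \<open>T\<close>. If it were zero, then after moving \<open>v\<^sub>j\<close> by a small multiple of \<open>u\<close> the
  complement of the orbits would be contained in the old one and orthogonal to \<open>T\<close>, hence strictly smaller.\<close>

lemma perturbation:
  assumes v: "v \<in> general_position k"
    and T: "subrep (Grp G) T (natural_rep smul)" "irreducible_rep (Grp G) (sub_rep T)" "T \<subseteq> perp (orbit_span k v)"
    and j: "j < k" and u: "u \<in> T" and t: "t \<in> T"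
  shows "\<exists>x. \<forall>i<k. \<forall>h\<in>G. ip x (h (v i)) = (if i = j then ip t (h u) else 0)"
proof -
  have subT: "subspace T" and GT: "\<And>g x. g \<in> G \<Longrightarrow> x \<in> T \<Longrightarrow> g x \<in> T"
    using T(1) unfolding subrep_natural by blast+
  have T0: "T \<noteq> {0}" using T(2) unfolding irreducible_rep_def by simp
  let ?S = "\<lambda>t x. \<forall>i<k. \<forall>h\<in>G. ip x (h (v i)) = (if i = j then ip t (h u) else 0)"
  let ?L = "{t\<in>T. \<exists>x. ?S t x}"
  have "subspace ?L"
  proof (rule subspaceI)
    have "?S 0 0" by simp
    then show "0 \<in> ?L" using subspace_0[OF subT] by blast
    fix a b assume "a \<in> ?L" "b \<in> ?L"
    then obtain x y where xy: "a \<in> T" "b \<in> T" "?S a x" "?S b y" by blast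
    have "?S (a + b) (x + y)" using xy(3,4) by (simp add: ip_add_left)
    then show "a + b \<in> ?L" using xy(1,2) subspace_add[OF subT] by blast
  next
    fix c a assume "a \<in> ?L"
    then obtain x where x: "a \<in> T" "?S a x" by blast
    have "?S (smul c a) (smul c x)" using x(2) by (simp add: ip_scale_left)
    then show "smul c a \<in> ?L" using x(1) subspace_scale[OF subT] by blast
  qed
  moreover have "g a \<in> ?L" if g: "g \<in> G" and a: "a \<in> ?L" for g a
  proof -
    obtain x where x: "a \<in> T" "?S a x" using a by blast
    have "?S (g a) (g x)"
    proof (intro allI impI ballI)
      fix i h assume "i < k" "h \<in> G"
      then show "ip (g x) (h (v i)) = (if i = j then ip (g a) (h u) else 0)"
        using x(2)[rule_format, of i "ginv g \<circ> h"] comp_G[OF ginv_G[OF g]] by (simp add: ip_ginv[OF g])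
    qed
    then show ?thesis using x(1) GT[OF g] by blast
  qed
  ultimately have "subrep (Grp G) ?L (natural_rep smul)" unfolding subrep_natural by blast
  then have "subrep (Grp G) ?L (sub_rep T)" using subrep_restrict[OF T(1), of ?L] by blast
  then have "?L = {0} \<or> ?L = T" using T(2) unfolding irreducible_rep_def by simp
  moreover have "?L \<noteq> {0}"
  proof
    assume L0: "?L = {0}"
    obtain M where M: "openin (htopology_pow ip k) M" "v \<in> M"
        "\<forall>w\<in>M. dim (orbit_span k w) \<le> dim (orbit_span k v)"
      using v unfolding general_position_def local_maxima_def by blast
    obtain \<delta> :: real where \<delta>: "\<delta> > 0" "\<And>s. \<bar>s\<bar> < \<delta> \<Longrightarrow>
        (\<lambda>i\<in>{..<k}. v i + smul (of_real s) (if i = j then u else 0)) \<in> M"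
      by (rule line_in_open[OF M(1,2), where u = "\<lambda>i. if i = j then u else 0"]) blast
    define s where "s = \<delta> / 2"
    define w where "w = (\<lambda>i\<in>{..<k}. v i + smul (of_real s) (if i = j then u else 0))"
    have s: "s \<noteq> 0" "w \<in> M" using \<delta>(1) \<delta>(2)[of s] unfolding s_def w_def by auto
    define P where "P = proj T"
    note P = proj_props[OF subT, folded P_def]
    let ?N = "perp (orbit_span k v)" and ?N' = "perp (orbit_span k w)"
    have N': "x \<in> ?N \<and> x \<in> perp T" if x: "x \<in> ?N'" for x
    proof -
      have e: "ip x (h (v i)) = - of_real s * (if i = j then ip x (h u) else 0)" if "i < k" "h \<in> G" for i h
      proof -
        have "ip x (h (w i)) = 0" using x that unfolding perp_orbit_span by blast
        then have "ip x (h (v i)) + of_real s * (if i = j then ip x (h u) else 0) = 0"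
          using that by (cases "i = j") (simp_all add: w_def G_add G_scale ip_add_right ip_scale_right)
        then show ?thesis by (simp add: eq_neg_iff_add_eq_0)
      qed
      have pr: "ip x (h u) = ip (P x) (h u)" if "h \<in> G" for h
      proof -
        have "ip (x - P x) (h u) = 0" using P(4)[of x] GT[OF that u] unfolding perp_def by blast
        then show ?thesis by (simp add: ip_diff_left)
      qed
      \<comment> \<open>the vanishing of the coefficients of \<open>x\<close> at \<open>w\<close> is the system for \<open>P x\<close>, up to the factor \<open>- s\<close>\<close>
      have "?S (P x) (smul (- of_real (1 / s)) x)"
        using e pr s(1) by (simp add: ip_scale_left)
      then have "P x \<in> ?L" using P(2) by blast
      then have P0: "P x = 0" using L0 by blast
      then have "ip x (h u) = 0" if "h \<in> G" for h using pr[OF that] by simp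
      then have "x \<in> ?N" unfolding perp_orbit_span using e by simp
      moreover have "x \<in> perp T" using P(4)[of x] P0 by simp
      ultimately show ?thesis by blast
    qed
    have "dim ?N' < dim ?N"
    proof (rule ccontr)
      assume "\<not> dim ?N' < dim ?N"
      then have "dim ?N \<le> dim ?N'" by simp
      moreover have "?N' \<subseteq> ?N" using N' by blast
      ultimately have "?N' = ?N"
        using subspace_eq_of_dim_ge[OF fin_dim_any _ subspace_perp subspace_perp] by blast
      then have "T \<subseteq> perp T" using T(3) N' by blast
      then have "T \<subseteq> {0}" using perp_disjoint by blast
      then show False using T0 subspace_0[OF subT] by blast
    qed
    moreover have "dim (orbit_span k w) \<le> dim (orbit_span k v)" using M(3) s(2) by blast
    ultimately show False
      using dim_perp[OF subspace_orbit_span, of k v] dim_perp[OF subspace_orbit_span, of k w] by linarith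
  qed
  ultimately show ?thesis using t by blast
qed

text \<open>By Riesz, applied to the value at the identity, a homomorphism from \<open>T\<close> to the regular representation has the form
  \<open>t \<mapsto> (h \<mapsto> \<langle>t, h u\<rangle>)\<close>, so \<open>perturbation\<close> yields preimages. Those chosen in the span of the orbits are unique, so they
  depend equivariantly on \<open>t\<close> and lie in the isotypic component.\<close>

lemma coefficients_onto:
  assumes v: "v \<in> general_position k"
    and T: "subrep (Grp G) T (natural_rep smul)" "irreducible_rep (Grp G) (sub_rep T)" "T \<subseteq> perp (orbit_span k v)"
    and j: "j < k"
  shows "isotypic (Grp G) (sub_rep T) regular \<subseteq>
    coeffs (v j) ` {x\<in>isotypic (Grp G) (sub_rep T) (natural_rep smul). \<forall>i<k. i \<noteq> j \<longrightarrow> coeffs (v i) x = 0}"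
proof -
  interpret n: vector_space "fun_scale :: 'f \<Rightarrow> (('v \<Rightarrow> 'v) \<Rightarrow> 'f) \<Rightarrow> ('v \<Rightarrow> 'v) \<Rightarrow> 'f"
    by (rule vector_space_fun_scale)
  interpret vector_space_pair smul "fun_scale :: 'f \<Rightarrow> (('v \<Rightarrow> 'v) \<Rightarrow> 'f) \<Rightarrow> ('v \<Rightarrow> 'v) \<Rightarrow> 'f" ..
  have subT: "subspace T" and GT: "\<And>g x. g \<in> G \<Longrightarrow> x \<in> T \<Longrightarrow> g x \<in> T"
    using T(1) unfolding subrep_natural by blast+
  let ?S = "isotypic (Grp G) (sub_rep T) (natural_rep smul)"
  let ?X = "{x\<in>?S. \<forall>i<k. i \<noteq> j \<longrightarrow> coeffs (v i) x = 0}"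
  let ?W = "orbit_span k v"
  have subS: "subspace ?S" using isotypic_subspace(1)[OF is_rep_natural] by simp
  have subX: "subspace ?X"
    using subspace_0[OF subS] subspace_add[OF subS] subspace_scale[OF subS]
      linear_0[OF coeffs_linear] linear_add[OF coeffs_linear] linear_scale[OF coeffs_linear]
    by (auto simp: subspace_def)
  define P where "P = proj ?W"
  note P = proj_props[OF subspace_orbit_span[of k v], folded P_def]
  have gen: "\<beta> t \<in> coeffs (v j) ` ?X" if \<beta>: "rep_hom (Grp G) (sub_rep T) regular \<beta>" and t: "t \<in> T" for \<beta> t
  proof -
    note \<beta>D = rep_homD[OF \<beta>, simplified, unfolded regular_simps natural_simps]
    obtain u where u: "u \<in> T" "\<And>x. x \<in> T \<Longrightarrow> \<beta> x id = ip x u"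
      by (rule riesz_on_subspace[OF subT, of "\<lambda>x. \<beta> x id"]) (use \<beta>D(2,3) in \<open>auto simp: fun_scale_def\<close>)
    have \<beta>_eq: "\<beta> x h = ip x (h u)" if x: "x \<in> T" and h: "h \<in> G" for x h
    proof -
      have "ginv (ginv h) = h"
        unfolding ginv_def using group.inv_inv[OF group_Grp, of h] h by simp
      then have "\<beta> (ginv h x) id = \<beta> x h"
        using \<beta>D(4)[OF ginv_G[OF h] x] id_G by simp
      moreover have "\<beta> (ginv h x) id = ip (ginv h x) u" using u(2) GT[OF ginv_G[OF h] x] by blast
      moreover have "ip (ginv h x) u = ip x (h u)" using G_ip[OF h, of "ginv h x" u] h by simp
      ultimately show ?thesis by simp
    qed
    let ?E = "\<lambda>t x. x \<in> ?W \<and> (\<forall>i<k. \<forall>h\<in>G. ip x (h (v i)) = (if i = j then ip t (h u) else 0))"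
    have ex: "\<exists>x. ?E t x" if t: "t \<in> T" for t
    proof -
      obtain x where x: "\<forall>i<k. \<forall>h\<in>G. ip x (h (v i)) = (if i = j then ip t (h u) else 0)"
        using perturbation[OF v T j u(1) t] by blast
      have "ip (P x) (h (v i)) = ip x (h (v i))" if "i < k" "h \<in> G" for i h
        using P(4)[of x] that unfolding perp_orbit_span by (simp add: ip_diff_left)
      then have "?E t (P x)" using x P(2) by simp
      then show ?thesis by blast
    qed
    have uniq: "x = y" if "?E t x" "?E t y" for t x y
    proof -
      have "x - y \<in> ?W" using that subspace_diff[OF subspace_orbit_span] by blast
      moreover have "x - y \<in> perp ?W" unfolding perp_orbit_span using that by (simp add: ip_diff_left)
      ultimately show ?thesis using perp_disjoint by fastforce
    qed
    define \<theta> where "\<theta> = (\<lambda>t. SOME x. ?E t x)"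
    have \<theta>: "?E t (\<theta> t)" if "t \<in> T" for t unfolding \<theta>_def by (rule someI_ex[OF ex[OF that]])
    have "rep_hom (Grp G) (sub_rep T) (natural_rep smul) \<theta>"
    proof (rule rep_homI, simp_all)
      fix x y assume x: "x \<in> T" and y: "y \<in> T"
      have "?E (x + y) (\<theta> x + \<theta> y)"
        using \<theta>[OF x] \<theta>[OF y] subspace_add[OF subspace_orbit_span] by (simp add: ip_add_left)
      then show "\<theta> (x + y) = \<theta> x + \<theta> y" by (rule uniq[OF \<theta>[OF subspace_add[OF subT x y]]])
    next
      fix c x assume x: "x \<in> T"
      have "?E (smul c x) (smul c (\<theta> x))"
        using \<theta>[OF x] subspace_scale[OF subspace_orbit_span] by (simp add: ip_scale_left)
      then show "\<theta> (smul c x) = smul c (\<theta> x)" by (rule uniq[OF \<theta>[OF subspace_scale[OF subT x]]])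
    next
      fix g x assume g: "g \<in> G" and x: "x \<in> T"
      have "?E (g x) (g (\<theta> x))"
      proof (intro conjI allI impI ballI)
        show "g (\<theta> x) \<in> ?W" using \<theta>[OF x] orbit_span_invariant[OF g] by blast
        fix i h assume "i < k" "h \<in> G"
        then show "ip (g (\<theta> x)) (h (v i)) = (if i = j then ip (g x) (h u) else 0)"
          using conjunct2[OF \<theta>[OF x], rule_format, of i "ginv g \<circ> h"] comp_G[OF ginv_G[OF g]]
          by (simp add: ip_ginv[OF g])
      qed
      then show "\<theta> (g x) = g (\<theta> x)" by (rule uniq[OF \<theta>[OF GT[OF g x]]])
    qed
    then have "\<theta> t \<in> ?S" using isotypic_hom[OF is_rep_natural, of "sub_rep T" \<theta> t] t by simp
    moreover have "coeffs (v i) (\<theta> t) = 0" if "i < k" "i \<noteq> j" for i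
      unfolding coeffs_eq_0_iff using \<theta>[OF t] that by simp
    moreover have "coeffs (v j) (\<theta> t) = \<beta> t"
    proof
      fix h show "coeffs (v j) (\<theta> t) h = \<beta> t h"
        using \<theta>[OF t] j \<beta>_eq[OF t, of h] \<beta>D(1)[OF t] by (cases "h \<in> G") (auto simp: coeffs_def)
    qed
    ultimately show ?thesis by (intro image_eqI[of _ _ "\<theta> t"]) auto
  qed
  have "n.subspace (coeffs (v j) ` ?X)" by (rule linear_subspace_image[OF coeffs_linear subX])
  moreover have "{\<beta> t | \<beta> t. rep_hom (Grp G) (sub_rep T) regular \<beta> \<and> t \<in> spc (sub_rep T)} \<subseteq> coeffs (v j) ` ?X"
    using gen by auto
  ultimately have "n.span {\<beta> t | \<beta> t. rep_hom (Grp G) (sub_rep T) regular \<beta> \<and> t \<in> spc (sub_rep T)}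
      \<subseteq> coeffs (v j) ` ?X"
    by (rule n.span_minimal[rotated])
  then show ?thesis unfolding isotypic_def[of _ _ regular] regular_simps(1) .
qed

lemma isotypic_dim_general_position:
  assumes v: "v \<in> general_position k"
    and T: "subrep (Grp G) T (natural_rep smul)" "irreducible_rep (Grp G) (sub_rep T)" "T \<subseteq> perp (orbit_span k v)"
  shows "dim (isotypic (Grp G) (sub_rep T) (natural_rep smul)) =
    dim (isotypic (Grp G) (sub_rep T) (natural_rep smul) \<inter> perp (orbit_span k v)) +
    k * vector_space.dim fun_scale (isotypic (Grp G) (sub_rep T) regular)"
proof -
  interpret n: vector_space "fun_scale :: 'f \<Rightarrow> (('v \<Rightarrow> 'v) \<Rightarrow> 'f) \<Rightarrow> ('v \<Rightarrow> 'v) \<Rightarrow> 'f"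
    by (rule vector_space_fun_scale)
  interpret vector_space_pair smul "fun_scale :: 'f \<Rightarrow> (('v \<Rightarrow> 'v) \<Rightarrow> 'f) \<Rightarrow> ('v \<Rightarrow> 'v) \<Rightarrow> 'f" ..
  let ?S = "isotypic (Grp G) (sub_rep T) (natural_rep smul)" and ?T = "isotypic (Grp G) (sub_rep T) regular"
  have "dim ?S = dim {x\<in>?S. \<forall>i<k. coeffs (v i) x = 0} + k * n.dim ?T"
  proof (rule dim_common_kernel_eq)
    show "subspace ?S" using isotypic_subspace(1)[OF is_rep_natural] by simp
    show "n.subspace ?T" using isotypic_subspace(1)[OF is_rep_reg] by (simp add: regular_simps(1))
    show "fin_dim fun_scale ?T" using n.fin_dim_subset[OF fin_dim_reg isotypic_subspace(2)[OF is_rep_reg]] .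
    show "coeffs (v i) x \<in> ?T" if "x \<in> ?S" for i x
      by (rule isotypic_functorial[OF is_rep_natural is_rep_reg coeffs_hom that])
    show "?T \<subseteq> coeffs (v j) ` {x\<in>?S. \<forall>i<k. i \<noteq> j \<longrightarrow> coeffs (v i) x = 0}" if "j < k" for j
      by (rule coefficients_onto[OF v T that])
  qed (rule fin_dim_any coeffs_linear)+
  moreover have "{x\<in>?S. \<forall>i<k. coeffs (v i) x = 0} = ?S \<inter> perp (orbit_span k v)"
    using perp_orbit_span_coeffs by blast
  ultimately show ?thesis by simp
qed

lemma subrep_in_isotypic:
  assumes "subrep (Grp G) T (natural_rep smul)"
  shows "T \<subseteq> isotypic (Grp G) (sub_rep T) (natural_rep smul)"
proof
  fix x assume "x \<in> T"
  moreover have "rep_hom (Grp G) (sub_rep T) (natural_rep smul) (\<lambda>x. x)" by (rule rep_homI) auto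
  ultimately show "x \<in> isotypic (Grp G) (sub_rep T) (natural_rep smul)"
    using isotypic_hom[OF is_rep_natural, of "sub_rep T" "\<lambda>x. x" x] by simp
qed

lemma irreducible_model:
  assumes "subrep (Grp G) T (natural_rep smul)" "irreducible_rep (Grp G) (sub_rep T)"
  obtains \<pi> :: "('f, nat \<Rightarrow> 'f, 'v \<Rightarrow> 'v) rep" where "\<pi> \<in> irreps (Grp G)" "rep_iso (Grp G) (sub_rep T) \<pi>"
proof -
  have r: "is_rep (Grp G) (sub_rep T)" by (rule is_rep_restrict[OF assms(1)])
  obtain \<pi> :: "('f, nat \<Rightarrow> 'f, 'v \<Rightarrow> 'v) rep"
    where \<pi>: "scl \<pi> = fun_scale" "is_rep (Grp G) \<pi>" "rep_iso (Grp G) (sub_rep T) \<pi>"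
    by (rule exists_sequence_model[OF r]) (simp add: fin_dim_any)
  have "irreducible_rep (Grp G) \<pi>" by (rule rep_iso_irreducible[OF assms(2) \<pi>(2,3)])
  then show thesis using that \<pi> unfolding irreps_def by blast
qed

text \<open>The part of the complement orthogonal to its fixed vectors has no trivial irreducible subspace, and a nontrivial one would
  make the isotypic component of its type larger than the inequality permits.\<close>

lemma complement_fixed:
  assumes star: "star_condition smul ip G k" and v: "v \<in> general_position k"
  shows "perp (orbit_span k v) \<subseteq> fixed"
proof -
  let ?N = "perp (orbit_span k v)"
  let ?F = "?N \<inter> fixed"
  let ?Q = "?N \<inter> perp ?F"
  have F: "subspace ?F" by (rule subspace_inter[OF subspace_perp subspace_fixed])
  have GF: "g x \<in> ?F" if "g \<in> G" "x \<in> ?F" for g x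
  proof -
    have "g x = x" using that unfolding fixed_def by blast
    then show ?thesis using that(2) by simp
  qed
  have GQ: "g x \<in> perp ?F" if "g \<in> G" "x \<in> perp ?F" for g x
    by (rule perp_invariant[of ?F g x]) (use that GF in blast)+
  have Q: "subrep (Grp G) ?Q (natural_rep smul)"
    unfolding subrep_natural
    using subspace_inter[OF subspace_perp subspace_perp] perp_orbit_span_invariant GQ by blast
  have "?Q = {0}"
  proof (rule ccontr)
    assume "?Q \<noteq> {0}"
    then obtain T where T: "subrep (Grp G) T (natural_rep smul)" "T \<subseteq> ?Q" "irreducible_rep (Grp G) (sub_rep T)"
      using exists_irreducible_subrep[OF is_rep_natural Q] fin_dim_any by auto
    have subT: "subspace T" using T(1) unfolding subrep_natural by blast
    have T0: "T \<noteq> {0}" using T(3) unfolding irreducible_rep_def by simp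
    have r: "is_rep (Grp G) (sub_rep T)" by (rule is_rep_restrict[OF T(1)])
    obtain \<pi> :: "('f, nat \<Rightarrow> 'f, 'v \<Rightarrow> 'v) rep" where \<pi>: "\<pi> \<in> irreps (Grp G)" "rep_iso (Grp G) (sub_rep T) \<pi>"
      by (rule irreducible_model[OF T(1,3)])
    show False
    proof (cases "rep_iso (Grp G) \<pi> (trivial_rep :: ('f, 'f, 'v \<Rightarrow> 'v) rep)")
      case True
      have "rep_iso (Grp G) (trivial_rep :: ('f, 'f, 'v \<Rightarrow> 'v) rep) (sub_rep T)"
        by (rule rep_iso_sym[OF r rep_iso_trans[OF \<pi>(2) True]])
      then obtain S where S: "rep_hom (Grp G) (trivial_rep :: ('f, 'f, 'v \<Rightarrow> 'v) rep) (sub_rep T) S"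
          "bij_betw S UNIV T" unfolding rep_iso_iff by auto
      have "g x = x" if gx: "g \<in> G" "x \<in> T" for g x
      proof -
        obtain c where "x = S c" using S(2) gx(2) unfolding bij_betw_def by blast
        then show ?thesis using rep_homD(4)[OF S(1), of g c] gx(1) by simp
      qed
      then have "T \<subseteq> ?F" using T(2) unfolding fixed_def by blast
      then have "T \<subseteq> {0}" using T(2) perp_disjoint by blast
      with T0 subspace_0[OF subT] show False by blast
    next
      case False
      let ?S = "isotypic (Grp G) (sub_rep T) (natural_rep smul)"
      have "dim (isotypic (Grp G) \<pi> (natural_rep smul)) \<le> k * vector_space.dim fun_scale (isotypic (Grp G) \<pi> regular)"
        using star \<pi>(1) False unfolding star_condition_iff by (auto split: if_splits)
      then have "dim ?S \<le> k * vector_space.dim fun_scale (isotypic (Grp G) (sub_rep T) regular)"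
        unfolding isotypic_iso[OF is_rep_natural r \<pi>(2)] isotypic_iso[OF is_rep_reg r \<pi>(2)] .
      moreover have TN: "T \<subseteq> ?N" using T(2) by blast
      ultimately have "dim (?S \<inter> ?N) = 0"
        using isotypic_dim_general_position[OF v T(1,3) TN] by simp
      moreover have "subspace (?S \<inter> ?N)"
        using isotypic_subspace(1)[OF is_rep_natural] by (intro subspace_inter subspace_perp) simp
      ultimately have "?S \<inter> ?N = {0}" using dim_eq_0_imp[OF fin_dim_any] by blast
      then have "T \<subseteq> {0}" using TN subrep_in_isotypic[OF T(1)] by blast
      with T0 subspace_0[OF subT] show False by blast
    qed
  qed
  define P where "P = proj ?F"
  note P = proj_props[OF F, folded P_def]
  show ?thesis
  proof
    fix x assume x: "x \<in> ?N"
    have "P x \<in> ?N" using P(2) by blast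
    then have "x - P x \<in> ?N" using x subspace_diff[OF subspace_perp] by blast
    then have "x - P x \<in> ?Q" using P(4) by blast
    then have "x = P x" using \<open>?Q = {0}\<close> by auto
    then show "x \<in> fixed" using P(2)[of x] by auto
  qed
qed

text \<open>All of the complement is fixed, so \<open>isotypic_dim_general_position\<close> for the trivial representation reads
  \<open>dim fixed = dim N + k\<close>.\<close>

lemma complement_small:
  assumes star: "star_condition smul ip G k" and v: "v \<in> general_position k"
    and ne: "perp (orbit_span k v) \<noteq> {0}"
  shows "enat (dim (perp (orbit_span k v))) < min_nontrivial_dim TYPE('f) (Grp G)"
proof -
  let ?N = "perp (orbit_span k v)"
  note all_fixed = complement_fixed[OF star v]
  have N: "subrep (Grp G) ?N (natural_rep smul)"
    unfolding subrep_natural using subspace_perp perp_orbit_span_invariant by blast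
  then obtain T where T: "subrep (Grp G) T (natural_rep smul)" "T \<subseteq> ?N" "irreducible_rep (Grp G) (sub_rep T)"
    using exists_irreducible_subrep[OF is_rep_natural N] fin_dim_any ne by auto
  have subT: "subspace T" using T(1) unfolding subrep_natural by blast
  have r: "is_rep (Grp G) (sub_rep T)" by (rule is_rep_restrict[OF T(1)])
  have "T \<noteq> {0}" using T(3) unfolding irreducible_rep_def by simp
  then obtain x where x: "x \<in> T" "x \<noteq> 0" using subspace_0[OF subT] by blast
  have h: "rep_hom (Grp G) trivial_rep (sub_rep T) (\<lambda>c. scl (sub_rep T) c x)"
    by (rule rep_hom_from_trivial[OF r]) (use x(1) T(2) all_fixed in \<open>auto simp: fixed_def\<close>)
  have "bij_betw (\<lambda>c. scl (sub_rep T) c x) (spc (trivial_rep :: ('f, 'f, 'v \<Rightarrow> 'v) rep)) (spc (sub_rep T))"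
    by (rule schur[OF irreducible_trivial T(3) h, of 1]) (use x in auto)
  with h have "rep_iso (Grp G) (trivial_rep :: ('f, 'f, 'v \<Rightarrow> 'v) rep) (sub_rep T)"
    unfolding rep_iso_iff by blast
  then have Tt: "rep_iso (Grp G) (sub_rep T) (trivial_rep :: ('f, 'f, 'v \<Rightarrow> 'v) rep)"
    by (rule rep_iso_sym[OF is_rep_trivial])
  obtain \<pi> :: "('f, nat \<Rightarrow> 'f, 'v \<Rightarrow> 'v) rep" where \<pi>: "\<pi> \<in> irreps (Grp G)" "rep_iso (Grp G) (sub_rep T) \<pi>"
    by (rule irreducible_model[OF T(1,3)])
  have "rep_iso (Grp G) \<pi> (trivial_rep :: ('f, 'f, 'v \<Rightarrow> 'v) rep)"
    by (rule rep_iso_trans[OF rep_iso_sym[OF r \<pi>(2)] Tt])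
  then have "enat (dim fixed) + 1 \<le> enat k + min_nontrivial_dim TYPE('f) (Grp G)"
    using star \<pi>(1) unfolding star_condition_iff by (auto split: if_splits)
  moreover have "dim fixed = dim (fixed \<inter> ?N) + k"
    using isotypic_dim_general_position[OF v T(1,3,2)]
    unfolding isotypic_iso[OF is_rep_natural r Tt] isotypic_iso[OF is_rep_reg r Tt] fixed_eq_isotypic[symmetric]
    using dim_fixed_regular[OF group_Grp, where 'f='f] finite_G by simp
  moreover have "fixed \<inter> ?N = ?N" using all_fixed by blast
  ultimately show ?thesis by (cases "min_nontrivial_dim TYPE('f) (Grp G)") (auto simp: one_enat_def)
qed

section \<open>Recovering the group\<close>

lemma exists_partner:
  assumes "k \<ge> degree_C_over TYPE('f)" "i < k"
  obtains j where "j < k" "i \<noteq> j \<or> \<not> (\<forall>z::'f. z \<in> \<real>)"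
proof (cases "\<forall>z::'f. z \<in> \<real>")
  case True
  then have "k \<ge> 2" using assms(1) unfolding degree_C_over_def by simp
  then show thesis using that[of "if i = 0 then 1 else 0"] by auto
next
  case False
  then show thesis using that[of i] assms(2) by blast
qed

lemma general_position_free:
  assumes v: "v \<in> general_position k" and k: "k \<ge> degree_C_over TYPE('f)" "i < k"
    and gh: "g \<in> G" "h \<in> G" "g (v i) = h (v i)"
  shows "g = h"
proof -
  obtain j where j: "j < k" "i \<noteq> j \<or> \<not> (\<forall>z::'f. z \<in> \<real>)" by (rule exists_partner[OF k])
  then show ?thesis using general_position_gap[OF v gh(1,2) _ k(2) j] gh(3) by auto
qed

lemma card_orbit:
  assumes "v \<in> general_position k" "k \<ge> degree_C_over TYPE('f)" "i < k"
  shows "card (orbit G (v i)) = card G"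
  unfolding orbit_def by (intro card_image inj_onI) (rule general_position_free[OF assms])

text \<open>If \<open>f (g v\<^sub>i) = \<sigma>\<^sub>i(g) v\<^sub>i\<close>, comparing inner products of the images of \<open>g v\<^sub>i\<close> and \<open>v\<^sub>j\<close> gives \<open>\<sigma>\<^sub>i(g) = \<sigma>\<^sub>j(1) g\<close>
  for all partners \<open>i\<close>, \<open>j\<close>. Hence \<open>f\<close> acts on all orbits like \<open>\<sigma>\<^sub>0(1)\<close>.\<close>

lemma isometry_preserving_orbits:
  assumes v: "v \<in> general_position k" and k: "k \<ge> degree_C_over TYPE('f)" "k > 0"
    and f: "f \<in> carrier (Aut smul ip)" and pres: "\<And>i x. i < k \<Longrightarrow> x \<in> orbit G (v i) \<Longrightarrow> f x \<in> orbit G (v i)"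
  obtains c where "c \<in> G" "\<And>x. x \<in> orbit_span k v \<Longrightarrow> f x = c x"
proof -
  have "\<forall>i g. \<exists>s. i < k \<and> g \<in> G \<longrightarrow> s \<in> G \<and> f (g (v i)) = s (v i)"
    using pres unfolding orbit_def by blast
  then obtain \<sigma> where \<sigma>: "\<And>i g. i < k \<Longrightarrow> g \<in> G \<Longrightarrow> \<sigma> i g \<in> G \<and> f (g (v i)) = \<sigma> i g (v i)" by metis
  have key: "\<sigma> i g x = \<sigma> j id (g x)"
    if i: "i < k" and j: "j < k" and or: "i \<noteq> j \<or> \<not> (\<forall>z::'f. z \<in> \<real>)" and g: "g \<in> G" for i j g x
  proof -
    have s: "\<sigma> i g \<in> G" "\<sigma> j id \<in> G" using \<sigma> i j g id_G by blast+
    have "ip (g (v i)) (v j) = ip (f (g (v i))) (f (v j))" using Aut_ip[OF f] by simp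
    also have "\<dots> = ip (\<sigma> i g (v i)) (\<sigma> j id (v j))" using \<sigma>[OF i g] \<sigma>[OF j id_G] by simp
    also have "\<dots> = ip ((ginv (\<sigma> j id) \<circ> \<sigma> i g) (v i)) (v j)"
      using G_ip[OF s(2), of "ginv (\<sigma> j id) (\<sigma> i g (v i))" "v j"] s(2) by simp
    finally have "g = ginv (\<sigma> j id) \<circ> \<sigma> i g"
      using general_position_gap[OF v g comp_G[OF ginv_G[OF s(2)] s(1)] _ i j or] by blast
    then have "\<sigma> j id (g x) = \<sigma> j id (ginv (\<sigma> j id) (\<sigma> i g x))" by (metis comp_apply)
    then show ?thesis using s(2) by simp
  qed
  \<comment> \<open>for \<open>i = 0\<close> over the reals, \<open>0\<close> is not its own partner and the comparison goes through another \<open>j\<close>\<close>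
  let ?c = "\<sigma> 0 id"
  have c: "f (g (v i)) = ?c (g (v i))" if i: "i < k" and g: "g \<in> G" for i g
  proof (cases "i \<noteq> 0 \<or> \<not> (\<forall>z::'f. z \<in> \<real>)")
    case True
    then show ?thesis using key[OF i k(2) True g] \<sigma>[OF i g] by simp
  next
    case False
    obtain j where j: "j < k" "0 \<noteq> j \<or> \<not> (\<forall>z::'f. z \<in> \<real>)" by (rule exists_partner[OF k])
    then have j': "j \<noteq> 0 \<or> \<not> (\<forall>z::'f. z \<in> \<real>)" by auto
    have "f (g (v i)) = \<sigma> i g (v i)" using \<sigma>[OF i g] by blast
    also have "\<dots> = \<sigma> j id (g (v i))" using key[OF i j(1) _ g] j(2) False by simp
    also have "\<dots> = ?c (g (v i))" using key[OF j(1) k(2) j' id_G] by simp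
    finally show ?thesis .
  qed
  have cG: "?c \<in> G" using \<sigma>[OF k(2) id_G] by blast
  have "subspace {x. f x = ?c x}"
    using Aut_add[OF f] Aut_scale[OF f] Aut_scale[OF f, of 0 0] G_add[OF cG] G_scale[OF cG] G_0[OF cG]
    by (auto simp: subspace_def)
  moreover have "{h (v i) | h i. h \<in> G \<and> i < k} \<subseteq> {x. f x = ?c x}" using c by blast
  ultimately have "orbit_span k v \<subseteq> {x. f x = ?c x}" unfolding orbit_span_def by (rule span_minimal[rotated])
  then show thesis using that[of ?c] cG by blast
qed

lemma orbit_span_eq: "orbit_span k v = span (\<Union>((\<lambda>i. orbit G (v i)) ` {..<k}))"
  unfolding orbit_span_def orbit_def by (rule arg_cong[where f=span]) auto

end

text \<open>The sequence model makes the bound available for representations on any space.\<close>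

lemma min_nontrivial_dim_le:
  fixes \<sigma> :: "('f::field, 'w::ab_group_add, 'g) rep"
  assumes s: "is_rep G \<sigma>" and fd: "fin_dim (scl \<sigma>) (spc \<sigma>)" and nt: "g \<in> carrier G" "x \<in> spc \<sigma>" "act \<sigma> g x \<noteq> x"
  shows "min_nontrivial_dim TYPE('f) G \<le> enat (vector_space.dim (scl \<sigma>) (spc \<sigma>))"
proof -
  obtain \<pi> :: "('f, nat \<Rightarrow> 'f, 'g) rep" where \<pi>: "scl \<pi> = fun_scale" "is_rep G \<pi>" "rep_iso G \<sigma> \<pi>"
    by (rule exists_sequence_model[OF s fd])
  obtain T where T: "rep_hom G \<sigma> \<pi> T" "bij_betw T (spc \<sigma>) (spc \<pi>)" using \<pi>(3) unfolding rep_iso_iff by blast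
  have "T (act \<sigma> g x) \<noteq> T x"
    using T(2) nt is_repD(3)[OF s nt(1,2)] unfolding bij_betw_def inj_on_def by blast
  then have "act \<pi> g (T x) \<noteq> T x" using rep_homD(4)[OF T(1) nt(1,2)] by simp
  then have "\<not> (\<forall>g\<in>carrier G. \<forall>x\<in>spc \<pi>. act \<pi> g x = x)"
    using nt(1) rep_homD(1)[OF T(1) nt(2)] by blast
  moreover have "\<exists>B. finite B \<and> spc \<pi> \<subseteq> module.span (scl \<pi>) B"
    using rep_iso_dim(2)[OF s \<pi>(2,3) fd] unfolding fin_dim_def .
  ultimately have "min_nontrivial_dim TYPE('f) G \<le> enat (vector_space.dim (scl \<pi>) (spc \<pi>))"
    unfolding min_nontrivial_dim_def using \<pi>(1,2) by (intro Inf_lower) blast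
  then show ?thesis using rep_iso_dim(1)[OF s \<pi>(2,3)] by simp
qed

text \<open>On the span \<open>W\<close> of the orbits, every element of \<open>H\<close> agrees with one of \<open>G\<close>. As the orders are equal, this inverts to an
  isomorphism \<open>d\<close> from \<open>G\<close> to \<open>H\<close>, through which \<open>G\<close> acts on the complement of \<open>W\<close>.\<close>

lemma (in fd_hilbert_space) generic_orbits_determine:
  assumes k: "k \<ge> degree_C_over TYPE('f)" "k > 0"
    and G: "finite_subgroup G (Aut smul ip)" and H: "finite_subgroup H (Aut smul ip)"
    and star: "star_condition smul ip G k"
    and v: "v \<in> isometry_group.general_position smul ip G k"
    and w: "w \<in> isometry_group.general_position smul ip H k"
    and eq: "(\<lambda>i. orbit G (v i)) ` {..<k} = (\<lambda>i. orbit H (w i)) ` {..<k}"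
  shows "G = H"
proof -
  interpret G: isometry_group smul ip G by unfold_locales (rule G)
  interpret H: isometry_group smul ip H by unfold_locales (rule H)
  define W where "W = G.orbit_span k v"
  have WH: "W = H.orbit_span k w" unfolding W_def G.orbit_span_eq H.orbit_span_eq eq ..
  have subW: "subspace W" unfolding W_def by (rule G.subspace_orbit_span)
  have card: "card G = card H"
  proof -
    obtain j where j: "j < k" "orbit G (v 0) = orbit H (w j)" using eq k(2) by blast
    then show ?thesis using G.card_orbit[OF v k] H.card_orbit[OF w k(1) j(1)] by simp
  qed
  have faithful: "h = h'" if "h \<in> H" "h' \<in> H" "\<And>x. x \<in> W \<Longrightarrow> h x = h' x" for h h'
    using H.general_position_free[OF w k that(1,2)] that(3) H.orbit_span_base'[OF k(2), of w] unfolding WH by blast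
  have "\<exists>c. c \<in> G \<and> (\<forall>x\<in>W. h x = c x)" if h: "h \<in> H" for h
  proof -
    have "h x \<in> orbit G (v i)" if i: "i < k" and x: "x \<in> orbit G (v i)" for i x
    proof -
      obtain j where j: "orbit G (v i) = orbit H (w j)" using eq i by blast
      then show ?thesis using x H.comp_G[OF h] unfolding j orbit_def by (auto simp: image_iff) (metis comp_apply)
    qed
    from G.isometry_preserving_orbits[OF v k H.G_Aut[OF h] this] show ?thesis unfolding W_def by metis
  qed
  then obtain c where c: "\<And>h. h \<in> H \<Longrightarrow> c h \<in> G" "\<And>h x. h \<in> H \<Longrightarrow> x \<in> W \<Longrightarrow> h x = c h x" by metis
  have "inj_on c H"
  proof (rule inj_onI)
    fix h h' assume "h \<in> H" "h' \<in> H" "c h = c h'"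
    then show "h = h'" using c(2) faithful by metis
  qed
  then have "card (c ` H) = card G" using card by (simp add: card_image)
  moreover have "c ` H \<subseteq> G" using c(1) by blast
  ultimately have "c ` H = G" using card_subset_eq[OF G.finite_G] by blast
  then have "\<forall>g\<in>G. \<exists>h. h \<in> H \<and> (\<forall>x\<in>W. h x = g x)" using c(2) by blast
  then obtain d where d: "\<And>g. g \<in> G \<Longrightarrow> d g \<in> H" "\<And>g x. g \<in> G \<Longrightarrow> x \<in> W \<Longrightarrow> d g x = g x" by metis
  have d_id: "d id = id" using faithful[OF d(1)[OF G.id_G] H.id_G] d(2)[OF G.id_G] by simp
  have d_comp: "d (g \<circ> g') = d g \<circ> d g'" if g: "g \<in> G" and g': "g' \<in> G" for g g'
  proof (rule faithful[OF d(1)[OF G.comp_G[OF g g']] H.comp_G[OF d(1)[OF g] d(1)[OF g']]])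
    fix x assume x: "x \<in> W"
    have "g' x \<in> W" using G.orbit_span_invariant[OF g'] x unfolding W_def by blast
    then show "d (g \<circ> g') x = (d g \<circ> d g') x"
      using d(2)[OF G.comp_G[OF g g'] x] d(2)[OF g] d(2)[OF g' x] by simp
  qed
  let ?N = "perp W"
  have fixN: "g x = x" if "g \<in> G" "x \<in> ?N" for g x
    using G.complement_fixed[OF star v] that unfolding W_def G.fixed_def by blast
  have dN: "d g x = x" if g: "g \<in> G" and x: "x \<in> ?N" for g x
  proof (rule ccontr)
    assume ne: "d g x \<noteq> x"
    have "x \<noteq> 0" using ne H.G_0[OF d(1)[OF g]] by metis
    then have "?N \<noteq> {0}" using x by blast
    then have small: "enat (dim ?N) < min_nontrivial_dim TYPE('f) (Grp G)"
      using G.complement_small[OF star v] unfolding W_def by blast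
    let ?\<rho> = "\<lparr>scl = smul, spc = ?N, act = d\<rparr> :: ('f, 'v, 'v \<Rightarrow> 'v) rep"
    have "is_rep (Grp G) ?\<rho>"
    proof (rule is_repI)
      fix g x assume "g \<in> carrier (Grp G)" "x \<in> spc ?\<rho>"
      then show "act ?\<rho> g x \<in> spc ?\<rho>" using H.perp_orbit_span_invariant[OF d(1)] unfolding WH by simp
    qed (use d(1) d_id d_comp in \<open>auto simp: vector_space_axioms subspace_perp H.G_add H.G_scale\<close>)
    from min_nontrivial_dim_le[OF this, of g x] small g x ne show False by (simp add: fin_dim_any)
  qed
  define P where "P = proj W"
  note P = proj_props[OF subW, folded P_def]
  have "g \<in> H" if g: "g \<in> G" for g
  proof -
    have "d g x = g x" for x
    proof -
      have "d g (P x + (x - P x)) = g (P x + (x - P x))"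
        unfolding H.G_add[OF d(1)[OF g]] G.G_add[OF g] d(2)[OF g P(2)] dN[OF g P(4)] fixN[OF g P(4)] ..
      then show ?thesis by simp
    qed
    then have "d g = g" by (intro ext)
    then show ?thesis using d(1)[OF g] by simp
  qed
  then have "G \<subseteq> H" by blast
  then show ?thesis using card_subset_eq[OF H.finite_G] card by blast
qed

theorem corollary3p5:
  fixes smul :: "'f::real_or_complex \<Rightarrow> 'v::ab_group_add \<Rightarrow> 'v"
    and ip :: "'v \<Rightarrow> 'v \<Rightarrow> 'f"
    and k :: nat
  assumes "fd_hilbert_space smul ip"
    and "k > 0"
  shows
    "(\<forall>G. finite_subgroup G (Aut smul ip) \<and> \<not> star_condition smul ip G k \<longrightarrow>
        (\<forall>v \<in> {..<k} \<rightarrow>\<^sub>E UNIV. \<exists>H. subgroup H (Aut smul ip) \<and> H \<noteq> G \<and>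
          (\<forall>i<k. \<exists>u. orbit G (v i) = orbit H u))) \<and>
     (k \<ge> degree_C_over TYPE('f) \<longrightarrow>
        (\<exists>K :: ('v \<Rightarrow> 'v) set \<Rightarrow> (nat \<Rightarrow> 'v) set.
          (\<forall>H. finite_subgroup H (Aut smul ip) \<longrightarrow> generic (htopology_pow ip k) (K H)) \<and>
          (\<forall>G H v w.
            finite_subgroup G (Aut smul ip) \<and> finite_subgroup H (Aut smul ip) \<and>
            star_condition smul ip G k \<and> v \<in> K G \<and> w \<in> K H \<and>
            (\<lambda>i. orbit G (v i)) ` {..<k} = (\<lambda>i. orbit H (w i)) ` {..<k} \<longrightarrow> G = H)))"
proof (intro conjI allI impI ballI)
  interpret fd_hilbert_space smul ip by fact
  fix G and v :: "nat \<Rightarrow> 'v"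
  assume G: "finite_subgroup G (Aut smul ip) \<and> \<not> star_condition smul ip G k"
  then interpret isometry_group smul ip G by unfold_locales blast
  have "\<exists>H. subgroup H (Aut smul ip) \<and> H \<noteq> G \<and> (\<forall>i<k. orbit H (v i) = orbit G (v i))"
    using orbits_fail_to_determine G by blast
  then show "\<exists>H. subgroup H (Aut smul ip) \<and> H \<noteq> G \<and> (\<forall>i<k. \<exists>u. orbit G (v i) = orbit H u)" by metis
next
  assume k: "k \<ge> degree_C_over TYPE('f)"
  interpret fd_hilbert_space smul ip by fact
  let ?K = "\<lambda>G. isometry_group.general_position smul ip G k"
  have "generic (htopology_pow ip k) (?K H)" if "finite_subgroup H (Aut smul ip)" for H
  proof -
    interpret isometry_group smul ip H by unfold_locales (rule that)
    show ?thesis by (rule generic_general_position)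
  qed
  then show "\<exists>K :: ('v \<Rightarrow> 'v) set \<Rightarrow> (nat \<Rightarrow> 'v) set.
      (\<forall>H. finite_subgroup H (Aut smul ip) \<longrightarrow> generic (htopology_pow ip k) (K H)) \<and>
      (\<forall>G H v w.
        finite_subgroup G (Aut smul ip) \<and> finite_subgroup H (Aut smul ip) \<and>
        star_condition smul ip G k \<and> v \<in> K G \<and> w \<in> K H \<and>
        (\<lambda>i. orbit G (v i)) ` {..<k} = (\<lambda>i. orbit H (w i)) ` {..<k} \<longrightarrow> G = H)"
  proof (intro exI[of _ ?K] conjI allI impI)
    fix G H and v w :: "nat \<Rightarrow> 'v"
    assume "finite_subgroup G (Aut smul ip) \<and> finite_subgroup H (Aut smul ip) \<and>
        star_condition smul ip G k \<and> v \<in> ?K G \<and> w \<in> ?K H \<and>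
        (\<lambda>i. orbit G (v i)) ` {..<k} = (\<lambda>i. orbit H (w i)) ` {..<k}"
    then show "G = H" by (elim conjE) (rule generic_orbits_determine[OF k assms(2)])
  qed
qed

end
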